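(* Let $D_1$ and $D_2$ be two link diagrams that are transformed into each other by applying finitely many Reidemeister moves I and III. Then there exists an I-generalized ordered sequence that transforms $D_1$ into $D_2$. Moreover, given any finite sequence of Reidemeister moves I and III transforming $D_1$ into $D_2$ that contains exactly $a$ $\Omega_1^{\uparrow}$ moves, $b$ $\Omega_3$ moves and $c$ $\Omega_1^{\downarrow}$ moves, the I-generalized ordered sequence from $D_1$ to $D_2$ can be taken to consist of exactly $a$ $\Omega_1^{\uparrow}$ moves, $b$ $\Omega_3^{*}$ moves and $c$ $\Omega_1^{\downarrow}$ moves.
   Context: Link diagrams are considered on $\mathbb{S}^2$, up to isotopy of the sphere. A Reidemeister move I ($\Omega_1$) is the local move that, inside a disk, exchanges a single crossingless arc and an arc with exactly one self-crossing bounding a monogon (a kink, of either crossing type and on either side). It is denoted $\Omega_1^{\uparrow}$ when it creates the crossing and $\Omega_1^{\downarrow}$ when it removes the crossing. A Reidemeister move III ($\Omega_3$) is the usual local move inside a disk containing three arcs (a top, a middle and a bottom one) crossing pairwise once and bounding a triangle, which passes one arc across the crossing of the other two. A rectangle is a $1$-tangle diagram (a diagram in a disk of a single arc with its two endpoints on the boundary) that is obtained from the trivial crossingless $1$-tangle diagram by applying finitely many (possibly zero) $\Omega_1^{\uparrow}$ moves inside the disk. A Reidemeister move III* (an $\Omega_3^{*}$ move) is a Reidemeister move III with three rectangles: it is the local move obtained from an $\Omega_3$ move by inserting a rectangle, possibly trivial, into each of the three edges of the triangle before the move, and inserting the same $1$-tangle diagram, on the same strand, into the corresponding edge of the triangle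 after the move. In particular every $\Omega_3$ move is an $\Omega_3^{*}$ move (all rectangles trivial). An I-generalized ordered sequence is a sequence of $\Omega_1^{\uparrow}$ moves, followed by a sequence of $\Omega_3^{*}$ moves, followed by a sequence of $\Omega_1^{\downarrow}$ moves; each of the three sequences is finite and may be empty, and the empty sequence (no move, between identical diagrams) is included. *)

theory Defs
  imports Main "HOL-Library.Disjoint_Sets" "HOL-Combinatorics.Transposition"
begin

text \<open>
  Unoriented link diagrams on the (oriented) sphere, up to isotopy, are encoded as combinatorial maps. Their vertices are the
  crossings (four darts) and auxiliary markers (two darts), a marker being a point chosen in the
  interior of a strand. Every crossingless circle carries at least one marker, which is how such
  components are represented; elsewhere markers are optional and are forgotten by isotopy.
  A dart is a half-edge leaving its vertex; \<open>rot\<close> is the next dart counterclockwise at the same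
  vertex, \<open>opp\<close> the other half of the same edge, and \<open>over\<close> the set of darts of overcrossing strands.

  A diagram need not be connected, so a region (component of the complement of the diagram in the
  sphere) may have several boundary walks and is extra data: \<open>regions\<close> is the partition of the
  darts in which \<open>d\<close> is put in the class of the region on the right of \<open>d\<close>.
\<close>

record diagram =
  darts :: "nat set"
  rot :: "nat \<Rightarrow> nat"
  opp :: "nat \<Rightarrow> nat"
  over :: "nat set"
  regions :: "nat set set"

definition marker :: "diagram \<Rightarrow> nat \<Rightarrow> bool" where
  "marker D d \<longleftrightarrow> d \<in> darts D \<and> rot D d \<noteq> d \<and> rot D (rot D d) = d"

definition crossing :: "diagram \<Rightarrow> nat \<Rightarrow> bool" where
  "crossing D d \<longleftrightarrow> d \<in> darts D \<and> rot D (rot D d) \<noteq> d \<and> rot D (rot D (rot D (rot D d))) = d"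

text \<open>The next dart along the boundary walk of the region on the right of \<open>d\<close>.\<close>

definition face :: "diagram \<Rightarrow> nat \<Rightarrow> nat" where
  "face D d = rot D (opp D d)"

definition orbits :: "nat set \<Rightarrow> (nat \<Rightarrow> nat) set \<Rightarrow> nat set set" where
  "orbits A F = A // {(x, f x) | x f. x \<in> A \<and> f \<in> F}\<^sup>*"

text \<open>The complement of the empty diagram is one region, although it has no dart on its boundary.\<close>

definition region_count :: "diagram \<Rightarrow> nat" where
  "region_count D = (if darts D = {} then 1 else card (regions D))"

text \<open>
  The last three conditions say that the surface is a sphere. Each connected component of
  the map has Euler characteristic at most 2, so the equation \<open>V + F = E + 2C\<close> makes all of
  them planar. In the bipartite graph of components and regions, with one edge for each boundary
  walk, connectedness together with \<open>C + R = F + 1\<close> says that this graph is a tree.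
\<close>

definition link_diagram :: "diagram \<Rightarrow> bool" where
  "link_diagram D \<longleftrightarrow>
     finite (darts D) \<and>
     (\<forall>d\<in>darts D. opp D d \<in> darts D \<and> opp D d \<noteq> d \<and> opp D (opp D d) = d) \<and>
     (\<forall>d\<in>darts D. rot D d \<in> darts D \<and> (marker D d \<or> crossing D d)) \<and>
     over D \<subseteq> darts D \<and>
     (\<forall>d. marker D d \<longrightarrow> d \<notin> over D) \<and>
     (\<forall>d. crossing D d \<longrightarrow> (d \<in> over D \<longleftrightarrow> rot D d \<notin> over D)) \<and>
     partition_on (darts D) (regions D) \<and>
     (\<forall>r\<in>regions D. face D ` r \<subseteq> r) \<and>
     card (orbits (darts D) {rot D}) + card (orbits (darts D) {face D}) =
       card (orbits (darts D) {opp D}) + 2 * card (orbits (darts D) {rot D, opp D}) \<and>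
     card (orbits (darts D) {rot D, opp D}) + region_count D =
       card (orbits (darts D) {face D}) + 1 \<and>
     (\<forall>S. S \<subseteq> darts D \<and> S \<noteq> {} \<and> rot D ` S \<subseteq> S \<and> opp D ` S \<subseteq> S \<and>
        (\<forall>r\<in>regions D. r \<inter> S \<noteq> {} \<longrightarrow> r \<subseteq> S) \<longrightarrow> S = darts D)"


text \<open>Isotopy: relabelling, which preserves the orientation of the sphere, and adding or forgetting
  markers. The only marker of a crossingless circle is not removable.\<close>

definition diagram_iso :: "(nat \<Rightarrow> nat) \<Rightarrow> diagram \<Rightarrow> diagram \<Rightarrow> bool" where
  "diagram_iso f D D' \<longleftrightarrow>
     bij_betw f (darts D) (darts D') \<and>
     (\<forall>d\<in>darts D. f (rot D d) = rot D' (f d) \<and> f (opp D d) = opp D' (f d)) \<and>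
     f ` over D = over D' \<and>
     (\<lambda>r. f ` r) ` regions D = regions D'"

definition removable_marker :: "diagram \<Rightarrow> nat \<Rightarrow> bool" where
  "removable_marker D v \<longleftrightarrow> marker D v \<and> opp D v \<noteq> rot D v"

definition remove_marker :: "nat \<Rightarrow> diagram \<Rightarrow> diagram" where
  "remove_marker v D = (let w = rot D v; a = opp D v; b = opp D w in
     \<lparr> darts = darts D - {v, w}, rot = rot D, opp = (opp D)(a := b, b := a), over = over D,
       regions = (\<lambda>r. r - {v, w}) ` regions D \<rparr>)"

definition isotopy_step :: "diagram \<Rightarrow> diagram \<Rightarrow> bool" where
  "isotopy_step D D' \<longleftrightarrow> link_diagram D \<and> link_diagram D' \<and>
     ((\<exists>f. diagram_iso f D D') \<or> (\<exists>v. removable_marker D v \<and> D' = remove_marker v D))"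

definition isotopic :: "diagram \<Rightarrow> diagram \<Rightarrow> bool" where
  "isotopic = equivclp isotopy_step"


text \<open>
  A kink is a crossing with a region whose boundary is the single dart \<open>x\<close>; counterclockwise the
  crossing is \<open>opp x, x, u, v\<close>, so that the strand enters at \<open>u\<close>, runs around the loop
  \<open>{x, opp x}\<close> and leaves at \<open>v\<close>. Removing it leaves an arc with the marker \<open>{u, v}\<close>.
\<close>

definition kink :: "diagram \<Rightarrow> nat \<Rightarrow> bool" where
  "kink D x \<longleftrightarrow> crossing D x \<and> {x} \<in> regions D"

definition remove_kink :: "nat \<Rightarrow> diagram \<Rightarrow> diagram" where
  "remove_kink x D = (let y = opp D x; u = rot D x; v = rot D u in
     \<lparr> darts = darts D - {x, y}, rot = (rot D)(u := v, v := u), opp = opp D,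
       over = over D - {x, y, u, v},
       regions = (\<lambda>r. r - {x, y}) ` (regions D - {{x}}) \<rparr>)"

definition omega1_down :: "diagram \<Rightarrow> diagram \<Rightarrow> bool" where
  "omega1_down D D' \<longleftrightarrow> link_diagram D \<and> link_diagram D' \<and>
     (\<exists>x. kink D x \<and> D' = remove_kink x D)"

definition omega1_up :: "diagram \<Rightarrow> diagram \<Rightarrow> bool" where
  "omega1_up D D' \<longleftrightarrow> omega1_down D' D"


text \<open>
  The region on the right of \<open>t1, t2, t3\<close> is a triangle with three distinct vertices, and one of
  the three strands passes over, another one under, both of the others.
\<close>

definition omega3_triangle :: "diagram \<Rightarrow> nat \<Rightarrow> nat \<Rightarrow> nat \<Rightarrow> bool" where
  "omega3_triangle D t1 t2 t3 \<longleftrightarrow>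
     crossing D t1 \<and> crossing D t2 \<and> crossing D t3 \<and>
     {t1, t2, t3} \<in> regions D \<and> face D t1 = t2 \<and> face D t2 = t3 \<and> face D t3 = t1 \<and>
     (\<forall>n. (rot D ^^ n) t1 \<noteq> t2 \<and> (rot D ^^ n) t2 \<noteq> t3 \<and> (rot D ^^ n) t3 \<noteq> t1) \<and>
     (\<exists>t\<in>{t1, t2, t3}. t \<in> over D \<and> opp D t \<in> over D) \<and>
     (\<exists>t\<in>{t1, t2, t3}. t \<notin> over D \<and> opp D t \<notin> over D)"

text \<open>
  The third move exchanges, on each of the three strands, the two crossings that the strand
  passes through. With \<open>q = rot \<circ> rot\<close> (the straight continuation through a crossing) the darts on
  the strand of \<open>t\<close> are, in order, \<open>q t, t, s, q s\<close> where \<open>s = opp t\<close>; after the move they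
  occupy the positions of \<open>s, q s, q t, t\<close>. This is the involution \<open>m\<close> below. The edges, that is
  \<open>opp\<close>, do not change: the new triangle has the same three edges, now with \<open>s1, s2, s3\<close> along its
  boundary, while the dart \<open>t1\<close> is moved to the region that was opposite to the triangle at the
  crossing of the other two strands (the region of \<open>q t3\<close>), and so on cyclically.
\<close>

definition omega3_swap :: "diagram \<Rightarrow> nat \<Rightarrow> nat \<Rightarrow> nat" where
  "omega3_swap D t =
     (let q = \<lambda>d. rot D (rot D d); s = opp D t in transpose t (q s) \<circ> transpose s (q t))"

definition omega3_result :: "nat \<Rightarrow> nat \<Rightarrow> nat \<Rightarrow> diagram \<Rightarrow> diagram" where
  "omega3_result t1 t2 t3 D =
     (let q = \<lambda>d. rot D (rot D d); s1 = opp D t1; s2 = opp D t2; s3 = opp D t3;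
          m = omega3_swap D t1 \<circ> omega3_swap D t2 \<circ> omega3_swap D t3 in
     \<lparr> darts = darts D, rot = m \<circ> rot D \<circ> m, opp = opp D, over = m ` over D,
       regions = insert {s1, s2, s3}
         ((\<lambda>r. (r - {t1, t2, t3, s1, s2, s3}) \<union>
               {t. t = t1 \<and> q t3 \<in> r \<or> t = t2 \<and> q t1 \<in> r \<or> t = t3 \<and> q t2 \<in> r})
          ` (regions D - {{t1, t2, t3}})) \<rparr>)"

definition omega3 :: "diagram \<Rightarrow> diagram \<Rightarrow> bool" where
  "omega3 D D' \<longleftrightarrow> link_diagram D \<and> link_diagram D' \<and>
     (\<exists>t1 t2 t3. omega3_triangle D t1 t2 t3 \<and> D' = omega3_result t1 t2 t3 D)"


text \<open>
  A 1-tangle diagram in a disk is encoded as a diagram \<open>T\<close> on the sphere with a distinguished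
  marker, to which the complement of the disk has been collapsed; \<open>b\<close> is the dart of this marker
  along which the strand starts, and the strand returns at \<open>rot T b\<close>. The first rule is the trivial
  1-tangle; the next three are isotopy in the disk and the last one is a move creating
  a crossing in the disk.
\<close>

inductive rectangle :: "diagram \<Rightarrow> nat \<Rightarrow> bool" where
  trivial: "link_diagram T \<Longrightarrow> marker T b \<Longrightarrow> darts T = {b, rot T b} \<Longrightarrow> rectangle T b"
| relabel: "rectangle T b \<Longrightarrow> link_diagram T' \<Longrightarrow> diagram_iso f T T' \<Longrightarrow> rectangle T' (f b)"
| unmark: "rectangle T b \<Longrightarrow> removable_marker T v \<Longrightarrow> v \<notin> {b, rot T b} \<Longrightarrow>
    link_diagram (remove_marker v T) \<Longrightarrow> rectangle (remove_marker v T) b"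
| mark: "rectangle (remove_marker v T) b \<Longrightarrow> removable_marker T v \<Longrightarrow> link_diagram T \<Longrightarrow>
    rectangle T b"
| add_kink: "rectangle (remove_kink x T) b \<Longrightarrow> kink T x \<Longrightarrow> b \<notin> {rot T x, rot T (rot T x)} \<Longrightarrow>
    link_diagram T \<Longrightarrow> rectangle T b"

text \<open>
  Insertion of a 1-tangle into the edge \<open>{d, opp d}\<close>, traversed from \<open>d\<close> to \<open>opp d\<close>; the darts of
  \<open>T\<close> have to be disjoint from those of \<open>D\<close>. The distinguished marker of \<open>T\<close> stays on the strand,
  right after the tangle. The regions on the two sides of the edge are united with those on the
  respective sides of the distinguished marker.
\<close>

definition insert_tangle :: "nat \<Rightarrow> diagram \<Rightarrow> nat \<Rightarrow> diagram \<Rightarrow> diagram" where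
  "insert_tangle d T b D = (let e = opp D d; f = opp T b; c = rot T b in
     \<lparr> darts = darts D \<union> darts T,
       rot = (\<lambda>x. if x \<in> darts T then rot T x else rot D x),
       opp = (\<lambda>x. if x \<in> darts T then opp T x else opp D x)(d := f, f := d, e := b, b := e),
       over = over D \<union> over T,
       regions = {r \<in> regions D. d \<notin> r \<and> e \<notin> r} \<union> {s \<in> regions T. b \<notin> s \<and> c \<notin> s} \<union>
         {r \<union> s | r s. r \<in> regions D \<and> s \<in> regions T \<and> (d \<in> r \<and> b \<in> s \<or> e \<in> r \<and> c \<in> s)} \<rparr>)"

text \<open>In \<open>omega3_result\<close> the edge of \<open>t1\<close> is the edge of the new triangle on the same strand,
  traversed by \<open>t1\<close> in the same direction as before the move.\<close>

definition omega3_star :: "diagram \<Rightarrow> diagram \<Rightarrow> bool" where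
  "omega3_star D D' \<longleftrightarrow> link_diagram D \<and> link_diagram D' \<and>
     (\<exists>D\<^sub>0 t1 t2 t3 T1 b1 T2 b2 T3 b3.
        link_diagram D\<^sub>0 \<and> link_diagram (omega3_result t1 t2 t3 D\<^sub>0) \<and>
        omega3_triangle D\<^sub>0 t1 t2 t3 \<and>
        rectangle T1 b1 \<and> rectangle T2 b2 \<and> rectangle T3 b3 \<and>
        darts T1 \<inter> darts D\<^sub>0 = {} \<and> darts T2 \<inter> darts D\<^sub>0 = {} \<and> darts T3 \<inter> darts D\<^sub>0 = {} \<and>
        darts T1 \<inter> darts T2 = {} \<and> darts T2 \<inter> darts T3 = {} \<and> darts T3 \<inter> darts T1 = {} \<and>
        D = insert_tangle t3 T3 b3 (insert_tangle t2 T2 b2 (insert_tangle t1 T1 b1 D\<^sub>0)) \<and>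
        D' = insert_tangle t3 T3 b3 (insert_tangle t2 T2 b2 (insert_tangle t1 T1 b1
               (omega3_result t1 t2 t3 D\<^sub>0))))"


datatype move = Omega1_up | Omega1_down | Omega3 | Omega3_star

fun move_rel :: "move \<Rightarrow> diagram \<Rightarrow> diagram \<Rightarrow> bool" where
  "move_rel Omega1_up = omega1_up"
| "move_rel Omega1_down = omega1_down"
| "move_rel Omega3 = omega3"
| "move_rel Omega3_star = omega3_star"

text \<open>The list of moves can be performed, in this order and up to isotopy, from the first diagram
  to the second one.\<close>

inductive transforms :: "move list \<Rightarrow> diagram \<Rightarrow> diagram \<Rightarrow> bool" where
  Nil: "isotopic D D' \<Longrightarrow> transforms [] D D'"
| Cons: "isotopic D E \<Longrightarrow> move_rel m E E' \<Longrightarrow> transforms ms E' D' \<Longrightarrow> transforms (m # ms) D D'"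

definition I_generalized_ordered :: "move list \<Rightarrow> bool" where
  "I_generalized_ordered ms \<longleftrightarrow>
     (\<exists>a b c. ms = replicate a Omega1_up @ replicate b Omega3_star @ replicate c Omega1_down)"

end

theory Submission
  imports Defs
begin

text \<open>
  Inserting a kink into an edge \<open>d\<close> of \<open>D\<close> means inserting a fixed small tangle there, and up to
  isotopy every \<open>\<Omega>\<^sub>1\<close> move is of this form. If \<open>D\<close> and \<open>E\<close> are isotopic, then each edge of \<open>D\<close>
  has a corresponding edge of \<open>E\<close> such that the two insertions are isotopic again. Hence a kink can be
  carried along all other moves: two insertions at different edges commute, and a kink on
  a diagram before an \<open>\<Omega>\<^sub>3\<^sup>*\<close> move either lies away from the three edges of the triangle, or
  enlarges one of the three rectangles; in both cases the diagrams with the kink added before and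
  after the move are again related by one \<open>\<Omega>\<^sub>3\<^sup>*\<close> move. So \<open>\<Omega>\<^sub>1\<close> moves that create a crossing can
  be exchanged to the front and those that remove one to the back, which sorts the sequence without
  changing the number of moves of each kind.
\<close>

section \<open>Orbits\<close>

text \<open>Being a link diagram is a global condition: Euler counts and connectedness must be known
  for every diagram that occurs. For insertions of kinks they are not computed afresh. A kink is
  inserted in three stages: its distinguished marker, a second marker, the kink itself. Each stage
  is undone by one deletion, and sphericity is compared across that deletion, where all counts
  change by known amounts. The same stages are the rules \<open>mark\<close>, \<open>mark\<close>
  and \<open>add_kink\<close> of \<open>rectangle\<close>, which is why a rectangle absorbs a kink.
  The price of the encoding is surplus markers: the removal of a kink leaves one, every inserted
  tangle another. Hence kinks are compared only up to isotopy, and the edge carrying a kink has to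
  be followed whenever a marker appears or disappears. In return, markers settle the awkward
  positions: a kink on an edge between a rectangle and the rest of its strand slides across the
  distinguished marker. Since the two diagrams of an \<Omega>3* move have the same darts, a kink can
  be inserted at literally the same dart of both.\<close>

abbreviation steps :: "nat set \<Rightarrow> (nat \<Rightarrow> nat) set \<Rightarrow> (nat \<times> nat) set" where
  "steps A F \<equiv> {(x, f x) | x f. x \<in> A \<and> f \<in> F}"

text \<open>\<open>orbits\<close> consists of classes of a reflexive transitive closure, which
  partition the set only once the closure is symmetric. Reversing single steps suffices for this,
  and a reversal may itself take several steps.\<close>

lemma steps_sym:
  assumes "\<And>x f. x \<in> A \<Longrightarrow> f \<in> F \<Longrightarrow> (f x, x) \<in> (steps A F)\<^sup>*"
  shows "sym ((steps A F)\<^sup>*)"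
proof (rule symI)
  fix x y assume "(x, y) \<in> (steps A F)\<^sup>*"
  then show "(y, x) \<in> (steps A F)\<^sup>*"
  proof (induction rule: rtrancl_induct)
    case (step y z)
    then have "(z, y) \<in> (steps A F)\<^sup>*" using assms by blast
    then show ?case using step.IH by (rule rtrancl_trans)
  qed simp
qed

text \<open>The assignment of \<open>g x\<close> to \<open>f x\<close> is well defined and
  injective.\<close>

lemma card_image_same_kernel:
  assumes "finite B" "\<And>x y. x \<in> B \<Longrightarrow> y \<in> B \<Longrightarrow> f x = f y \<longleftrightarrow> g x = g y"
  shows "card (f ` B) = card (g ` B)"
proof -
  define k where "k y = g (SOME x. x \<in> B \<and> f x = y)" for y
  have k: "k (f x) = g x" if "x \<in> B" for x
  proof -
    have "(SOME z. z \<in> B \<and> f z = f x) \<in> B \<and> f (SOME z. z \<in> B \<and> f z = f x) = f x"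
      by (rule someI[of "\<lambda>z. z \<in> B \<and> f z = f x" x]) (use that in simp)
    then show ?thesis unfolding k_def using assms(2) that by blast
  qed
  have "inj_on k (f ` B)" by (rule inj_onI) (use k assms(2) in force)
  moreover have "k ` f ` B = g ` B" using k by (force simp: image_image)
  ultimately show ?thesis by (metis card_image)
qed

lemma sym_rtrancl_class_eq:
  assumes "sym (R\<^sup>*)"
  shows "R\<^sup>* `` {x} = R\<^sup>* `` {y} \<longleftrightarrow> (x, y) \<in> R\<^sup>*"
proof
  show "(x, y) \<in> R\<^sup>*" if "R\<^sup>* `` {x} = R\<^sup>* `` {y}"
    using that assms by (auto dest: symD)
  assume xy: "(x, y) \<in> R\<^sup>*"
  then have "(y, x) \<in> R\<^sup>*" using assms by (auto dest: symD)
  with xy show "R\<^sup>* `` {x} = R\<^sup>* `` {y}" by (auto intro: rtrancl_trans)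
qed

text \<open>The tool for comparing a diagram with one that has fewer darts: \<open>h\<close>
  replaces each deleted dart by a surviving one in the same orbit. A step in \<open>A\<close>
  becomes a path in \<open>B\<close> under \<open>h\<close>, and a step in \<open>B\<close> is a
  path in \<open>A\<close>, so two elements of \<open>B\<close> are equivalent in \<open>A\<close>
  exactly when they are in \<open>B\<close>.\<close>

lemma card_orbits_retract:
  assumes "finite A" "B \<subseteq> A"
    and "sym ((steps A F)\<^sup>*)" "sym ((steps B G)\<^sup>*)"
    and h: "\<And>x. x \<in> A \<Longrightarrow> h x \<in> B" "\<And>x. x \<in> B \<Longrightarrow> h x = x"
      "\<And>x. x \<in> A \<Longrightarrow> (x, h x) \<in> (steps A F)\<^sup>*"
      "\<And>x f. x \<in> A \<Longrightarrow> f \<in> F \<Longrightarrow> f x \<in> A \<and> (h x, h (f x)) \<in> (steps B G)\<^sup>*"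
    and G: "\<And>x g. x \<in> B \<Longrightarrow> g \<in> G \<Longrightarrow> (x, g x) \<in> (steps A F)\<^sup>*"
  shows "card (orbits A F) = card (orbits B G)"
proof -
  let ?r = "(steps A F)\<^sup>*" and ?s = "(steps B G)\<^sup>*"
  have "orbits A F = (\<lambda>x. ?r `` {x}) ` A" by (auto simp: orbits_def quotient_def)
  also have "\<dots> = (\<lambda>x. ?r `` {x}) ` B"
  proof -
    have "?r `` {x} = ?r `` {h x}" if "x \<in> A" for x
      using sym_rtrancl_class_eq[OF assms(3)] h(3)[OF that] by simp
    then have "(\<lambda>x. ?r `` {x}) ` A = (\<lambda>x. ?r `` {x}) ` h ` A" by (simp add: image_image)
    also have "h ` A = B" using h(1,2) \<open>B \<subseteq> A\<close> by force
    finally show ?thesis .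
  qed
  finally have 1: "orbits A F = (\<lambda>x. ?r `` {x}) ` B" .
  have 2: "orbits B G = (\<lambda>x. ?s `` {x}) ` B" by (auto simp: orbits_def quotient_def)
  have rs: "(x, y) \<in> ?r \<Longrightarrow> x \<in> A \<Longrightarrow> y \<in> A \<and> (h x, h y) \<in> ?s" for x y
  proof (induction rule: rtrancl_induct)
    case (step y z)
    then obtain f where f: "f \<in> F" "z = f y" by auto
    have y: "y \<in> A" "(h x, h y) \<in> ?s" using step by simp_all
    then have "z \<in> A" "(h y, h z) \<in> ?s" using h(4)[OF y(1) f(1)] f(2) by simp_all
    then show ?case using y(2) by (meson rtrancl_trans)
  qed simp
  have sr: "?s \<subseteq> ?r"
  proof -
    have "steps B G \<subseteq> ?r" using G by auto
    then show ?thesis by (rule rtrancl_subset_rtrancl)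
  qed
  have "(x, y) \<in> ?r \<longleftrightarrow> (x, y) \<in> ?s" if "x \<in> B" "y \<in> B" for x y
  proof
    have "x \<in> A" using that \<open>B \<subseteq> A\<close> by blast
    then show "(x, y) \<in> ?s" if "(x, y) \<in> ?r"
      using rs[OF that] h(2)[OF \<open>x \<in> B\<close>] h(2)[OF \<open>y \<in> B\<close>] by simp
  qed (use sr in blast)
  then show ?thesis unfolding 1 2
    unfolding sym_rtrancl_class_eq[OF assms(3)] sym_rtrancl_class_eq[OF assms(4)]
    using finite_subset[OF assms(2,1)]
    by (intro card_image_same_kernel)
      (simp_all only: sym_rtrancl_class_eq[OF assms(3)] sym_rtrancl_class_eq[OF assms(4)])
qed

lemma steps_closed:
  assumes "(x, y) \<in> (steps A F)\<^sup>*" "x \<in> B" "B \<subseteq> A" "\<And>x f. x \<in> B \<Longrightarrow> f \<in> F \<Longrightarrow> f x \<in> B"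
  shows "y \<in> B \<and> (x, y) \<in> (steps B F)\<^sup>*"
  using assms(1)
proof (induction rule: rtrancl_induct)
  case (step y z)
  then obtain f where f: "f \<in> F" "z = f y" by auto
  then have "(y, z) \<in> steps B F" using step.IH by auto
  then show ?case using step.IH f assms(4) by (blast intro: rtrancl_into_rtrancl)
qed (use assms(2) in simp)

lemma card_orbits_split:
  assumes "finite (B \<union> C)" "B \<inter> C = {}"
    and "\<And>x f. x \<in> B \<Longrightarrow> f \<in> F \<Longrightarrow> f x \<in> B" "\<And>x f. x \<in> C \<Longrightarrow> f \<in> F \<Longrightarrow> f x \<in> C"
  shows "card (orbits (B \<union> C) F) = card (orbits B F) + card (orbits C F)"
proof -
  have sub: "(steps X F)\<^sup>* \<subseteq> (steps (B \<union> C) F)\<^sup>*" if "X \<subseteq> B \<union> C" for X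
    using that by (intro rtrancl_mono) auto
  have B: "(steps (B \<union> C) F)\<^sup>* `` {x} = (steps B F)\<^sup>* `` {x}" if "x \<in> B" for x
    using steps_closed[of x _ "B \<union> C" F B] that assms(3) sub[of B] by auto
  have C: "(steps (B \<union> C) F)\<^sup>* `` {x} = (steps C F)\<^sup>* `` {x}" if "x \<in> C" for x
    using steps_closed[of x _ "B \<union> C" F C] that assms(4) sub[of C] by auto
  have "orbits (B \<union> C) F = orbits B F \<union> orbits C F"
    using B C by (auto simp: orbits_def quotient_def)
  moreover have "orbits B F \<inter> orbits C F = {}"
  proof -
    have "X \<subseteq> B \<and> X \<noteq> {}" if "X \<in> orbits B F" for X
      using that steps_closed[of _ _ B F B] assms(3) by (auto simp: orbits_def quotient_def)
    moreover have "X \<subseteq> C" if "X \<in> orbits C F" for X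
      using that steps_closed[of _ _ C F C] assms(4) by (auto simp: orbits_def quotient_def)
    ultimately show ?thesis using assms(2) by blast
  qed
  moreover have "finite (orbits B F)" "finite (orbits C F)"
    using assms(1) by (auto simp: orbits_def quotient_def)
  ultimately show ?thesis by (simp add: card_Un_disjoint)
qed

lemma card_orbits_transitive:
  assumes "x \<in> A" "\<And>y f. y \<in> A \<Longrightarrow> f \<in> F \<Longrightarrow> f y \<in> A"
    and "\<And>y z. y \<in> A \<Longrightarrow> z \<in> A \<Longrightarrow> (y, z) \<in> (steps A F)\<^sup>*"
  shows "card (orbits A F) = 1"
proof -
  have "(steps A F)\<^sup>* `` {y} = A" if "y \<in> A" for y
    using steps_closed[of y _ A F A] assms(3)[OF that] that assms(2) by blast
  then have "orbits A F = {A}" using assms(1) by (auto simp: orbits_def quotient_def)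
  then show ?thesis by simp
qed

lemma card_orbits_involution:
  assumes "finite A" "\<And>x. x \<in> A \<Longrightarrow> f x \<in> A \<and> f x \<noteq> x \<and> f (f x) = x"
  shows "2 * card (orbits A {f}) = card A"
proof -
  have "(steps A {f})\<^sup>* `` {x} = {x, f x}" if "x \<in> A" for x
  proof -
    have "y \<in> {x, f x}" if "(x, y) \<in> (steps A {f})\<^sup>*" for y
      using that by (induction rule: rtrancl_induct) (use assms(2) \<open>x \<in> A\<close> in auto)
    moreover have "(x, f x) \<in> (steps A {f})\<^sup>*" using that by auto
    ultimately show ?thesis by auto
  qed
  then have o: "orbits A {f} = (\<lambda>x. {x, f x}) ` A" by (auto simp: orbits_def quotient_def)
  have "2 * card (orbits A {f}) = card (\<Union> (orbits A {f}))"
  proof (rule card_partition)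
    show "finite (orbits A {f})" "finite (\<Union> (orbits A {f}))" using assms(1) by (auto simp: o)
    show "card c = 2" if "c \<in> orbits A {f}" for c using that assms(2) by (auto simp: o card_2_iff)
    show "c1 \<inter> c2 = {}" if "c1 \<in> orbits A {f}" "c2 \<in> orbits A {f}" "c1 \<noteq> c2" for c1 c2
    proof -
      obtain x y where "x \<in> A" "y \<in> A" "c1 = {x, f x}" "c2 = {y, f y}"
        using \<open>c1 \<in> _\<close> \<open>c2 \<in> _\<close> by (auto simp: o)
      then show ?thesis using assms(2)[of x] assms(2)[of y] \<open>c1 \<noteq> c2\<close> by auto
    qed
  qed
  also have "\<Union> (orbits A {f}) = A" using assms(2) by (auto simp: o)
  finally show ?thesis .
qed

text \<open>The forward orbit of \<open>f x\<close> is finite and mapped injectively into itself,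
  hence onto itself. So \<open>f x\<close> has a preimage in it, and by injectivity this is
  \<open>x\<close>.\<close>

lemma inj_on_finite_returns:
  assumes "finite A" "f ` A \<subseteq> A" "inj_on f A" "x \<in> A"
  shows "(f x, x) \<in> (steps A {f})\<^sup>*"
proof -
  have "f ` A = A" using assms(1-3) by (simp add: endo_inj_surj)
  let ?O = "(steps A {f})\<^sup>* `` {f x}"
  have sub: "?O \<subseteq> A" using steps_closed[of "f x" _ A "{f}" A] assms by auto
  have "f ` ?O \<subseteq> ?O" using sub by (auto intro: rtrancl_into_rtrancl)
  moreover have "inj_on f ?O" "finite ?O" using assms(1,3) sub by (auto intro: inj_on_subset finite_subset)
  ultimately have "f ` ?O = ?O" by (simp add: endo_inj_surj)
  moreover have "f x \<in> ?O" by simp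
  ultimately have "f x \<in> f ` ?O" by simp
  then obtain z where "f x = f z" "z \<in> ?O" by (rule imageE)
  then have "z = x" using inj_onD[OF assms(3) \<open>f x = f z\<close> assms(4)] sub by blast
  with \<open>z \<in> ?O\<close> show ?thesis by simp
qed

section \<open>Local conditions and sphericity\<close>

text \<open>\<open>link_diagram\<close> is cut in two: these clauses can be verified dart by dart
  after each construction, while \<open>spherical\<close> below depends on counts over the whole
  diagram and is transferred from one diagram to another.\<close>

definition local_diagram :: "diagram \<Rightarrow> bool" where
  "local_diagram D \<longleftrightarrow>
     finite (darts D) \<and>
     (\<forall>d\<in>darts D. opp D d \<in> darts D \<and> opp D d \<noteq> d \<and> opp D (opp D d) = d) \<and>
     (\<forall>d\<in>darts D. rot D d \<in> darts D \<and> (marker D d \<or> crossing D d)) \<and>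
     over D \<subseteq> darts D \<and>
     (\<forall>d. marker D d \<longrightarrow> d \<notin> over D) \<and>
     (\<forall>d. crossing D d \<longrightarrow> (d \<in> over D \<longleftrightarrow> rot D d \<notin> over D)) \<and>
     partition_on (darts D) (regions D) \<and>
     (\<forall>r\<in>regions D. face D ` r \<subseteq> r)"

definition spherical :: "diagram \<Rightarrow> bool" where
  "spherical D \<longleftrightarrow>
     card (orbits (darts D) {rot D}) + card (orbits (darts D) {face D}) =
       card (orbits (darts D) {opp D}) + 2 * card (orbits (darts D) {rot D, opp D}) \<and>
     card (orbits (darts D) {rot D, opp D}) + region_count D =
       card (orbits (darts D) {face D}) + 1 \<and>
     (\<forall>S. S \<subseteq> darts D \<and> S \<noteq> {} \<and> rot D ` S \<subseteq> S \<and> opp D ` S \<subseteq> S \<and>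
        (\<forall>r\<in>regions D. r \<inter> S \<noteq> {} \<longrightarrow> r \<subseteq> S) \<longrightarrow> S = darts D)"

lemma link_diagram_iff: "link_diagram D \<longleftrightarrow> local_diagram D \<and> spherical D"
  by (simp only: link_diagram_def local_diagram_def spherical_def conj_assoc)

section \<open>Elementary consequences of the local conditions\<close>

lemma
  assumes "local_diagram D"
  shows finite_darts: "finite (darts D)"
    and over_subset: "over D \<subseteq> darts D"
    and regions_partition: "partition_on (darts D) (regions D)"
  using assms by (simp_all add: local_diagram_def)

lemma
  assumes "local_diagram D" "d \<in> darts D"
  shows opp_darts: "opp D d \<in> darts D"
    and opp_neq: "opp D d \<noteq> d"
    and opp_opp: "opp D (opp D d) = d"
    and rot_darts: "rot D d \<in> darts D"
    and marker_or_crossing: "marker D d \<or> crossing D d"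
    and face_darts: "face D d \<in> darts D"
    and rot4: "rot D (rot D (rot D (rot D d))) = d"
proof -
  have o: "opp D x \<in> darts D \<and> opp D x \<noteq> x \<and> opp D (opp D x) = x"
    and r: "rot D x \<in> darts D \<and> (marker D x \<or> crossing D x)" if "x \<in> darts D" for x
    using that assms(1) by (simp_all add: local_diagram_def)
  show "opp D d \<in> darts D" "opp D d \<noteq> d" "opp D (opp D d) = d" "rot D d \<in> darts D"
    "marker D d \<or> crossing D d" "face D d \<in> darts D"
    using o r assms(2) by (simp_all add: face_def)
  then show "rot D (rot D (rot D (rot D d))) = d" by (auto simp: marker_def crossing_def)
qed

lemma marker_rot:
  assumes "local_diagram D" "marker D d"
  shows "marker D (rot D d)"
  using assms rot_darts[of D d] by (auto simp: marker_def)

lemma rot_neq: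
  assumes "local_diagram D" "d \<in> darts D"
  shows "rot D d \<noteq> d"
  using marker_or_crossing[OF assms] by (auto simp: marker_def crossing_def)

lemma rot_inj:
  assumes "local_diagram D" "x \<in> darts D" "y \<in> darts D"
  shows "rot D x = rot D y \<longleftrightarrow> x = y"
  using rot4[OF assms(1,2)] rot4[OF assms(1,3)] by metis

lemma opp_inj:
  assumes "local_diagram D" "x \<in> darts D" "y \<in> darts D"
  shows "opp D x = opp D y \<longleftrightarrow> x = y"
  using opp_opp[OF assms(1,2)] opp_opp[OF assms(1,3)] by metis

lemma face_inj:
  assumes "local_diagram D" "x \<in> darts D" "y \<in> darts D"
  shows "face D x = face D y \<longleftrightarrow> x = y"
  using assms rot_inj opp_inj opp_darts by (simp add: face_def)

lemma region_subset: "local_diagram D \<Longrightarrow> r \<in> regions D \<Longrightarrow> r \<subseteq> darts D"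
  using partition_onD1 regions_partition by blast

lemma region_nonempty: "local_diagram D \<Longrightarrow> r \<in> regions D \<Longrightarrow> r \<noteq> {}"
  using partition_onD3 regions_partition by blast

lemma region_unique:
  assumes "local_diagram D" "r \<in> regions D" "s \<in> regions D" "x \<in> r" "x \<in> s"
  shows "r = s"
  using partition_onD2[OF regions_partition[OF assms(1)]] assms(2-5)
  by (auto simp: disjoint_def)

lemma region_ex:
  assumes "local_diagram D" "x \<in> darts D"
  obtains r where "r \<in> regions D" "x \<in> r"
  using partition_onD1[OF regions_partition[OF assms(1)]] assms(2) by blast

lemma face_region:
  assumes "local_diagram D" "r \<in> regions D" "x \<in> darts D"
  shows "face D x \<in> r \<longleftrightarrow> x \<in> r"
proof
  have step: "face D y \<in> s" if "s \<in> regions D" "y \<in> s" for s y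
    using that assms(1) by (simp add: local_diagram_def image_subset_iff)
  show "face D x \<in> r" if "x \<in> r" using step assms(2) that by blast
  assume f: "face D x \<in> r"
  obtain s where s: "s \<in> regions D" "x \<in> s" using region_ex assms(1,3) by metis
  then show "x \<in> r" using region_unique[OF assms(1,2) s(1) f] step by blast
qed

text \<open>\<open>rot D x\<close> is the \<open>face\<close> successor of
  \<open>opp D x\<close>.\<close>

lemma rot_opp_region:
  assumes "local_diagram D" "r \<in> regions D" "x \<in> darts D"
  shows "rot D x \<in> r \<longleftrightarrow> opp D x \<in> r"
  using face_region[OF assms(1,2) opp_darts[OF assms(1,3)]] opp_opp[OF assms(1,3)]
  by (simp add: face_def)

lemma
  assumes "local_diagram D"
  shows over_marker: "marker D x \<Longrightarrow> x \<notin> over D"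
    and over_crossing: "crossing D x \<Longrightarrow> x \<in> over D \<longleftrightarrow> rot D x \<notin> over D"
  using assms by (simp_all add: local_diagram_def)

lemma local_diagramI:
  assumes "finite (darts D)"
    and "\<And>x. x \<in> darts D \<Longrightarrow> opp D x \<in> darts D \<and> opp D x \<noteq> x \<and> opp D (opp D x) = x"
    and "\<And>x. x \<in> darts D \<Longrightarrow> rot D x \<in> darts D \<and> (marker D x \<or> crossing D x)"
    and "over D \<subseteq> darts D"
    and "\<And>x. marker D x \<Longrightarrow> x \<notin> over D"
    and "\<And>x. crossing D x \<Longrightarrow> x \<in> over D \<longleftrightarrow> rot D x \<notin> over D"
    and "partition_on (darts D) (regions D)"
    and "\<And>r x. r \<in> regions D \<Longrightarrow> x \<in> r \<Longrightarrow> face D x \<in> r"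
  shows "local_diagram D"
  using assms by (simp add: local_diagram_def image_subset_iff)

text \<open>The region to the right of \<open>x\<close>; the description is determined only for
  darts of \<open>D\<close>.\<close>

definition reg :: "diagram \<Rightarrow> nat \<Rightarrow> nat set" where
  "reg D x = (THE r. r \<in> regions D \<and> x \<in> r)"

lemma reg_eq:
  assumes "local_diagram D" "r \<in> regions D" "x \<in> r"
  shows "reg D x = r"
  unfolding reg_def using assms region_unique[OF assms(1)] by (intro the_equality) auto

lemma
  assumes "local_diagram D" "x \<in> darts D"
  shows reg_regions: "reg D x \<in> regions D" and reg_self: "x \<in> reg D x"
proof -
  obtain r where "r \<in> regions D" "x \<in> r" using region_ex[OF assms] .
  then show "reg D x \<in> regions D" "x \<in> reg D x" using reg_eq[OF assms(1)] by simp_all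
qed

lemma sym_orbits:
  assumes "local_diagram D" "F \<subseteq> {rot D, opp D, face D}"
  shows "sym ((steps (darts D) F)\<^sup>*)"
proof (rule steps_sym)
  fix x f assume x: "x \<in> darts D" and f: "f \<in> F"
  have "f ` darts D \<subseteq> darts D" "inj_on f (darts D)"
    using f assms rot_darts opp_darts face_darts rot_inj opp_inj face_inj
    by (auto simp: inj_on_def)
  then have "(f x, x) \<in> (steps (darts D) {f})\<^sup>*"
    using inj_on_finite_returns finite_darts[OF assms(1)] x by blast
  moreover have "(steps (darts D) {f})\<^sup>* \<subseteq> (steps (darts D) F)\<^sup>*"
    using f by (intro rtrancl_mono) auto
  ultimately show "(f x, x) \<in> (steps (darts D) F)\<^sup>*" by blast
qed

lemma card_edges: "local_diagram D \<Longrightarrow> 2 * card (orbits (darts D) {opp D}) = card (darts D)"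
  by (intro card_orbits_involution conjI) (simp_all add: finite_darts opp_darts opp_neq opp_opp)

text \<open>Connectedness is formulated in \<open>link_diagram\<close> by closed sets of darts.
  Reachability along this relation says the same and can be carried along a map of darts; two darts
  of one region are adjacent even when they lie on different boundary walks.\<close>

definition adjacency :: "diagram \<Rightarrow> (nat \<times> nat) set" where
  "adjacency D = {(x, y). x \<in> darts D \<and> y \<in> darts D \<and>
     (y = rot D x \<or> y = opp D x \<or> (\<exists>r\<in>regions D. x \<in> r \<and> y \<in> r))}"

text \<open>Forwards, the set of darts reachable from \<open>x\<close> is closed and therefore
  everything. Backwards, a closed set contains whatever is reachable from one of its darts.\<close>

lemma connected_iff:
  assumes "local_diagram D"
  shows "(\<forall>S. S \<subseteq> darts D \<and> S \<noteq> {} \<and> rot D ` S \<subseteq> S \<and> opp D ` S \<subseteq> S \<and>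
        (\<forall>r\<in>regions D. r \<inter> S \<noteq> {} \<longrightarrow> r \<subseteq> S) \<longrightarrow> S = darts D) \<longleftrightarrow>
      (\<forall>x\<in>darts D. \<forall>y\<in>darts D. (x, y) \<in> (adjacency D)\<^sup>*)" (is "?L \<longleftrightarrow> ?R")
proof
  assume L: ?L
  show ?R
  proof (intro ballI)
    fix x y assume x: "x \<in> darts D" and y: "y \<in> darts D"
    let ?S = "(adjacency D)\<^sup>* `` {x}"
    have sub: "?S \<subseteq> darts D"
    proof
      fix z assume "z \<in> ?S"
      then have "(x, z) \<in> (adjacency D)\<^sup>*" by simp
      then show "z \<in> darts D" by (cases rule: rtrancl.cases) (use x in \<open>auto simp: adjacency_def\<close>)
    qed
    have adj: "w \<in> ?S" if "z \<in> ?S" "(z, w) \<in> adjacency D" for z w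
      using that by (auto intro: rtrancl_into_rtrancl)
    have "rot D ` ?S \<subseteq> ?S" "opp D ` ?S \<subseteq> ?S"
      using adj sub rot_darts[OF assms] opp_darts[OF assms] unfolding adjacency_def by blast+
    moreover have "\<forall>r\<in>regions D. r \<inter> ?S \<noteq> {} \<longrightarrow> r \<subseteq> ?S"
      using adj region_subset[OF assms] unfolding adjacency_def by blast
    moreover have "x \<in> ?S" by simp
    ultimately have "?S = darts D" using L sub by blast
    then show "(x, y) \<in> (adjacency D)\<^sup>*" using y by blast
  qed
next
  assume R: ?R
  show ?L
  proof (intro allI impI)
    fix S assume S: "S \<subseteq> darts D \<and> S \<noteq> {} \<and> rot D ` S \<subseteq> S \<and> opp D ` S \<subseteq> S \<and>
        (\<forall>r\<in>regions D. r \<inter> S \<noteq> {} \<longrightarrow> r \<subseteq> S)"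
    then obtain x where x: "x \<in> S" by blast
    have "y \<in> S" if "(x, y) \<in> (adjacency D)\<^sup>*" for y
      using that
    proof (induction rule: rtrancl_induct)
      case (step y z)
      then consider "z = rot D y" | "z = opp D y" | r where "r \<in> regions D" "y \<in> r" "z \<in> r"
        unfolding adjacency_def by blast
      then show ?case using S \<open>y \<in> S\<close> by cases blast+
    qed (rule x)
    moreover have "x \<in> darts D" "S \<subseteq> darts D" using S x by auto
    ultimately show "S = darts D" using R by auto
  qed
qed

section \<open>Removing markers and kinks\<close>

lemma steps_refl_or_step:
  assumes "x = y \<or> x \<in> A \<and> (\<exists>f\<in>F. y = f x)"
  shows "(x, y) \<in> (steps A F)\<^sup>*"
  using assms by auto

text \<open>Lifts connectedness from a diagram \<open>D'\<close> with fewer darts: each dart of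
  \<open>D\<close> is joined, in both directions, to one that survives in \<open>D'\<close>.\<close>

lemma adjacency_retract:
  assumes "\<And>x. x \<in> darts D \<Longrightarrow> \<exists>y\<in>darts D'. (x, y) \<in> (adjacency D)\<^sup>* \<and> (y, x) \<in> (adjacency D)\<^sup>*"
    and "adjacency D' \<subseteq> (adjacency D)\<^sup>*"
    and "\<forall>x\<in>darts D'. \<forall>y\<in>darts D'. (x, y) \<in> (adjacency D')\<^sup>*"
    and "x \<in> darts D" "y \<in> darts D"
  shows "(x, y) \<in> (adjacency D)\<^sup>*"
proof -
  obtain x' where x': "x' \<in> darts D'" "(x, x') \<in> (adjacency D)\<^sup>*" using assms(1,4) by blast
  obtain y' where y': "y' \<in> darts D'" "(y', y) \<in> (adjacency D)\<^sup>*" using assms(1,5) by blast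
  have "(x', y') \<in> (adjacency D)\<^sup>*"
    using rtrancl_subset_rtrancl[OF assms(2)] assms(3) x'(1) y'(1) by blast
  then show ?thesis using x'(2) y'(2) by (meson rtrancl_trans)
qed

lemma remove_marker_simps:
  "darts (remove_marker v D) = darts D - {v, rot D v}"
  "rot (remove_marker v D) = rot D"
  "opp (remove_marker v D) =
     (opp D)(opp D v := opp D (rot D v), opp D (rot D v) := opp D v)"
  "over (remove_marker v D) = over D"
  "regions (remove_marker v D) = (\<lambda>r. r - {v, rot D v}) ` regions D"
  by (simp_all add: remove_marker_def Let_def)

lemma remove_kink_simps:
  "darts (remove_kink x D) = darts D - {x, opp D x}"
  "rot (remove_kink x D) = (rot D)(rot D x := rot D (rot D x), rot D (rot D x) := rot D x)"
  "opp (remove_kink x D) = opp D"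
  "over (remove_kink x D) = over D - {x, opp D x, rot D x, rot D (rot D x)}"
  "regions (remove_kink x D) = (\<lambda>r. r - {x, opp D x}) ` (regions D - {{x}})"
  by (simp_all add: remove_kink_def Let_def)

text \<open>Removability excludes the circle with a single marker. Without that case, the two darts
  of the marker and the two darts facing them are four different darts.\<close>

lemma removable_marker_darts:
  assumes "local_diagram D" "removable_marker D v"
  defines "w \<equiv> rot D v"
  shows "v \<in> darts D" "w \<in> darts D" "w \<noteq> v" "rot D w = v" "opp D v \<in> darts D" "opp D w \<in> darts D"
    "opp D v \<noteq> v" "opp D v \<noteq> w" "opp D w \<noteq> v" "opp D w \<noteq> w" "opp D v \<noteq> opp D w"
    "opp D (opp D v) = v" "opp D (opp D w) = w"
proof -
  have v: "v \<in> darts D" "rot D v \<noteq> v" "rot D (rot D v) = v" "opp D v \<noteq> w"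
    using assms(2) by (auto simp: removable_marker_def marker_def w_def)
  then have w: "w \<in> darts D" "w \<noteq> v" "rot D w = v" using assms(1) rot_darts by (auto simp: w_def)
  show "v \<in> darts D" "w \<in> darts D" "w \<noteq> v" "rot D w = v" "opp D v \<in> darts D" "opp D w \<in> darts D"
    "opp D v \<noteq> v" "opp D v \<noteq> w" "opp D w \<noteq> w" "opp D (opp D v) = v" "opp D (opp D w) = w"
    using v w opp_darts opp_neq opp_opp assms(1) by simp_all
  show "opp D v \<noteq> opp D w" using opp_inj[OF assms(1) v(1) w(1)] w(2) by simp
  show "opp D w \<noteq> v" using opp_opp[OF assms(1) w(1)] v(4) by auto
qed

lemma removable_marker_regions:
  assumes "local_diagram D" "removable_marker D v" "r \<in> regions D"
  shows "v \<in> r \<longleftrightarrow> opp D (rot D v) \<in> r" "rot D v \<in> r \<longleftrightarrow> opp D v \<in> r"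
proof -
  note m = removable_marker_darts[OF assms(1,2)]
  show "v \<in> r \<longleftrightarrow> opp D (rot D v) \<in> r" "rot D v \<in> r \<longleftrightarrow> opp D v \<in> r"
    using rot_opp_region[OF assms(1,3), of v] rot_opp_region[OF assms(1,3), of "rot D v"] m(1-4)
    by simp_all
qed

lemma local_remove_marker:
  assumes X: "local_diagram X" and v: "removable_marker X v"
  shows "local_diagram (remove_marker v X)"
proof (rule local_diagramI)
  define w where "w = rot X v"
  define a where "a = opp X v"
  define b where "b = opp X w"
  note m = removable_marker_darts[OF X v, folded w_def a_def b_def]
  let ?Y = "remove_marker v X"
  have Y: "darts ?Y = darts X - {v, w}" "rot ?Y = rot X" "opp ?Y = (opp X)(a := b, b := a)"
    "over ?Y = over X" "regions ?Y = (\<lambda>r. r - {v, w}) ` regions X"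
    by (simp_all add: a_def b_def w_def remove_marker_simps)
  have ov: "opp X v = a" "opp X w = b" "rot X v = w" "rot X w = v"
    using m by (simp_all add: a_def b_def w_def)
  have reg: "v \<in> r \<longleftrightarrow> b \<in> r" "w \<in> r \<longleftrightarrow> a \<in> r" if "r \<in> regions X" for r
    using removable_marker_regions[OF X v that] by (simp_all add: a_def b_def w_def)
  have mc: "marker ?Y x \<longleftrightarrow> marker X x \<and> x \<in> darts ?Y" "crossing ?Y x \<longleftrightarrow> crossing X x \<and> x \<in> darts ?Y" for x
    by (auto simp: marker_def crossing_def Y)
  show "finite (darts ?Y)" using finite_darts[OF X] by (simp add: Y)
  have rotY: "rot X x \<notin> {v, w}" if "x \<in> darts ?Y" for x
    using that rot_inj[OF X, of x v] rot_inj[OF X, of x w] m(1,2) by (auto simp: Y ov)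
  have oppY: "opp X x \<notin> {v, w}" if "x \<in> darts ?Y" "x \<noteq> a" "x \<noteq> b" for x
  proof -
    have "opp X (opp X x) = x" using that(1) opp_opp[OF X, of x] by (simp add: Y)
    then have "opp X x \<noteq> v" "opp X x \<noteq> w" using ov(1,2) that(2,3) by metis+
    then show ?thesis by simp
  qed
  show "opp ?Y x \<in> darts ?Y \<and> opp ?Y x \<noteq> x \<and> opp ?Y (opp ?Y x) = x" if x: "x \<in> darts ?Y" for x
  proof (cases "x = a \<or> x = b")
    case True
    then show ?thesis using m by (auto simp: Y)
  next
    case False
    have xX: "x \<in> darts X" "x \<noteq> v" "x \<noteq> w" using x by (simp_all add: Y)
    have "opp X x \<noteq> a" "opp X x \<noteq> b"
      using opp_inj[OF X xX(1) m(1)] opp_inj[OF X xX(1) m(2)] xX by (simp_all add: ov)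
    then show ?thesis
      using False oppY[OF x] opp_darts[OF X xX(1)] opp_neq[OF X xX(1)] opp_opp[OF X xX(1)]
      by (simp add: Y)
  qed
  show "rot ?Y x \<in> darts ?Y \<and> (marker ?Y x \<or> crossing ?Y x)" if x: "x \<in> darts ?Y" for x
  proof -
    have "x \<in> darts X" using x by (simp add: Y)
    then show ?thesis
      using x rotY[OF x] rot_darts[OF X, of x] marker_or_crossing[OF X, of x] by (simp add: mc Y)
  qed
  show "x \<notin> over ?Y" if "marker ?Y x" for x
    using that over_marker[OF X] by (simp add: mc Y)
  show "x \<in> over ?Y \<longleftrightarrow> rot ?Y x \<notin> over ?Y" if "crossing ?Y x" for x
    using that over_crossing[OF X] by (simp add: mc Y)
  have "marker X v" "marker X w"
    using v marker_rot[OF X] by (auto simp: removable_marker_def w_def)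
  then show "over ?Y \<subseteq> darts ?Y"
    using over_subset[OF X] over_marker[OF X] by (auto simp: Y)
  show "partition_on (darts ?Y) (regions ?Y)"
  proof (rule partition_onI)
    show "\<Union> (regions ?Y) = darts ?Y"
      using partition_onD1[OF regions_partition[OF X]] by (auto simp: Y)
    \<comment> \<open>A region containing \<open>v\<close> also contains \<open>b\<close>, and one
      containing \<open>w\<close> also contains \<open>a\<close>; these darts survive, so no region
      becomes empty.\<close>
    show "{} \<notin> regions ?Y"
    proof
      assume "{} \<in> regions ?Y"
      then obtain r where r: "r \<in> regions X" "r - {v, w} = {}" by (auto simp: Y)
      then show False using reg[OF r(1)] region_nonempty[OF X r(1)] m(7-10) by blast
    qed
    fix p q assume pq: "p \<in> regions ?Y" "q \<in> regions ?Y" "p \<noteq> q"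
    then obtain r s where rs: "r \<in> regions X" "s \<in> regions X" "p = r - {v, w}" "q = s - {v, w}"
      by (auto simp: Y)
    then have "r \<noteq> s" using pq by blast
    then show "disjnt p q" using region_unique[OF X rs(1,2)] rs by (auto simp: disjnt_def)
  qed
  show "face ?Y x \<in> r" if "r \<in> regions ?Y" "x \<in> r" for r x
  proof -
    obtain s where s: "s \<in> regions X" "r = s - {v, w}" using \<open>r \<in> regions ?Y\<close> by (auto simp: Y)
    then have x: "x \<in> s" "x \<in> darts X" "x \<in> darts ?Y"
      using \<open>x \<in> r\<close> region_subset[OF X s(1)] by (auto simp: Y)
    have fs: "rot X (opp X z) \<in> s" if "z \<in> s" for z
      using that face_region[OF X s(1), of z] region_subset[OF X s(1)] by (auto simp: face_def)
    have "face ?Y x \<in> s"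
      using fs[OF x(1)] fs[of v] fs[of w] reg[OF s(1)] x(1) by (auto simp: face_def Y ov)
    moreover have "opp ?Y x \<in> darts ?Y"
    proof (cases "x = a \<or> x = b")
      case True
      then show ?thesis using m by (auto simp: Y)
    next
      case False
      then show ?thesis using oppY[OF x(3)] opp_darts[OF X x(2)] by (simp add: Y)
    qed
    then have "face ?Y x \<notin> {v, w}" using rotY by (simp add: face_def Y)
    ultimately show ?thesis using s by simp
  qed
qed

text \<open>Deletion of a marker lowers the numbers of vertices and of edges by one each; the
  numbers of boundary walks, components and regions stay the same, so both Euler equations are
  preserved.\<close>

lemma spherical_remove_marker:
  assumes X: "local_diagram X" and v: "removable_marker X v"
  shows "spherical (remove_marker v X) \<longleftrightarrow> spherical X"
proof -
  define Y where "Y = remove_marker v X"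
  define A where "A = darts X"
  define w where "w = rot X v"
  define a where "a = opp X v"
  define b where "b = opp X w"
  define B where "B = A - {v, w}"
  \<comment> \<open>Each dart of the marker is replaced by the facing dart that has the same region
    on its right. Thus one map serves for boundary walks, for components and for
    connectedness.\<close>
  define h where "h = id(v := b, w := a)"
  note m = removable_marker_darts[OF X v, folded w_def a_def b_def A_def]
  have Y: "darts Y = B" "rot Y = rot X" "opp Y = (opp X)(a := b, b := a)"
    "regions Y = (\<lambda>r. r - {v, w}) ` regions X"
    by (simp_all add: Y_def B_def A_def a_def b_def w_def remove_marker_simps)
  have LY: "local_diagram Y" using local_remove_marker[OF X v] by (simp add: Y_def)
  have fin: "finite A" using finite_darts[OF X] by (simp add: A_def)
  have "B \<subseteq> A" and AB: "A = B \<union> {v, w}" using m by (auto simp: B_def)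
  have aB: "a \<in> B" "b \<in> B" using m by (auto simp: B_def)
  have rotB: "rot X x \<in> B" if "x \<in> B" for x using rot_darts[OF LY, of x] that by (simp add: Y)
  have oppB: "opp X x \<in> B" if "x \<in> B" "x \<noteq> a" "x \<noteq> b" for x
    using opp_darts[OF LY, of x] that by (simp add: Y)
  have rotA: "rot X x \<in> A" "opp X x \<in> A" if "x \<in> A" for x
    using that X rot_darts opp_darts by (simp_all add: A_def)
  have ov: "opp X v = a" "opp X w = b" "opp X a = v" "opp X b = w" "rot X v = w" "rot X w = v"
    using m by (simp_all add: a_def b_def w_def)
  have h: "h v = b" "h w = a" "x \<in> B \<Longrightarrow> h x = x" for x using m by (auto simp: h_def B_def)
  have fY: "face Y x = (if x = a then rot X b else if x = b then rot X a else rot X (opp X x))" for x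
    using m by (simp add: face_def Y)
  have fX: "face X x = rot X (opp X x)" for x by (simp add: face_def)
  have cases_A: "P" if "x \<in> A" "x = v \<Longrightarrow> P" "x = w \<Longrightarrow> P" "x = a \<Longrightarrow> P" "x = b \<Longrightarrow> P"
    "x \<in> B \<Longrightarrow> x \<noteq> a \<Longrightarrow> x \<noteq> b \<Longrightarrow> P" for x P using that AB by blast
  have nB: "v \<notin> B" "w \<notin> B" by (auto simp: B_def)
  have ab: "a \<noteq> b" "b \<noteq> a" using m by auto

  have "card (orbits A {rot X}) = card (orbits B {rot X}) + card (orbits {v, w} {rot X})"
    unfolding AB by (rule card_orbits_split) (use fin AB nB rotB ov in auto)
  moreover have "card (orbits {v, w} {rot X}) = 1"
    by (rule card_orbits_transitive[of v]) (use ov in \<open>auto intro!: steps_refl_or_step\<close>)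
  ultimately have V: "card (orbits A {rot X}) = card (orbits B {rot X}) + 1" by simp

  have F: "card (orbits A {face X}) = card (orbits B {face Y})"
  proof (rule card_orbits_retract[where h = h])
    show "sym ((steps A {face X})\<^sup>*)" "sym ((steps B {face Y})\<^sup>*)"
      using sym_orbits[OF X, of "{face X}"] sym_orbits[OF LY, of "{face Y}"]
      by (simp_all add: A_def Y)
    show "h x \<in> B" if "x \<in> A" for x using that by (rule cases_A) (use h aB in auto)
    show "(x, h x) \<in> (steps A {face X})\<^sup>*" if "x \<in> A" for x
      using that
    proof (rule cases_A)
      have "(b, v) \<in> steps A {face X}" using aB ov AB by (auto simp: fX)
      moreover note sym_orbits[OF X, of "{face X}", folded A_def]
      ultimately have "(v, b) \<in> (steps A {face X})\<^sup>*" by (auto dest: symD)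
      then show ?thesis if "x = v" using that h by simp
      have "(a, w) \<in> steps A {face X}" using aB ov AB by (auto simp: fX)
      moreover note sym_orbits[OF X, of "{face X}", folded A_def]
      ultimately have "(w, a) \<in> (steps A {face X})\<^sup>*" by (auto dest: symD)
      then show ?thesis if "x = w" using that h by simp
    qed (use h aB in auto)
    show "f x \<in> A \<and> (h x, h (f x)) \<in> (steps B {face Y})\<^sup>*" if "x \<in> A" "f \<in> {face X}" for x f
    proof
      show "f x \<in> A" using that rotA by (auto simp: fX)
      show "(h x, h (f x)) \<in> (steps B {face Y})\<^sup>*"
        using that(1)
        by (rule cases_A; intro steps_refl_or_step)
          (use that(2) h aB ov rotB oppB ab in \<open>simp_all add: fX fY\<close>)
    qed
    show "(x, g x) \<in> (steps A {face X})\<^sup>*" if "x \<in> B" "g \<in> {face Y}" for x g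
    proof -
      have st: "(y, face X y) \<in> (steps A {face X})\<^sup>*" if "y \<in> A" for y using that by auto
      consider "x = a" | "x = b" | "x \<noteq> a" "x \<noteq> b" by blast
      then show ?thesis
      proof cases
        case 1
        then show ?thesis using st[of a] st[of w] aB AB that ov
          by (auto simp: fX fY intro: rtrancl_trans)
      next
        case 2
        then show ?thesis using st[of b] st[of v] aB AB that ov ab
          by (auto simp: fX fY intro: rtrancl_trans)
      next
        case 3
        then show ?thesis using st[of x] AB that by (simp add: fX fY)
      qed
    qed
  qed (use fin \<open>B \<subseteq> A\<close> h in auto)

  have C: "card (orbits A {rot X, opp X}) = card (orbits B {rot Y, opp Y})"
  proof (rule card_orbits_retract[where h = h])
    show sy: "sym ((steps A {rot X, opp X})\<^sup>*)" "sym ((steps B {rot Y, opp Y})\<^sup>*)"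
      using sym_orbits[OF X, of "{rot X, opp X}"] sym_orbits[OF LY, of "{rot Y, opp Y}"]
      by (simp_all add: A_def Y)
    show "h x \<in> B" if "x \<in> A" for x using that by (rule cases_A) (use h aB in auto)
    have st: "(y, rot X y) \<in> (steps A {rot X, opp X})\<^sup>*" "(y, opp X y) \<in> (steps A {rot X, opp X})\<^sup>*"
      if "y \<in> A" for y using that by auto
    have vw: "v \<in> A" "w \<in> A" "a \<in> A" "b \<in> A" using aB AB by auto
    show "(x, h x) \<in> (steps A {rot X, opp X})\<^sup>*" if "x \<in> A" for x
      using that
    proof (rule cases_A)
      show ?thesis if "x = v" using st[of v] st[of w] vw ov h that by (auto intro: rtrancl_trans)
      show ?thesis if "x = w" using st[of v] st[of w] vw ov h that by (auto intro: rtrancl_trans)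
    qed (use h aB in auto)
    show "f x \<in> A \<and> (h x, h (f x)) \<in> (steps B {rot Y, opp Y})\<^sup>*"
      if xA: "x \<in> A" and fF: "f \<in> {rot X, opp X}" for x f
    proof
      show "f x \<in> A" using that rotA by auto
      consider "f = rot X" | "f = opp X" using fF by blast
      then show "(h x, h (f x)) \<in> (steps B {rot Y, opp Y})\<^sup>*"
      proof cases
        case 1
        show ?thesis using xA
          by (rule cases_A; intro steps_refl_or_step) (use 1 h aB ov rotB ab in \<open>simp_all add: Y\<close>)
      next
        case 2
        show ?thesis using xA
          by (rule cases_A; intro steps_refl_or_step) (use 2 h aB ov oppB ab in \<open>simp_all add: Y\<close>)
      qed
    qed
    show "(x, g x) \<in> (steps A {rot X, opp X})\<^sup>*" if "x \<in> B" "g \<in> {rot Y, opp Y}" for x g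
    proof -
      have "(a, v) \<in> (steps A {rot X, opp X})\<^sup>*" "(v, w) \<in> (steps A {rot X, opp X})\<^sup>*"
        "(w, b) \<in> (steps A {rot X, opp X})\<^sup>*" using st[of a] st[of v] st[of w] vw ov by auto
      then have "(a, b) \<in> (steps A {rot X, opp X})\<^sup>*" by (meson rtrancl_trans)
      moreover from this have "(b, a) \<in> (steps A {rot X, opp X})\<^sup>*" using sy(1) by (auto dest: symD)
      ultimately show ?thesis using that st[of x] AB ov by (auto simp: Y)
    qed
  qed (use fin \<open>B \<subseteq> A\<close> h in auto)

  have "card A = card B + 2" using AB fin nB m by auto
  then have E: "card (orbits A {opp X}) = card (orbits B {opp Y}) + 1"
    using card_edges[OF X] card_edges[OF LY] by (simp add: A_def Y)

  have reg: "v \<in> r \<longleftrightarrow> b \<in> r" "w \<in> r \<longleftrightarrow> a \<in> r" if "r \<in> regions X" for r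
    using removable_marker_regions[OF X v that] by (simp_all add: a_def b_def w_def)
  have "inj_on (\<lambda>r. r - {v, w}) (regions X)"
  proof (rule inj_onI)
    fix r s assume rs: "r \<in> regions X" "s \<in> regions X" "r - {v, w} = s - {v, w}"
    have "r - {v, w} \<noteq> {}" using reg[OF rs(1)] region_nonempty[OF X rs(1)] aB nB by blast
    then obtain x where "x \<in> r" "x \<in> s" using rs(3) by blast
    then show "r = s" using region_unique[OF X rs(1,2)] by blast
  qed
  then have R: "region_count X = region_count Y"
    using aB AB by (auto simp: region_count_def Y A_def[symmetric] card_image)

  have up: "(x, y) \<in> (adjacency X)\<^sup>*" if "\<forall>x\<in>darts Y. \<forall>y\<in>darts Y. (x, y) \<in> (adjacency Y)\<^sup>*" "x \<in> A" "y \<in> A" for x y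
  proof (rule adjacency_retract[where D' = Y])
    have adj: "(y, rot X y) \<in> adjacency X" "(y, opp X y) \<in> adjacency X" if "y \<in> A" for y
      using that rotA by (auto simp: adjacency_def A_def)
    have vw: "v \<in> A" "w \<in> A" "a \<in> A" "b \<in> A" using aB AB by auto
    have e: "(a, v) \<in> (adjacency X)\<^sup>*" "(v, a) \<in> (adjacency X)\<^sup>*" "(v, w) \<in> (adjacency X)\<^sup>*"
      "(w, v) \<in> (adjacency X)\<^sup>*" "(w, b) \<in> (adjacency X)\<^sup>*" "(b, w) \<in> (adjacency X)\<^sup>*"
      using adj[of a] adj[of b] adj[of v] adj[of w] vw ov by auto
    have ab': "(a, b) \<in> (adjacency X)\<^sup>*" "(b, a) \<in> (adjacency X)\<^sup>*" "(w, a) \<in> (adjacency X)\<^sup>*"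
      "(a, w) \<in> (adjacency X)\<^sup>*"
      using e by (meson rtrancl_trans)+
    show "\<exists>y\<in>darts Y. (x, y) \<in> (adjacency X)\<^sup>* \<and> (y, x) \<in> (adjacency X)\<^sup>*"
      if "x \<in> darts X" for x
      using that e ab' aB AB unfolding Y(1) A_def[symmetric] by blast
    show "adjacency Y \<subseteq> (adjacency X)\<^sup>*"
    proof (rule subrelI)
      fix x y assume "(x, y) \<in> adjacency Y"
      then have xy: "x \<in> B" "y \<in> B"
        and "y = rot X x \<or> y = opp Y x \<or> (\<exists>r\<in>regions Y. x \<in> r \<and> y \<in> r)"
        by (simp_all add: adjacency_def Y(1,2))
      then have c: "y = rot X x \<or> y = opp Y x \<or> (\<exists>r\<in>regions X. x \<in> r \<and> y \<in> r)"
        unfolding Y(4) by blast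
      have A: "x \<in> A" "y \<in> A" using xy AB by auto
      from c show "(x, y) \<in> (adjacency X)\<^sup>*"
      proof (elim disjE)
        assume "y = opp Y x"
        then show ?thesis using ab' adj(2)[OF A(1)] by (auto simp: Y split: if_splits)
      next
        assume "\<exists>r\<in>regions X. x \<in> r \<and> y \<in> r"
        then have "(x, y) \<in> adjacency X" using A by (simp add: adjacency_def A_def)
        then show ?thesis by blast
      qed (use adj(1)[OF A(1)] in blast)
    qed
  qed (use that in \<open>simp_all add: A_def\<close>)
  have down: "(x, y) \<in> (adjacency Y)\<^sup>*"
    if "\<forall>x\<in>darts X. \<forall>y\<in>darts X. (x, y) \<in> (adjacency X)\<^sup>*" "x \<in> B" "y \<in> B" for x y
  proof -
    have adj: "(y, rot X y) \<in> adjacency Y" "(y, opp Y y) \<in> adjacency Y" if "y \<in> B" for y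
      using that rot_darts[OF LY, of y] opp_darts[OF LY, of y] by (auto simp: adjacency_def Y(1,2))
    have ab': "(a, b) \<in> (adjacency Y)\<^sup>*" "(b, a) \<in> (adjacency Y)\<^sup>*"
      using adj(2)[OF aB(1)] adj(2)[OF aB(2)] ab by (auto simp: Y)
    have adj_h: "(h x, h y) \<in> (adjacency Y)\<^sup>*" if xy: "(x, y) \<in> adjacency X" for x y
    proof -
      have xA: "x \<in> A" and yA: "y \<in> A" using xy by (auto simp: adjacency_def A_def)
      have hB: "h z \<in> B" if "z \<in> A" for z using that by (rule cases_A) (use h aB in auto)
      have hr: "h z \<in> r \<longleftrightarrow> z \<in> r" if "z \<in> A" "r \<in> regions X" for z r
        using that(1) by (rule cases_A) (use h aB reg[OF that(2)] in auto)
      consider "y = rot X x" | "y = opp X x" | r where "r \<in> regions X" "x \<in> r" "y \<in> r"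
        using xy unfolding adjacency_def by blast
      then show ?thesis
      proof cases
        case 1
        show ?thesis using xA
          by (rule cases_A)
            (use 1 ab' adj(1)[of a] adj(1)[of b] adj(1)[of x] rotB[of x] rotB[of a] rotB[of b] in
              \<open>simp_all add: ov h aB r_into_rtrancl\<close>)
      next
        case 2
        show ?thesis using xA
          by (rule cases_A)
            (use 2 ab' adj(2)[of x] oppB[of x] in \<open>simp_all add: ov h aB Y(3) r_into_rtrancl\<close>)
      next
        case 3
        then have "h x \<in> r - {v, w}" "h y \<in> r - {v, w}"
          using hr[OF xA] hr[OF yA] hB[OF xA] hB[OF yA] by (auto simp: B_def)
        moreover have "r - {v, w} \<in> regions Y" using 3(1) by (simp add: Y(4))
        ultimately have "\<exists>s\<in>regions Y. h x \<in> s \<and> h y \<in> s"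
          by (intro bexI[of _ "r - {v, w}"] conjI)
        then have "(h x, h y) \<in> adjacency Y"
          using hB[OF xA] hB[OF yA] by (simp add: adjacency_def Y(1))
        then show ?thesis by (rule r_into_rtrancl)
      qed
    qed
    have "x \<in> darts X" "y \<in> darts X" using that(2,3) AB by (simp_all add: A_def[symmetric])
    then have "(x, y) \<in> (adjacency X)\<^sup>*" using that(1) by simp
    then have "(h x, h y) \<in> (adjacency Y)\<^sup>*"
    proof (induction rule: rtrancl_induct)
      case (step y z)
      then show ?case using rtrancl_trans[OF step.IH adj_h[OF step.hyps(2)]] by simp
    qed simp
    then show ?thesis using h(3) that(2,3) by simp
  qed
  have conn: "(\<forall>x\<in>darts Y. \<forall>y\<in>darts Y. (x, y) \<in> (adjacency Y)\<^sup>*) \<longleftrightarrow>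
      (\<forall>x\<in>darts X. \<forall>y\<in>darts X. (x, y) \<in> (adjacency X)\<^sup>*)"
    using up down by (auto simp only: Y(1) A_def)
  then show ?thesis using V F C E R
    unfolding spherical_def connected_iff[OF X] connected_iff[OF LY] conn Y_def[symmetric]
    by (simp add: Y(1,2) A_def)
qed

text \<open>A region with the single dart \<open>x\<close> is closed under \<open>face\<close>, so
  \<open>face D x = x\<close>, which means \<open>rot D y = x\<close>. This fixes the cyclic order
  \<open>x\<close>, \<open>u\<close>, \<open>v\<close>, \<open>y\<close> around the
  crossing.\<close>

lemma kink_darts:
  assumes "local_diagram D" "kink D x"
  defines "y \<equiv> opp D x" and "u \<equiv> rot D x"
  defines "v \<equiv> rot D u"
  shows "x \<in> darts D" "y \<in> darts D" "u \<in> darts D" "v \<in> darts D" "distinct [x, y, u, v]"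
    "rot D v = y" "rot D y = x" "opp D y = x"
proof -
  have x: "crossing D x" "{x} \<in> regions D" using assms(2) by (simp_all add: kink_def)
  then show xd: "x \<in> darts D" by (simp add: crossing_def)
  then show d: "y \<in> darts D" "u \<in> darts D" "v \<in> darts D" "opp D y = x"
    using assms(1) rot_darts opp_darts opp_opp by (simp_all add: y_def u_def v_def)
  have "face D x = x" using face_region[OF assms(1) x(2) xd] by simp
  then show yx: "rot D y = x" by (simp add: face_def y_def)
  have "rot D (rot D (rot D (rot D y))) = y" using rot4 assms(1) d(1) by blast
  then show vy: "rot D v = y" by (simp add: yx u_def v_def)
  have "rot D u \<noteq> x" using x(1) by (simp add: crossing_def u_def)
  moreover have "rot D v \<noteq> u"
    using x(1) rot_inj[OF assms(1), of "rot D u" x] d xd calculation by (simp add: u_def v_def)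
  ultimately show "distinct [x, y, u, v]"
    using rot_neq[OF assms(1)] xd d vy yx opp_neq[OF assms(1) xd] by (auto simp: u_def v_def y_def)
qed

lemma kink_regions:
  assumes "local_diagram D" "kink D x" "r \<in> regions D"
  shows "opp D x \<in> r \<longleftrightarrow> rot D x \<in> r" "x \<in> r \<longleftrightarrow> r = {x}"
proof -
  note k = kink_darts[OF assms(1,2)]
  show "opp D x \<in> r \<longleftrightarrow> rot D x \<in> r"
    using rot_opp_region[OF assms(1,3) k(1)] by simp
  show "x \<in> r \<longleftrightarrow> r = {x}"
    using region_unique[OF assms(1,3)] assms(2) by (auto simp: kink_def)
qed

text \<open>Putting the kink back adds one edge, one boundary walk and one region, the last two
  being the monogon. The crossing takes the place of a marker, so the number of vertices is the
  same, and so is the number of components.\<close>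

lemma spherical_remove_kink:
  assumes X: "local_diagram X" and x: "kink X x"
    and X': "local_diagram (remove_kink x X)" "spherical (remove_kink x X)"
  shows "spherical X"
proof -
  define Y where "Y = remove_kink x X"
  define A where "A = darts X"
  define y where "y = opp X x"
  define u where "u = rot X x"
  define v where "v = rot X u"
  define B where "B = A - {x, y}"
  \<comment> \<open>\<open>y\<close> and \<open>u\<close> have the same region on their right. The
    dart \<open>x\<close> is alone in its region, so sending it to \<open>u\<close> respects
    components but not boundary walks.\<close>
  define h where "h = id(x := u, y := u)"
  note k = kink_darts[OF X x, folded y_def u_def v_def A_def, folded v_def]
  have Y: "darts Y = B" "rot Y = (rot X)(u := v, v := u)" "opp Y = opp X"
    "regions Y = (\<lambda>r. r - {x, y}) ` (regions X - {{x}})"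
    by (simp_all add: Y_def B_def A_def y_def u_def v_def remove_kink_simps)
  have LY: "local_diagram Y" and SY: "spherical Y" using X' by (simp_all add: Y_def)
  have fin: "finite A" using finite_darts[OF X] by (simp add: A_def)
  have "B \<subseteq> A" and AB: "A = B \<union> {x, y}" using k by (auto simp: B_def)
  have d: "x \<noteq> y" "y \<noteq> x" "u \<noteq> v" "v \<noteq> u" "x \<noteq> u" "u \<noteq> x" "x \<noteq> v" "v \<noteq> x" "y \<noteq> u" "u \<noteq> y" "y \<noteq> v" "v \<noteq> y"
    using k(5) by auto
  have uB: "u \<in> B" "v \<in> B" using k d by (auto simp: B_def)
  have rotB: "rot X z \<in> B" if "z \<in> B" "z \<noteq> u" "z \<noteq> v" for z
    using rot_darts[OF LY, of z] that by (simp add: Y)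
  have oppB: "opp X z \<in> B" if "z \<in> B" for z using opp_darts[OF LY, of z] that by (simp add: Y)
  have rotA: "rot X z \<in> A" "opp X z \<in> A" "face X z \<in> A" if "z \<in> A" for z
    using that X rot_darts opp_darts face_darts by (simp_all add: A_def)
  have ov: "opp X x = y" "opp X y = x" "rot X x = u" "rot X u = v" "rot X v = y" "rot X y = x"
    using k by (simp_all add: y_def u_def v_def)
  have h: "h x = u" "h y = u" "z \<in> B \<Longrightarrow> h z = z" for z using d by (auto simp: h_def B_def)
  have fX: "face X z = rot X (opp X z)" for z by (simp add: face_def)
  have fY: "face Y z = ((rot X)(u := v, v := u)) (opp X z)" for z by (simp add: face_def Y)
  have cases_A: "P" if "z \<in> A" "z = x \<Longrightarrow> P" "z = y \<Longrightarrow> P" "z = u \<Longrightarrow> P" "z = v \<Longrightarrow> P"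
    "z \<in> B \<Longrightarrow> z \<noteq> u \<Longrightarrow> z \<noteq> v \<Longrightarrow> P" for z P using that AB by blast
  have nB: "x \<notin> B" "y \<notin> B" by (auto simp: B_def)
  have xy: "x \<in> A" "y \<in> A" "u \<in> A" "v \<in> A" using uB AB by auto
  have opps: "opp X z = w \<longleftrightarrow> z = opp X w" if "z \<in> A" "w \<in> A" for z w
    using that opp_opp[OF X] by (metis A_def)
  have symX: "sym ((steps A F)\<^sup>*)" if "F \<subseteq> {rot X, opp X, face X}" for F
    using sym_orbits[OF X that] by (simp add: A_def)
  have symY: "sym ((steps B F)\<^sup>*)" if "F \<subseteq> {rot Y, opp Y, face Y}" for F
    using sym_orbits[OF LY that] by (simp add: Y)

  have V: "card (orbits A {rot X}) = card (orbits B {rot Y})"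
  proof -
    define h' where "h' = id(x := u, y := v)"
    have h': "h' x = u" "h' y = v" "z \<in> B \<Longrightarrow> h' z = z" for z using d by (auto simp: B_def h'_def)
    show ?thesis
    proof (rule card_orbits_retract[where h = h'])
      show "h' z \<in> B" if "z \<in> A" for z using that by (rule cases_A) (use h' uB in auto)
      have st: "(z, rot X z) \<in> (steps A {rot X})\<^sup>*" if "z \<in> A" for z using that by auto
      have "(v, y) \<in> (steps A {rot X})\<^sup>*" using st[of v] xy ov by simp
      then have "(y, v) \<in> (steps A {rot X})\<^sup>*" using symX[of "{rot X}"] by (auto dest: symD)
      moreover have xu: "(x, u) \<in> (steps A {rot X})\<^sup>*" using st[of x] xy ov by simp
      ultimately show "(z, h' z) \<in> (steps A {rot X})\<^sup>*" if "z \<in> A" for z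
        by (cases rule: cases_A[OF that]) (use h' uB in auto)
      have uv: "(u, v) \<in> (steps A {rot X})\<^sup>*" using st[of u] xy ov by simp
      then have vu: "(v, u) \<in> (steps A {rot X})\<^sup>*" using symX[of "{rot X}"] by (auto dest: symD)
      show "f z \<in> A \<and> (h' z, h' (f z)) \<in> (steps B {rot Y})\<^sup>*" if "z \<in> A" and f: "f \<in> {rot X}" for z f
      proof
        have f: "f = rot X" using f by simp
        show "f z \<in> A" using that rotA by auto
        show "(h' z, h' (f z)) \<in> (steps B {rot Y})\<^sup>*"
          using that(1) by (rule cases_A; intro steps_refl_or_step)
            (simp_all add: f h' uB ov rotB d Y)
      qed
      show "(z, g z) \<in> (steps A {rot X})\<^sup>*" if "z \<in> B" "g \<in> {rot Y}" for z g
        using that uv vu st[of z] AB by (auto simp: Y)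
    qed (use fin \<open>B \<subseteq> A\<close> h' symX[of "{rot X}"] symY[of "{rot Y}"] in auto)
  qed

  \<comment> \<open>The monogon \<open>{x}\<close> is a boundary walk by itself. It is split off
    before the remaining walks are retracted to \<open>B\<close>.\<close>
  let ?A = "B \<union> {y}"
  have A_split: "A = ?A \<union> {x}" using AB by auto
  have faceB: "face X z \<in> ?A" if "z \<in> ?A" for z
  proof -
    have "face X z \<in> A" "face X z \<noteq> face X x"
      using that rotA face_inj[OF X, of z x] xy AB nB d by (auto simp: A_def)
    moreover have "face X x = x" using ov by (simp add: fX)
    ultimately show ?thesis using A_split by simp
  qed
  have "card (orbits A {face X}) = card (orbits ?A {face X}) + card (orbits {x} {face X})"
    unfolding A_split
  proof (rule card_orbits_split)
    show "finite (?A \<union> {x})" using fin A_split by metis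
    show "?A \<inter> {x} = {}" using nB d by blast
    show "f z \<in> ?A" if "z \<in> ?A" "f \<in> {face X}" for z f using that faceB by blast
    show "f z \<in> {x}" if "z \<in> {x}" "f \<in> {face X}" for z f using that ov by (simp add: fX)
  qed
  moreover have "card (orbits {x} {face X}) = 1"
    by (rule card_orbits_transitive[of x]) (use ov in \<open>auto simp: fX\<close>)
  moreover have "card (orbits ?A {face X}) = card (orbits B {face Y})"
  proof (rule card_orbits_retract[where h = h])
    have inj: "inj_on (face X) ?A"
      using face_inj[OF X] AB by (auto simp: inj_on_def A_def)
    have "finite ?A" "face X ` ?A \<subseteq> ?A" using fin AB faceB by auto
    then show "sym ((steps ?A {face X})\<^sup>*)"
      using inj_on_finite_returns[OF _ _ inj] by (intro steps_sym) blast
    show "h z \<in> B" if "z \<in> ?A" for z using that h uB by auto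
    have st: "(z, face X z) \<in> (steps ?A {face X})\<^sup>*" if "z \<in> ?A" for z using that by auto
    have yu: "(y, u) \<in> (steps ?A {face X})\<^sup>*" using st[of y] ov by (simp add: fX)
    then show "(z, h z) \<in> (steps ?A {face X})\<^sup>*" if "z \<in> ?A" for z using that h by auto
    show "f z \<in> ?A \<and> (h z, h (f z)) \<in> (steps B {face Y})\<^sup>*" if zA: "z \<in> ?A" and f: "f \<in> {face X}" for z f
    proof
      have f: "f = face X" using f by simp
      show "f z \<in> ?A" using that faceB by auto
      consider "z = y" | "z \<in> B" "opp X z = u" | "z \<in> B" "opp X z = v"
        | "z \<in> B" "opp X z \<noteq> u" "opp X z \<noteq> v" using zA by blast
      then show "(h z, h (f z)) \<in> (steps B {face Y})\<^sup>*"
        by (cases; intro steps_refl_or_step)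
          (simp_all add: f h uB ov oppB rotB d fX fY)
    qed
    show "(z, g z) \<in> (steps ?A {face X})\<^sup>*" if "z \<in> B" and g: "g \<in> {face Y}" for z g
    \<comment> \<open>In this case the walk from \<open>z\<close> through \<open>y\<close> to
      \<open>u\<close> is shortened to a single step of \<open>face Y\<close>.\<close>
    proof (cases "opp X z = v")
      case True
      then have "(z, y) \<in> (steps ?A {face X})\<^sup>*" using st[of z] that ov by (simp add: fX)
      then show ?thesis using True yu g by (simp add: fY)
    next
      case False
      then show ?thesis using st[of z] that ov d by (auto simp: fX fY)
    qed
  qed (use fin AB h symY[of "{face Y}"] in auto)
  ultimately have F: "card (orbits A {face X}) = card (orbits B {face Y}) + 1" by simp

  have C: "card (orbits A {rot X, opp X}) = card (orbits B {rot Y, opp Y})"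
  proof (rule card_orbits_retract[where h = h])
    let ?r = "(steps A {rot X, opp X})\<^sup>*"
    show sy: "sym ?r" "sym ((steps B {rot Y, opp Y})\<^sup>*)"
      using symX[of "{rot X, opp X}"] symY[of "{rot Y, opp Y}"] by simp_all
    show "h z \<in> B" if "z \<in> A" for z using that by (rule cases_A) (use h uB in auto)
    have st: "(z, rot X z) \<in> ?r" "(z, opp X z) \<in> ?r" if "z \<in> A" for z using that by auto
    have e: "(x, u) \<in> ?r" "(u, v) \<in> ?r" "(y, x) \<in> ?r" using st[of x] st[of u] st[of y] xy ov by simp_all
    then have e': "(y, u) \<in> ?r" "(v, u) \<in> ?r" using sy(1) by (meson rtrancl_trans symD)+
    show "(z, h z) \<in> ?r" if "z \<in> A" for z
      using that by (rule cases_A) (use h uB e e' in auto)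
    show "f z \<in> A \<and> (h z, h (f z)) \<in> (steps B {rot Y, opp Y})\<^sup>*"
      if zA: "z \<in> A" and fF: "f \<in> {rot X, opp X}" for z f
    proof
      show "f z \<in> A" using that rotA by auto
      consider "f = rot X" | "f = opp X" using fF by blast
      then show "(h z, h (f z)) \<in> (steps B {rot Y, opp Y})\<^sup>*"
      proof cases
        case 1
        show ?thesis using zA
          by (rule cases_A; intro steps_refl_or_step) (simp_all add: 1 h uB ov rotB d Y)
      next
        case 2
        show ?thesis using zA
          by (rule cases_A; intro steps_refl_or_step) (simp_all add: 2 h uB ov oppB d Y)
      qed
    qed
    show "(z, g z) \<in> ?r" if "z \<in> B" "g \<in> {rot Y, opp Y}" for z g
      using that e e' st[of z] AB by (auto simp: Y)
  qed (use fin \<open>B \<subseteq> A\<close> h in auto)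

  have "card A = card B + 2" using AB fin nB d by auto
  then have E: "card (orbits A {opp X}) = card (orbits B {opp Y}) + 1"
    using card_edges[OF X] card_edges[OF LY] by (simp add: A_def Y)

  have reg: "y \<in> r \<longleftrightarrow> u \<in> r" "x \<in> r \<longleftrightarrow> r = {x}" if "r \<in> regions X" for r
    using kink_regions[OF X x that] by (simp_all add: y_def u_def)
  have "inj_on (\<lambda>r. r - {x, y}) (regions X - {{x}})"
  proof (rule inj_onI)
    fix r s assume rs: "r \<in> regions X - {{x}}" "s \<in> regions X - {{x}}" "r - {x, y} = s - {x, y}"
    have "r \<in> regions X" "s \<in> regions X" using rs by auto
    moreover have "r - {x, y} \<noteq> {}"
      using reg[OF calculation(1)] region_nonempty[OF X calculation(1)] rs(1) uB nB by blast
    then obtain z where "z \<in> r" "z \<in> s" using rs(3) by blast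
    ultimately show "r = s" using region_unique[OF X] by blast
  qed
  moreover have "finite (regions X)" "{x} \<in> regions X"
    using finite_darts[OF X] regions_partition[OF X] finite_elements x by (auto simp: kink_def)
  ultimately have "card (regions X) = card (regions Y) + 1"
    using card_Suc_Diff1[of "regions X" "{x}"] by (simp add: Y(4) card_image del: card_Diff_insert)
  moreover have "darts X \<noteq> {}" "darts Y \<noteq> {}" using uB xy by (auto simp: Y A_def)
  ultimately have R: "region_count X = region_count Y + 1" by (simp add: region_count_def)

  have "(z, w) \<in> (adjacency X)\<^sup>*" if "z \<in> A" "w \<in> A" for z w
  proof (rule adjacency_retract[where D' = Y])
    have adj: "(z, rot X z) \<in> adjacency X" "(z, opp X z) \<in> adjacency X" if "z \<in> A" for z
      using that rotA by (auto simp: adjacency_def A_def)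
    have e: "(x, u) \<in> (adjacency X)\<^sup>*" "(u, v) \<in> (adjacency X)\<^sup>*" "(v, y) \<in> (adjacency X)\<^sup>*"
      "(y, x) \<in> (adjacency X)\<^sup>*"
      using adj[of x] adj[of u] adj[of v] adj[of y] xy ov by auto
    have e': "(u, x) \<in> (adjacency X)\<^sup>*" "(y, u) \<in> (adjacency X)\<^sup>*" "(u, y) \<in> (adjacency X)\<^sup>*"
      "(v, u) \<in> (adjacency X)\<^sup>*"
      using e by (meson rtrancl_trans)+
    show "\<exists>w\<in>darts Y. (z, w) \<in> (adjacency X)\<^sup>* \<and> (w, z) \<in> (adjacency X)\<^sup>*"
      if "z \<in> darts X" for z
      using that e e' uB AB unfolding Y(1) A_def[symmetric] by blast
    show "adjacency Y \<subseteq> (adjacency X)\<^sup>*"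
    proof (rule subrelI)
      fix z w assume "(z, w) \<in> adjacency Y"
      then have zw: "z \<in> B" "w \<in> B"
        and "w = rot Y z \<or> w = opp X z \<or> (\<exists>r\<in>regions Y. z \<in> r \<and> w \<in> r)"
        by (simp_all add: adjacency_def Y(1,3))
      then have c: "w = rot Y z \<or> w = opp X z \<or> (\<exists>r\<in>regions X. z \<in> r \<and> w \<in> r)"
        unfolding Y(4) by blast
      have A: "z \<in> A" "w \<in> A" using zw AB by auto
      from c show "(z, w) \<in> (adjacency X)\<^sup>*"
      proof (elim disjE)
        assume "w = rot Y z"
        then show ?thesis using e e' adj(1)[OF A(1)] by (auto simp: Y split: if_splits)
      next
        assume "\<exists>r\<in>regions X. z \<in> r \<and> w \<in> r"
        then have "(z, w) \<in> adjacency X" using A by (simp add: adjacency_def A_def)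
        then show ?thesis by blast
      qed (use adj(2)[OF A(1)] in blast)
    qed
    show "\<forall>x\<in>darts Y. \<forall>y\<in>darts Y. (x, y) \<in> (adjacency Y)\<^sup>*"
      using SY unfolding spherical_def connected_iff[OF LY] by simp
  qed (use that in \<open>simp_all add: A_def\<close>)
  then show ?thesis using SY V F C E R
    unfolding spherical_def connected_iff[OF X] connected_iff[OF LY]
    by (simp add: Y A_def)
qed

section \<open>Isotopy and insertion of tangles\<close>

text \<open>\<open>rot\<close> and \<open>opp\<close> are total functions, and two constructions of
  the same diagram may disagree outside its darts. Identities between constructions therefore hold
  only up to this relation, which is an isotopy with the identity as relabelling.\<close>

definition deqv :: "diagram \<Rightarrow> diagram \<Rightarrow> bool" (infix "\<approx>" 50) where
  "D \<approx> D' \<longleftrightarrow> darts D = darts D' \<and> (\<forall>x\<in>darts D. rot D x = rot D' x \<and> opp D x = opp D' x) \<and>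
     over D = over D' \<and> regions D = regions D'"

lemma deqv_refl [simp]: "D \<approx> D" by (simp add: deqv_def)
lemma deqv_sym: "D \<approx> D' \<Longrightarrow> D' \<approx> D" by (simp add: deqv_def)
lemma deqv_trans [trans]: "D \<approx> D' \<Longrightarrow> D' \<approx> D'' \<Longrightarrow> D \<approx> D''" by (simp add: deqv_def)

lemma deqv_iso: "D \<approx> D' \<Longrightarrow> diagram_iso id D D'"
  by (simp add: diagram_iso_def deqv_def)

lemma deqv_marker:
  assumes "D \<approx> D'" "local_diagram D"
  shows "marker D' x \<longleftrightarrow> marker D x" "crossing D' x \<longleftrightarrow> crossing D x"
proof -
  have r: "rot D' y = rot D y" "darts D' = darts D" if "y \<in> darts D" for y
    using assms(1) that by (simp_all add: deqv_def)
  have d: "darts D' = darts D" using assms(1) by (simp add: deqv_def)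
  show "marker D' x \<longleftrightarrow> marker D x" "crossing D' x \<longleftrightarrow> crossing D x"
    using rot_darts[OF assms(2)] by (auto simp: marker_def crossing_def d r)
qed

lemma deqv_local:
  assumes "D \<approx> D'" "local_diagram D"
  shows "local_diagram D'"
proof (rule local_diagramI)
  have e: "darts D' = darts D" "over D' = over D" "regions D' = regions D"
    "x \<in> darts D \<Longrightarrow> rot D' x = rot D x" "x \<in> darts D \<Longrightarrow> opp D' x = opp D x" for x
    using assms(1) by (simp_all add: deqv_def)
  note d = opp_darts[OF assms(2)] opp_neq[OF assms(2)] opp_opp[OF assms(2)] rot_darts[OF assms(2)]
  show "face D' x \<in> r" if "r \<in> regions D'" "x \<in> r" for r x
    using that face_region[OF assms(2), of r x] region_subset[OF assms(2), of r] d
    by (auto simp: e face_def)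
  show "x \<in> over D' \<longleftrightarrow> rot D' x \<notin> over D'" if "crossing D' x" for x
  proof -
    have "crossing D x" using that deqv_marker[OF assms] by simp
    moreover from this have "x \<in> darts D" by (simp add: crossing_def)
    ultimately show ?thesis using over_crossing[OF assms(2)] by (simp add: e)
  qed
  show "x \<notin> over D'" if "marker D' x" for x
    using that deqv_marker[OF assms] over_marker[OF assms(2)] by (simp add: e)
  show "opp D' x \<in> darts D' \<and> opp D' x \<noteq> x \<and> opp D' (opp D' x) = x"
    "rot D' x \<in> darts D' \<and> (marker D' x \<or> crossing D' x)" if "x \<in> darts D'" for x
    using that e d deqv_marker[OF assms] marker_or_crossing[OF assms(2)] by simp_all
  show "finite (darts D')" "over D' \<subseteq> darts D'" "partition_on (darts D') (regions D')"
    using finite_darts[OF assms(2)] over_subset[OF assms(2)] regions_partition[OF assms(2)]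
    by (simp_all add: e)
qed

lemma deqv_link:
  assumes "D \<approx> D'" "link_diagram D"
  shows "link_diagram D'"
proof -
  have L: "local_diagram D" "spherical D" using assms(2) by (simp_all add: link_diagram_iff)
  note e = assms(1)[unfolded deqv_def]
  have f: "face D' x = face D x" if "x \<in> darts D" for x
    using that e opp_darts[OF L(1)] by (simp add: face_def)
  have s: "steps A {g} = (\<lambda>x. (x, g x)) ` A"
    "steps A {g, h} = (\<lambda>x. (x, g x)) ` A \<union> (\<lambda>x. (x, h x)) ` A" for A and g h :: "nat \<Rightarrow> nat"
    by auto
  have o1: "orbits A {g} = orbits A {g'}" if "\<And>x. x \<in> A \<Longrightarrow> g x = g' x" for A and g g' :: "nat \<Rightarrow> nat"
    unfolding orbits_def s using that by simp
  have o2: "orbits A {g, h} = orbits A {g', h'}"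
    if "\<And>x. x \<in> A \<Longrightarrow> g x = g' x" "\<And>x. x \<in> A \<Longrightarrow> h x = h' x" for A and g g' h h' :: "nat \<Rightarrow> nat"
    unfolding orbits_def s using that by simp
  have "adjacency D = adjacency D'"
    using e unfolding adjacency_def by (auto simp del: ex_simps)
  moreover have "orbits (darts D) {rot D} = orbits (darts D') {rot D'}"
    "orbits (darts D) {opp D} = orbits (darts D') {opp D'}"
    "orbits (darts D) {face D} = orbits (darts D') {face D'}"
    "orbits (darts D) {rot D, opp D} = orbits (darts D') {rot D', opp D'}"
    using e f by (auto intro!: o1 o2)
  moreover have "region_count D = region_count D'" using e by (simp add: region_count_def)
  ultimately have "spherical D'"
    using L(2) e unfolding spherical_def connected_iff[OF L(1)] connected_iff[OF deqv_local[OF assms(1) L(1)]]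
    by simp
  then show ?thesis using deqv_local[OF assms(1) L(1)] by (simp add: link_diagram_iff)
qed

section \<open>Isotopy as an equivalence relation, and transfer of sphericity\<close>

lemma isotopic_refl [simp]: "isotopic D D"
  by (simp add: isotopic_def equivclp_def)

lemma isotopic_sym: "isotopic D D' \<Longrightarrow> isotopic D' D"
  unfolding isotopic_def by (rule equivclp_sym)

lemma isotopic_trans [trans]: "isotopic D D' \<Longrightarrow> isotopic D' D'' \<Longrightarrow> isotopic D D''"
  unfolding isotopic_def by (rule equivclp_trans)

lemma isotopic_step: "isotopy_step D D' \<Longrightarrow> isotopic D D'"
  unfolding isotopic_def by (rule r_into_equivclp)

lemma isotopic_iso: "link_diagram D \<Longrightarrow> link_diagram D' \<Longrightarrow> diagram_iso f D D' \<Longrightarrow> isotopic D D'"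
  by (rule isotopic_step) (auto simp: isotopy_step_def)

lemma isotopic_deqv: "link_diagram D \<Longrightarrow> D \<approx> D' \<Longrightarrow> isotopic D D'"
  using isotopic_iso deqv_link deqv_iso by metis

lemma isotopic_remove_marker:
  assumes "link_diagram D" "removable_marker D v" "link_diagram D'" "remove_marker v D \<approx> D'"
  shows "isotopic D D'"
proof -
  have "link_diagram (remove_marker v D)" using deqv_link[OF deqv_sym] assms(3,4) by blast
  moreover from this have "isotopic D (remove_marker v D)"
    using assms by (auto intro!: isotopic_step simp: isotopy_step_def)
  ultimately show ?thesis using isotopic_trans isotopic_deqv assms(4) by blast
qed

lemma isotopic_link_diagram:
  assumes "isotopic D D'" "link_diagram D"
  shows "link_diagram D'"
  using assms(1) unfolding isotopic_def
  by (induction rule: equivclp_induct) (use assms(2) in \<open>auto simp: isotopy_step_def\<close>)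

lemma link_remove_marker:
  assumes "local_diagram D" "removable_marker D v"
  shows "link_diagram (remove_marker v D) \<longleftrightarrow> link_diagram D"
  using spherical_remove_marker[OF assms] local_remove_marker[OF assms] assms(1)
  by (simp add: link_diagram_iff)

text \<open>The pattern by which enlarged diagrams become link diagrams: their local conditions are
  checked directly, and sphericity is inherited from the diagram that the deletion leads back
  to.\<close>

lemma link_of_remove_marker:
  assumes "local_diagram D" "removable_marker D v" "remove_marker v D \<approx> D'" "link_diagram D'"
  shows "link_diagram D"
  using deqv_link[OF deqv_sym[OF assms(3)] assms(4)] link_remove_marker[OF assms(1,2)] by simp

lemma link_of_remove_kink:
  assumes "local_diagram D" "kink D x" "remove_kink x D \<approx> D'" "link_diagram D'"
  shows "link_diagram D"
  using spherical_remove_kink[OF assms(1,2)] deqv_link[OF deqv_sym[OF assms(3)] assms(4)] assms(1)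
  by (simp add: link_diagram_iff)

text \<open>The distinguished marker must have different regions on its two sides, since these are
  glued separately to the two sides of the edge that receives the tangle.\<close>

definition tangle :: "diagram \<Rightarrow> nat \<Rightarrow> bool" where
  "tangle T b \<longleftrightarrow> local_diagram T \<and> marker T b \<and> rot T b \<notin> reg T b"

definition attach :: "nat \<Rightarrow> diagram \<Rightarrow> nat \<Rightarrow> diagram \<Rightarrow> nat set \<Rightarrow> nat set" where
  "attach d T b D r = r \<union> (if d \<in> r then reg T b else {}) \<union>
     (if opp D d \<in> r then reg T (rot T b) else {})"

text \<open>Unlike \<open>insert_tangle\<close>, this remains meaningful when the edge has the same region on both
  sides; so it can be used without proving that this never happens in a planar diagram.\<close>

definition ins :: "nat \<Rightarrow> diagram \<Rightarrow> nat \<Rightarrow> diagram \<Rightarrow> diagram" where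
  "ins d T b D =
     \<lparr> darts = darts D \<union> darts T,
       rot = (\<lambda>x. if x \<in> darts T then rot T x else rot D x),
       opp = (\<lambda>x. if x \<in> darts T then opp T x else opp D x)
         (d := opp T b, opp T b := d, opp D d := b, b := opp D d),
       over = over D \<union> over T,
       regions = attach d T b D ` regions D \<union> (regions T - {reg T b, reg T (rot T b)}) \<rparr>"

lemma ins_simps [simp]:
  "darts (ins d T b D) = darts D \<union> darts T"
  "over (ins d T b D) = over D \<union> over T"
  "regions (ins d T b D) = attach d T b D ` regions D \<union> (regions T - {reg T b, reg T (rot T b)})"
  by (simp_all add: ins_def)

text \<open>Only local conditions are assumed and derived here; sphericity of an insertion is
  treated separately, through deletions.\<close>

locale insertion =
  fixes d :: nat and T :: diagram and b :: nat and D :: diagram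
  assumes D: "local_diagram D" and d: "d \<in> darts D" and Tb: "tangle T b"
    and disj: "darts D \<inter> darts T = {}"
begin

abbreviation "e \<equiv> opp D d"
abbreviation "f \<equiv> opp T b"
abbreviation "c \<equiv> rot T b"
abbreviation "I \<equiv> ins d T b D"

lemma T: "local_diagram T" and marker_b: "marker T b" and b: "b \<in> darts T"
  and c_notin: "rot T b \<notin> reg T b"
  using Tb by (auto simp: tangle_def marker_def)

lemma e: "e \<in> darts D" "e \<noteq> d" "opp D e = d"
  using D d opp_darts opp_neq opp_opp by auto

lemma bcf: "f \<in> darts T" "f \<noteq> b" "opp T f = b" "c \<in> darts T" "c \<noteq> b" "rot T c = b"
  using T b marker_b opp_darts opp_neq opp_opp rot_darts by (auto simp: marker_def)

lemma notin: "x \<in> darts D \<Longrightarrow> x \<notin> darts T" "x \<in> darts T \<Longrightarrow> x \<notin> darts D"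
  using disj by auto

lemma neq: "x \<in> darts D \<Longrightarrow> y \<in> darts T \<Longrightarrow> x \<noteq> y" "x \<in> darts D \<Longrightarrow> y \<in> darts T \<Longrightarrow> y \<noteq> x"
  using disj by auto

lemma rot_I [simp]:
  "x \<in> darts D \<Longrightarrow> rot I x = rot D x" "x \<in> darts T \<Longrightarrow> rot I x = rot T x"
  using notin by (simp_all add: ins_def)

lemma opp_I [simp]:
  "opp I d = f" "opp I e = b" "opp I f = d" "opp I b = e"
  "x \<in> darts D \<Longrightarrow> x \<noteq> d \<Longrightarrow> x \<noteq> e \<Longrightarrow> opp I x = opp D x"
  "x \<in> darts T \<Longrightarrow> x \<noteq> b \<Longrightarrow> x \<noteq> f \<Longrightarrow> opp I x = opp T x"
  using d e b bcf neq[of x f] neq[of x b] neq[of d x] neq[of e x] neq[of d b] neq[of d f]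
    neq[of e b] neq[of e f] notin by (simp_all add: ins_def)

lemma marker_I [simp]:
  "x \<in> darts D \<Longrightarrow> marker I x \<longleftrightarrow> marker D x" "x \<in> darts T \<Longrightarrow> marker I x \<longleftrightarrow> marker T x"
  "x \<in> darts D \<Longrightarrow> crossing I x \<longleftrightarrow> crossing D x" "x \<in> darts T \<Longrightarrow> crossing I x \<longleftrightarrow> crossing T x"
  using rot_darts[OF D] rot_darts[OF T] by (simp_all add: marker_def crossing_def)

lemma reg_b: "reg T b \<in> regions T" "b \<in> reg T b" and reg_c: "reg T c \<in> regions T" "c \<in> reg T c"
  and reg_bc: "reg T b \<noteq> reg T c"
  using reg_regions[OF T] reg_self[OF T] b bcf c_notin by auto

lemma reg_sub: "reg T b \<subseteq> darts T" "reg T c \<subseteq> darts T"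
  using region_subset[OF T] reg_b reg_c by auto

lemma reg_disj: "reg T b \<inter> reg T c = {}"
  using region_unique[OF T reg_b(1) reg_c(1)] reg_bc by blast

lemma reg_mem [simp]: "b \<notin> reg T c" "f \<in> reg T c" "f \<notin> reg T b" "b \<in> reg T b" "c \<in> reg T c"
proof -
  show "b \<in> reg T b" "c \<in> reg T c" by (rule reg_b reg_c)+
  then show "b \<notin> reg T c" using reg_disj by blast
  show "f \<in> reg T c"
    using face_region[OF T reg_c(1) bcf(1)] bcf(3) reg_c(2) by (simp add: face_def)
  then show "f \<notin> reg T b" using reg_disj by blast
qed

lemma other_region:
  assumes "s \<in> regions T - {reg T b, reg T c}"
  shows "b \<notin> s" "c \<notin> s" "f \<notin> s" "s \<subseteq> darts T" "s \<inter> reg T b = {}" "s \<inter> reg T c = {}"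
proof -
  have s: "s \<in> regions T" "s \<noteq> reg T b" "s \<noteq> reg T c" using assms by auto
  then show "s \<inter> reg T b = {}" "s \<inter> reg T c = {}" "s \<subseteq> darts T"
    using region_unique[OF T s(1)] reg_b(1) reg_c(1) region_subset[OF T s(1)] by blast+
  then show "b \<notin> s" "c \<notin> s" "f \<notin> s" using reg_mem(2,4,5) by blast+
qed

lemma attach_mem [simp]:
  assumes "r \<in> regions D"
  shows "x \<in> darts D \<Longrightarrow> x \<in> attach d T b D r \<longleftrightarrow> x \<in> r"
    "x \<in> darts T \<Longrightarrow> x \<in> attach d T b D r \<longleftrightarrow> d \<in> r \<and> x \<in> reg T b \<or> e \<in> r \<and> x \<in> reg T c"
  using region_subset[OF D assms] reg_sub notin by (auto simp: attach_def)

lemma attach_sub: "r \<in> regions D \<Longrightarrow> attach d T b D r \<subseteq> darts D \<union> darts T"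
  using region_subset[OF D] reg_sub by (auto simp: attach_def)

lemma attach_other:
  assumes "r \<in> regions D" "s \<in> regions T - {reg T b, reg T c}"
  shows "attach d T b D r \<inter> s = {}"
  using other_region[OF assms(2)] attach_mem(2)[OF assms(1)] by blast

lemma partition_I: "partition_on (darts I) (regions I)"
proof (rule partition_onI)
  show "{} \<notin> regions I"
    using region_nonempty[OF D] region_nonempty[OF T] by (auto simp: attach_def)
next
  show "\<Union> (regions I) = darts I"
  proof
    show "\<Union> (regions I) \<subseteq> darts I" using attach_sub other_region(4) by (auto simp: subset_iff)
    show "darts I \<subseteq> \<Union> (regions I)"
    proof
      fix x assume "x \<in> darts I"
      then consider "x \<in> darts D" | "x \<in> darts T" "x \<in> reg T b" | "x \<in> darts T" "x \<in> reg T c"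
        | "x \<in> darts T" "x \<notin> reg T b" "x \<notin> reg T c" by auto
      then show "x \<in> \<Union> (regions I)"
      proof cases
        case 1
        then obtain r where "r \<in> regions D" "x \<in> r" using region_ex[OF D] by metis
        then show ?thesis by (auto simp: attach_def)
      next
        case 2
        obtain r where "r \<in> regions D" "d \<in> r" using region_ex[OF D d] by metis
        then show ?thesis using 2 by (auto simp: attach_def)
      next
        case 3
        obtain r where "r \<in> regions D" "e \<in> r" using region_ex[OF D e(1)] by metis
        then show ?thesis using 3 by (auto simp: attach_def)
      next
        case 4
        then obtain r where "r \<in> regions T" "x \<in> r" using region_ex[OF T] by metis
        then show ?thesis using 4 by auto
      qed
    qed
  qed
next
  fix p q assume p: "p \<in> regions I" and q: "q \<in> regions I" and "p \<noteq> q"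
  have "p = q" if x: "x \<in> p" "x \<in> q" for x
  proof -
    consider r s where "r \<in> regions D" "s \<in> regions D" "p = attach d T b D r" "q = attach d T b D s"
      | r where "r \<in> regions D" "p = attach d T b D r" "q \<in> regions T - {reg T b, reg T c}"
      | r where "r \<in> regions D" "q = attach d T b D r" "p \<in> regions T - {reg T b, reg T c}"
      | "p \<in> regions T" "q \<in> regions T" using p q unfolding ins_simps by blast
    then show "p = q"
    proof cases
      case 1
      have "x \<in> darts D \<or> x \<in> darts T" using x attach_sub 1 by auto
      then have "\<exists>z. z \<in> r \<and> z \<in> s"
        using x 1 reg_disj by auto
      then show ?thesis using region_unique[OF D 1(1,2)] 1 by auto
    next
      case 2
      then show ?thesis using x attach_other by blast
    next
      case 3
      then show ?thesis using x attach_other by blast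
    next
      case 4
      then show ?thesis using region_unique[OF T] x by blast
    qed
  qed
  then show "disjnt p q" using \<open>p \<noteq> q\<close> by (auto simp: disjnt_def)
qed

lemma face_I:
  "x \<in> darts D \<Longrightarrow> x \<noteq> d \<Longrightarrow> x \<noteq> e \<Longrightarrow> face I x = face D x"
  "x \<in> darts T \<Longrightarrow> x \<noteq> b \<Longrightarrow> x \<noteq> f \<Longrightarrow> face I x = face T x"
  "face I d = face T b" "face I e = c" "face I b = face D d" "face I f = face D e"
  using d e b bcf opp_darts[OF D] opp_darts[OF T] by (simp_all add: face_def)

lemma local_I: "local_diagram I"
proof (rule local_diagramI)
  have x_cases: "P" if "x \<in> darts I" "x = d \<Longrightarrow> P" "x = e \<Longrightarrow> P" "x = b \<Longrightarrow> P" "x = f \<Longrightarrow> P"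
    "x \<in> darts D \<Longrightarrow> x \<noteq> d \<Longrightarrow> x \<noteq> e \<Longrightarrow> P" "x \<in> darts T \<Longrightarrow> x \<noteq> b \<Longrightarrow> x \<noteq> f \<Longrightarrow> P" for x P
    using that by auto
  show "opp I x \<in> darts I \<and> opp I x \<noteq> x \<and> opp I (opp I x) = x" if "x \<in> darts I" for x
    using that
  proof (rule x_cases)
    assume x: "x \<in> darts D" "x \<noteq> d" "x \<noteq> e"
    moreover have "opp D x \<noteq> d" "opp D x \<noteq> e"
      using x opp_opp[OF D x(1)] opp_opp[OF D d] by auto
    ultimately show ?thesis using opp_darts[OF D] opp_neq[OF D] opp_opp[OF D] by simp
  next
    assume x: "x \<in> darts T" "x \<noteq> b" "x \<noteq> f"
    moreover have "opp T x \<noteq> b" "opp T x \<noteq> f"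
      using x opp_opp[OF T x(1)] opp_opp[OF T b] by auto
    ultimately show ?thesis using opp_darts[OF T] opp_neq[OF T] opp_opp[OF T] by simp
  qed (use d e b bcf neq[of d f] neq[of e b] in simp_all)
  show "rot I x \<in> darts I \<and> (marker I x \<or> crossing I x)" if "x \<in> darts I" for x
    using that rot_darts[OF D, of x] rot_darts[OF T, of x] marker_or_crossing[OF D, of x]
      marker_or_crossing[OF T, of x]
    by auto
  show "x \<notin> over I" if "marker I x" for x
  proof -
    have "x \<in> darts I" using that by (simp add: marker_def)
    then show ?thesis
      using that over_subset[OF D] over_subset[OF T] over_marker[OF D] over_marker[OF T] notin by auto
  qed
  show "x \<in> over I \<longleftrightarrow> rot I x \<notin> over I" if "crossing I x" for x
  proof -
    have "x \<in> darts I" using that by (simp add: crossing_def)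
    then consider "x \<in> darts D" | "x \<in> darts T" by auto
    then show ?thesis
    proof cases
      case 1
      then have "x \<notin> over T" "rot D x \<notin> over T"
        using over_subset[OF T] rot_darts[OF D] notin by blast+
      then show ?thesis using 1 that over_crossing[OF D, of x] by simp
    next
      case 2
      then have "x \<notin> over D" "rot T x \<notin> over D"
        using over_subset[OF D] rot_darts[OF T] notin by blast+
      then show ?thesis using 2 that over_crossing[OF T, of x] by simp
    qed
  qed
  show "face I x \<in> r" if r: "r \<in> regions I" and x: "x \<in> r" for x r
  proof -
    have "x \<in> darts I" using x r partition_onD1[OF partition_I] by blast
    moreover consider s where "s \<in> regions D" "r = attach d T b D s"
      | "r \<in> regions T - {reg T b, reg T c}" using r by auto
    then show ?thesis
    proof cases
      case 1
      have fD: "face D y \<in> s" if "y \<in> s" for y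
        using face_region[OF D 1(1)] region_subset[OF D 1(1)] that by blast
      have fT: "face T y \<in> t" if "y \<in> t" "t \<in> regions T" for y t
        using face_region[OF T that(2)] region_subset[OF T that(2)] that by blast
      note mem = attach_mem[OF 1(1), folded 1(2)]
      from \<open>x \<in> darts I\<close> show ?thesis
      proof (rule x_cases)
        assume "x = d"
        then show ?thesis using x mem d face_darts[OF T b] fT[OF reg_b(2,1)] by (simp add: face_I)
      next
        assume "x = e"
        then show ?thesis using x mem e bcf by (simp add: face_I)
      next
        assume "x = b"
        then have "d \<in> s" using x mem b by simp
        then show ?thesis using \<open>x = b\<close> mem fD face_darts[OF D d] by (simp add: face_I)
      next
        assume "x = f"
        then have "e \<in> s" using x mem bcf by simp
        then show ?thesis using \<open>x = f\<close> mem fD face_darts[OF D e(1)] by (simp add: face_I)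
      next
        assume "x \<in> darts D" "x \<noteq> d" "x \<noteq> e"
        then show ?thesis using x mem fD face_darts[OF D] by (simp add: face_I)
      next
        assume "x \<in> darts T" "x \<noteq> b" "x \<noteq> f"
        then show ?thesis using x mem fT reg_b(1) reg_c(1) face_darts[OF T] by (auto simp: face_I)
      qed
    next
      case 2
      then have "x \<in> darts T" "x \<noteq> b" "x \<noteq> f" using other_region[OF 2] x by auto
      then show ?thesis using x 2 face_region[OF T] by (simp add: face_I)
    qed
  qed
  show "finite (darts I)" "over I \<subseteq> darts I" "partition_on (darts I) (regions I)"
    using finite_darts[OF D] finite_darts[OF T] over_subset[OF D] over_subset[OF T] partition_I
    by auto
qed

end

section \<open>Commuting insertions\<close>

text \<open>Prepares nested insertions. \<open>attach\<close> adds only darts of \<open>K\<close> to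
  the regions of \<open>T\<close>, so the two sides of the distinguished marker of \<open>T\<close>
  remain different.\<close>

lemma tangle_ins:
  assumes "tangle T b" "insertion d K k T"
  shows "tangle (ins d K k T) b"
    and "reg (ins d K k T) b = attach d K k T (reg T b)"
    and "reg (ins d K k T) (rot T b) = attach d K k T (reg T (rot T b))"
proof -
  interpret insertion d K k T by fact
  have m: "marker T b" "b \<in> darts T" "rot T b \<in> darts T" "rot T b \<notin> reg T b"
    using assms(1) rot_darts[OF D] by (auto simp: tangle_def marker_def)
  have r: "reg T b \<in> regions T" "b \<in> reg T b" "reg T (rot T b) \<in> regions T" "rot T b \<in> reg T (rot T b)"
    using reg_regions[OF D] reg_self[OF D] m by auto
  show b: "reg I b = attach d K k T (reg T b)"
    using r m by (intro reg_eq[OF local_I]) auto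
  show "reg I (rot T b) = attach d K k T (reg T (rot T b))"
    using r m by (intro reg_eq[OF local_I]) auto
  show "tangle I b" using m r local_I by (simp add: tangle_def b)
qed

lemma ins_cong:
  assumes "D \<approx> D'" "insertion d T b D"
  shows "ins d T b D \<approx> ins d T b D'" "insertion d T b D'"
proof -
  interpret insertion d T b D by fact
  have e: "darts D' = darts D" "over D' = over D" "regions D' = regions D"
    "x \<in> darts D \<Longrightarrow> rot D' x = rot D x" "x \<in> darts D \<Longrightarrow> opp D' x = opp D x" for x
    using assms(1) by (simp_all add: deqv_def)
  show "insertion d T b D'"
    using deqv_local[OF assms(1) D] d Tb disj by (simp add: insertion_def e)
  have "attach d T b D' = attach d T b D" using d e by (simp add: attach_def fun_eq_iff)
  then show "ins d T b D \<approx> ins d T b D'" using d e by (auto simp: deqv_def ins_def)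
qed

text \<open>The resulting formula is symmetric in the two tangles, which gives the commutation of
  the regions. If \<open>d = opp D d'\<close>, the tangles share an edge and after the first
  insertion \<open>d\<close> faces \<open>b'\<close>; the dart \<open>b'\<close> lies in the region
  obtained from \<open>r\<close> exactly when \<open>d' = opp D d\<close> lies in
  \<open>r\<close>.\<close>

lemma regions_ins_ins:
  assumes "insertion d T b D" "insertion d' T' b' D" "d \<noteq> d'" "darts T \<inter> darts T' = {}"
  shows "insertion d T b (ins d' T' b' D)"
    and "regions (ins d T b (ins d' T' b' D)) =
      (\<lambda>r. attach d T b D r \<union> attach d' T' b' D r) ` regions D \<union>
      (regions T - {reg T b, reg T (rot T b)}) \<union> (regions T' - {reg T' b', reg T' (rot T' b')})"
proof -
  interpret A: insertion d T b D by fact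
  interpret B: insertion d' T' b' D by fact
  show "insertion d T b B.I"
    using A.d A.Tb A.disj assms(4) B.local_I by (intro insertion.intro) auto
  have 1: "attach d T b B.I (attach d' T' b' D r) = attach d T b D r \<union> attach d' T' b' D r"
    if r: "r \<in> regions D" for r
  proof -
    have "d \<in> attach d' T' b' D r \<longleftrightarrow> d \<in> r" using B.attach_mem(1)[OF r] A.d by simp
    moreover have "opp B.I d \<in> attach d' T' b' D r \<longleftrightarrow> opp D d \<in> r"
    proof (cases "d = opp D d'")
      case True
      then show ?thesis using B.attach_mem(2)[OF r] B.b B.e by simp
    next
      case False
      then show ?thesis using B.attach_mem(1)[OF r] A.d A.e assms(3) by simp
    qed
    ultimately show ?thesis unfolding attach_def[of d T b] by (auto simp: attach_def[of d' T' b'])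
  qed
  have 2: "attach d T b B.I s = s" if "s \<in> regions T' - {reg T' b', reg T' (rot T' b')}" for s
  proof -
    note o = B.other_region[OF that]
    have "d \<notin> s" using o(4) A.d B.notin by blast
    moreover have "opp B.I d \<notin> s"
    proof (cases "d = opp D d'")
      case True
      then show ?thesis using o by simp
    next
      case False
      then show ?thesis using o(4) B.notin A.d A.e assms(3) by auto
    qed
    ultimately show ?thesis by (simp add: attach_def)
  qed
  have "attach d T b B.I ` attach d' T' b' D ` regions D =
      (\<lambda>r. attach d T b D r \<union> attach d' T' b' D r) ` regions D"
    using 1 by (simp add: image_image)
  moreover have "attach d T b B.I ` (regions T' - {reg T' b', reg T' (rot T' b')}) =
      regions T' - {reg T' b', reg T' (rot T' b')}"
    using 2 by simp
  ultimately show "regions (ins d T b B.I) =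
      (\<lambda>r. attach d T b D r \<union> attach d' T' b' D r) ` regions D \<union>
      (regions T - {reg T b, reg T (rot T b)}) \<union> (regions T' - {reg T' b', reg T' (rot T' b')})"
    by (simp add: image_Un Un_ac)
qed

text \<open>Each tangle ends up next to its own dart, even when \<open>d\<close> and
  \<open>d'\<close> are the two ends of one edge. At equal darts the later tangle would come to lie
  next to \<open>d\<close>, and the order would matter.\<close>

lemma ins_commute:
  assumes "insertion d T b D" "insertion d' T' b' D" "d \<noteq> d'" "darts T \<inter> darts T' = {}"
  shows "ins d T b (ins d' T' b' D) \<approx> ins d' T' b' (ins d T b D)"
proof -
  interpret A: insertion d T b D by fact
  interpret B: insertion d' T' b' D by fact
  have disj: "darts T' \<inter> darts T = {}" using assms(4) by auto
  interpret A': insertion d T b B.I by (rule regions_ins_ins[OF assms])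
  interpret B': insertion d' T' b' A.I
    by (rule regions_ins_ins[OF assms(2,1) assms(3)[symmetric] disj])
  have x_cases: "P" if "x \<in> darts A'.I" "x \<in> darts T \<Longrightarrow> x \<notin> darts T' \<Longrightarrow> x \<notin> darts D \<Longrightarrow> P"
    "x \<in> darts T' \<Longrightarrow> x \<notin> darts T \<Longrightarrow> x \<notin> darts D \<Longrightarrow> P"
    "x \<in> darts D \<Longrightarrow> x \<notin> darts T \<Longrightarrow> x \<notin> darts T' \<Longrightarrow> P" for x P
  proof -
    have "x \<in> darts T \<or> x \<in> darts T' \<or> x \<in> darts D" using that(1) by (simp add: disj_ac)
    then show P using that(2-4) A.disj B.disj assms(4) by (elim disjE) (metis disjoint_iff)+
  qed
  have "opp A'.I x = opp B'.I x" if x: "x \<in> darts A'.I" for x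
  proof -
    have n: "b \<notin> darts T'" "opp T b \<notin> darts T'" "b' \<notin> darts T" "opp T' b' \<notin> darts T"
      "b \<noteq> b'" "b \<noteq> opp T' b'" "opp T b \<noteq> b'" "opp T b \<noteq> opp T' b'"
      "b' \<noteq> b" "opp T' b' \<noteq> b" "b' \<noteq> opp T b" "opp T' b' \<noteq> opp T b"
      using assms(4) A.b A.bcf B.b B.bcf by auto
    note m = A.d A.e B.d B.e A.notin(1)[OF A.d] B.notin(1)[OF A.d] A.notin(1)[OF B.d] B.notin(1)[OF B.d]
      A.notin(1)[OF A.e(1)] B.notin(1)[OF A.e(1)] A.notin(1)[OF B.e(1)] B.notin(1)[OF B.e(1)]
      A.b B.b A.bcf(1,2) B.bcf(1,2) A.bcf(2)[symmetric] B.bcf(2)[symmetric]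
      A.e(2)[symmetric] B.e(2)[symmetric]
    have q: "y \<noteq> b" "y \<noteq> opp T b" "y \<noteq> b'" "y \<noteq> opp T' b'" "b \<noteq> y" "opp T b \<noteq> y" "b' \<noteq> y" "opp T' b' \<noteq> y"
      if "y \<in> darts D" for y
      using A.neq(1)[OF that] B.neq(1)[OF that] A.b A.bcf(1) B.b B.bcf(1) by metis+
    note q = q[OF A.d] q[OF A.e(1)] q[OF B.d] q[OF B.e(1)]
    have i: "opp D d = opp D d' \<longleftrightarrow> d = d'" "opp D d' = opp D d \<longleftrightarrow> d = d'"
      "opp D d = d' \<longleftrightarrow> d = opp D d'" "d' = opp D d \<longleftrightarrow> d = opp D d'" "opp D d' = d \<longleftrightarrow> d = opp D d'"
      using opp_inj[OF A.D A.d B.d] opp_inj[OF A.D A.e(1) B.d] opp_inj[OF A.D B.e(1) A.d]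
      by (simp_all add: A.e(3) B.e(3) eq_commute)
    note r = n m q i assms(3) assms(3)[symmetric]
    show ?thesis
      by (rule x_cases[OF x]; cases "d = opp D d'") (simp_all add: ins_def r, (auto simp: r)?)
  qed
  moreover have "rot A'.I x = rot B'.I x" if "x \<in> darts A'.I" for x
    by (rule x_cases[OF that]) (simp_all add: ins_def)
  moreover have "regions A'.I = regions B'.I"
    unfolding regions_ins_ins(2)[OF assms]
      regions_ins_ins(2)[OF assms(2,1) assms(3)[symmetric] disj]
    by (simp add: Un_ac)
  ultimately show ?thesis by (simp add: deqv_def Un_ac)
qed

text \<open>When \<open>T\<close> is cut open at its distinguished marker, the end \<open>b\<close>
  of the edge from \<open>b\<close> to \<open>opp T b\<close> is taken over by \<open>d\<close>. So
  the edge of \<open>T\<close> addressed by \<open>b\<close> is addressed by \<open>d\<close> in the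
  result, whereas all other darts of \<open>T\<close> address the same place as before.\<close>

lemma ins_nest:
  assumes "insertion d T b D" "insertion d' K k T" "darts K \<inter> darts D = {}"
  defines "d'' \<equiv> if d' = b then d else d'"
  shows "ins d'' K k (ins d T b D) \<approx> ins d (ins d' K k T) b D"
    and "insertion d'' K k (ins d T b D)" "insertion d (ins d' K k T) b D"
proof -
  interpret A: insertion d T b D by fact
  interpret B: insertion d' K k T by fact
  note J = tangle_ins[OF A.Tb assms(2)]
  have d''[simp]: "d'' = d" if "d' = b" using that by (simp add: d''_def)
  have d''2[simp]: "d'' = d'" if "d' \<noteq> b" using that by (simp add: d''_def)
  show L: "insertion d'' K k A.I"
    using A.local_I A.d B.d B.Tb B.disj assms(3) by (auto simp: insertion_def d''_def)
  show R: "insertion d B.I b D"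
    using A.D A.d J(1) A.disj assms(3) by (auto simp: insertion_def)
  interpret L: insertion d'' K k A.I by (rule L)
  interpret R: insertion d B.I b D by (rule R)
  let ?RT = "regions T - {reg T b, reg T (rot T b)}"
  let ?RK = "regions K - {reg K k, reg K (rot K k)}"
  have rotb: "rot B.I b = rot T b" using A.b by simp
  have opp_T: "opp T d' = b \<longleftrightarrow> d' = opp T b" using A.bcf A.b B.d opp_opp[OF A.T] by metis
  have opp_T2: "opp T b = opp T d' \<longleftrightarrow> d' = b" "opp T d' = opp T b \<longleftrightarrow> d' = b"
    using opp_inj[OF A.T A.b B.d] by auto
  have 1: "attach d'' K k A.I (attach d T b D r) = attach d B.I b D r" if r: "r \<in> regions D" for r
  proof -
    have m1: "d'' \<in> attach d T b D r \<longleftrightarrow> d \<in> r \<and> d' \<in> reg T b \<or> opp D d \<in> r \<and> d' \<in> reg T (rot T b)"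
      using A.attach_mem[OF r] A.d B.d by (cases "d' = b") auto
    have m2: "opp A.I d'' \<in> attach d T b D r \<longleftrightarrow>
        d \<in> r \<and> opp T d' \<in> reg T b \<or> opp D d \<in> r \<and> opp T d' \<in> reg T (rot T b)"
    proof (cases "d' = b")
      case True
      then show ?thesis using A.attach_mem[OF r] A.bcf by simp
    next
      case False
      then show ?thesis using A.attach_mem[OF r] A.d A.bcf B.d B.e by (cases "d' = opp T b") auto
    qed
    have "attach d B.I b D r = r \<union> (if d \<in> r then attach d' K k T (reg T b) else {}) \<union>
        (if opp D d \<in> r then attach d' K k T (reg T (rot T b)) else {})"
      unfolding attach_def[of d B.I] rotb J(2,3) ..
    also have "\<dots> = attach d'' K k A.I (attach d T b D r)"
      unfolding attach_def[of d'' K] m1 m2 by (auto simp: attach_def)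
    finally show ?thesis ..
  qed
  have 2: "attach d'' K k A.I s = attach d' K k T s" if s: "s \<in> ?RT" for s
  proof -
    note o = A.other_region[OF s]
    have ds: "d \<notin> s" using o(4) A.d A.notin by blast
    have "d'' \<in> s \<longleftrightarrow> d' \<in> s" using o ds by (cases "d' = b") auto
    moreover have "opp A.I d'' \<in> s \<longleftrightarrow> opp T d' \<in> s"
    proof (cases "d' = b")
      case False
      then show ?thesis using o ds A.bcf B.d by (cases "d' = opp T b") auto
    qed simp
    ultimately show ?thesis by (simp add: attach_def)
  qed
  have 3: "regions B.I - {reg B.I b, reg B.I (rot B.I b)} = attach d' K k T ` ?RT \<union> ?RK"
  proof -
    \<comment> \<open>Intersection with \<open>darts T\<close> recovers the original region, so
      \<open>attach\<close> is injective and taking images commutes with discarding the two side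
      regions.\<close>
    have "attach d' K k T s = attach d' K k T t \<longleftrightarrow> s = t" if "s \<in> regions T" "t \<in> regions T" for s t
    proof -
      have "s = attach d' K k T s \<inter> darts T" if "s \<in> regions T" for s
        using B.attach_mem(1)[OF that] region_subset[OF A.T that] by auto
      then show ?thesis using that by metis
    qed
    moreover have "attach d' K k T t \<notin> ?RK" if "t \<in> regions T" for t
      using B.attach_mem(1)[OF that] region_subset[OF A.T that] region_nonempty[OF A.T that]
        B.other_region(4)[of "attach d' K k T t"] B.notin by blast
    ultimately show ?thesis
      unfolding rotb J(2,3) using A.reg_b(1) A.reg_c(1) by auto
  qed
  have "attach d'' K k A.I ` attach d T b D ` regions D = attach d B.I b D ` regions D"
    "attach d'' K k A.I ` ?RT = attach d' K k T ` ?RT"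
    using 1 2 by (simp_all add: image_image)
  then have regs: "regions L.I = regions R.I"
    unfolding ins_simps(3)[of d B.I] 3 by (simp add: image_Un Un_ac)
  have x_cases: "P" if "x \<in> darts L.I" "x \<in> darts T \<Longrightarrow> x \<notin> darts K \<Longrightarrow> x \<notin> darts D \<Longrightarrow> P"
    "x \<in> darts K \<Longrightarrow> x \<notin> darts T \<Longrightarrow> x \<notin> darts D \<Longrightarrow> P"
    "x \<in> darts D \<Longrightarrow> x \<notin> darts T \<Longrightarrow> x \<notin> darts K \<Longrightarrow> P" for x P
  proof -
    have "x \<in> darts T \<or> x \<in> darts K \<or> x \<in> darts D" using that(1) by (simp add: disj_ac)
    then show P using that(2-4) A.disj B.disj assms(3) by (elim disjE) (metis disjoint_iff)+
  qed
  have "rot L.I x = rot R.I x" if "x \<in> darts L.I" for x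
    by (rule x_cases[OF that]) (simp_all add: ins_def)
  moreover have "opp L.I x = opp R.I x" if x: "x \<in> darts L.I" for x
  proof -
    have dD: "d \<in> darts D" "opp D d \<in> darts D" using A.d A.e by simp_all
    have bT: "b \<in> darts T" "opp T b \<in> darts T" "d' \<in> darts T" "opp T d' \<in> darts T"
      using A.b A.bcf B.d B.e by simp_all
    have kK: "k \<in> darts K" "opp K k \<in> darts K" using B.b B.bcf by simp_all
    have m: "y \<notin> darts T" "y \<notin> darts K" "y \<noteq> b" "y \<noteq> opp T b" "y \<noteq> d'" "y \<noteq> opp T d'" "y \<noteq> k" "y \<noteq> opp K k"
      if "y \<in> darts D" for y
      using that A.disj assms(3) bT kK by (metis disjoint_iff)+
    have n: "y \<notin> darts D" "y \<notin> darts K" "y \<noteq> d" "y \<noteq> opp D d" "y \<noteq> k" "y \<noteq> opp K k"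
      if "y \<in> darts T" for y
      using that A.disj B.disj dD kK by (metis disjoint_iff)+
    have p: "y \<notin> darts D" "y \<notin> darts T" "y \<noteq> d" "y \<noteq> opp D d" "y \<noteq> b" "y \<noteq> opp T b" "y \<noteq> d'" "y \<noteq> opp T d'"
      if "y \<in> darts K" for y
      using that B.disj assms(3) dD bT by (metis disjoint_iff)+
    note r = dD bT kK m[OF dD(1)] m[OF dD(2)] n[OF bT(1)] n[OF bT(2)] n[OF bT(3)] n[OF bT(4)]
      p[OF kK(1)] p[OF kK(2)] A.bcf(2,3) A.e(2,3) B.e(2,3) B.bcf(2,3) A.bcf(2)[symmetric] A.e(2)[symmetric]
      B.e(2)[symmetric] B.bcf(2)[symmetric] opp_T opp_T2
    show ?thesis
      by (rule x_cases[OF x]; cases "d' = b"; cases "d' = opp T b")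
        (simp_all add: ins_def r, (auto simp: r)?)
  qed
  ultimately show "L.I \<approx> R.I" using regs by (simp add: deqv_def Un_ac)
qed

lemma (in insertion) opp_I_if:
  "opp I x = (if x = d then f else if x = e then b else if x = f then d else if x = b then e
     else if x \<in> darts T then opp T x else opp D x)"
  using d e b bcf neq(1)[of d f] neq(1)[of d b] neq(1)[of e f] neq(1)[of e b] by (auto simp: ins_def)

text \<open>If \<open>d\<close> belongs to the deleted marker, the tangle beside \<open>d\<close>
  becomes adjacent to the far end of the marker's other edge, and this dart is \<open>d'\<close>.
  Otherwise the address of the edge survives.\<close>

lemma remove_marker_ins:
  assumes "insertion d T b D" "removable_marker D w"
  defines "d' \<equiv> if d = w then opp D (rot D w) else if d = rot D w then opp D w else d"
  shows "remove_marker w (ins d T b D) \<approx> ins d' T b (remove_marker w D)"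
    and "removable_marker (ins d T b D) w" "insertion d' T b (remove_marker w D)"
proof -
  interpret A: insertion d T b D by fact
  define w' where "w' = rot D w"
  define a where "a = opp D w"
  define a' where "a' = opp D w'"
  let ?D = "remove_marker w D"
  note m = removable_marker_darts[OF A.D assms(2), folded w'_def a_def a'_def]
  note reg = removable_marker_regions[OF A.D assms(2), folded w'_def a_def a'_def]
  have D': "darts ?D = darts D - {w, w'}" "rot ?D = rot D" "opp ?D = (opp D)(a := a', a' := a)"
    "over ?D = over D" "regions ?D = (\<lambda>r. r - {w, w'}) ` regions D"
    by (simp_all add: remove_marker_simps w'_def a_def a'_def)
  have d': "d' = (if d = w then a' else if d = w' then a else d)"
    by (simp add: d'_def w'_def a_def a'_def)
  show ins: "insertion d' T b ?D"
    using local_remove_marker[OF A.D assms(2)] A.d m A.Tb A.disj by (auto simp: insertion_def D' d')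
  have ri: "rot A.I w = w'" using m by (simp add: w'_def)
  have o: "opp D w = a" "opp D w' = a'" "opp D a = w" "opp D a' = w'"
    using m by (simp_all add: a_def a'_def)
  have nT: "w \<notin> darts T" "w' \<notin> darts T" "a \<notin> darts T" "a' \<notin> darts T" "d \<notin> darts T" "opp D d \<notin> darts T"
    "b \<notin> darts D" "opp T b \<notin> darts D"
    using m A.notin A.d A.e A.b A.bcf by auto
  have "opp T b \<noteq> w'" "b \<noteq> w'" using A.neq(2)[OF m(2)] A.b A.bcf(1) by metis+
  then have "opp A.I w \<noteq> w'"
    by (cases "w = d"; cases "w = opp D d") (simp_all add: m o)
  then show rem: "removable_marker A.I w"
    using assms(2) m(1) ri by (simp add: removable_marker_def)
  have d_cases: "d = w \<or> d = w' \<or> d = a \<or> d = a' \<or> (d \<notin> {w, w', a, a'} \<and> opp D d \<notin> {w, w', a, a'})"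
  proof -
    have "d \<in> {w, w', a, a'}" if "opp D d \<in> {w, w', a, a'}"
    proof -
      have "opp D (opp D d) \<in> opp D ` {w, w', a, a'}" using that by (rule imageI)
      then show ?thesis by (simp add: A.e o disj_ac)
    qed
    then show ?thesis by blast
  qed
  have att: "attach d T b D r - {w, w'} = attach d' T b ?D (r - {w, w'})" if r: "r \<in> regions D" for r
  proof -
    have 1: "d' \<in> r - {w, w'} \<longleftrightarrow> d \<in> r" by (simp add: d' reg[OF r] m)
    have 2: "opp ?D d' \<in> r - {w, w'} \<longleftrightarrow> opp D d \<in> r"
      using d_cases by (elim disjE) (simp_all add: d' D' reg[OF r] m o m(3,7-11)[symmetric])
    have 3: "reg T b \<inter> {w, w'} = {}" "reg T (rot T b) \<inter> {w, w'} = {}" using A.reg_sub nT by auto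
    have "attach d T b D r - {w, w'} = (r - {w, w'}) \<union> (if d \<in> r then reg T b else {}) \<union>
      (if opp D d \<in> r then reg T (rot T b) else {})"
      using 3 unfolding attach_def by auto
    also have "\<dots> = attach d' T b ?D (r - {w, w'})" unfolding attach_def 1 2 ..
    finally show ?thesis .
  qed
  have "s - {w, w'} = s" if "s \<in> regions T" for s using region_subset[OF A.T that] nT by auto
  then have regs: "regions (remove_marker w A.I) = regions (ins d' T b ?D)"
    using att by (simp add: remove_marker_simps ri w'_def[symmetric] image_Un image_image)
  interpret A': insertion d' T b ?D by (rule ins)
  have opp: "opp (remove_marker w A.I) x = opp A'.I x" if x: "x \<in> darts A'.I" for x
  proof -
    have L: "opp (remove_marker w A.I) x = (if x = opp A.I w' then opp A.I w
        else if x = opp A.I w then opp A.I w' else opp A.I x)"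
      by (simp add: remove_marker_simps ri)
    have x: "x \<noteq> w" "x \<noteq> w'" "x \<in> darts T \<Longrightarrow> x \<noteq> a \<and> x \<noteq> a'"
      using x nT by (auto simp: D')
    note n = m(3,7-11) m(3,7-11)[symmetric] x
      A.neq[OF m(1) A.b] A.neq[OF m(2) A.b] A.neq[OF m(5) A.b] A.neq[OF m(6) A.b] A.neq[OF A.d A.b]
      A.neq[OF m(1) A.bcf(1)] A.neq[OF m(2) A.bcf(1)] A.neq[OF m(5) A.bcf(1)] A.neq[OF m(6) A.bcf(1)]
      A.neq[OF A.d A.bcf(1)] A.bcf(2) A.bcf(2)[symmetric]
    note X = A.opp_I_if[of x]
    \<comment> \<open>The tangle lies on one of the two edges at the marker, inserted from either
      end, or on an edge away from it.\<close>
    consider "d = w" | "d = w'" | "d = a" | "d = a'" | "d \<notin> {w, w', a, a'}" "opp D d \<notin> {w, w', a, a'}"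
      using d_cases by blast
    then show ?thesis
    proof cases
      case 1
      have e: "opp D d = a" "d' = a'" "opp ?D d' = a" using 1 o n by (simp_all add: d' D')
      have o': "opp A.I w = opp T b" "opp A.I w' = a'" unfolding A.opp_I_if e using 1 n o nT by simp_all
      show ?thesis unfolding L o' X A'.opp_I_if unfolding e using 1 n by (simp add: D')
    next
      case 2
      have e: "opp D d = a'" "d' = a" "opp ?D d' = a'" using 2 o n by (simp_all add: d' D')
      have o': "opp A.I w = a" "opp A.I w' = opp T b" unfolding A.opp_I_if e using 2 n o nT by simp_all
      show ?thesis unfolding L o' X A'.opp_I_if unfolding e using 2 n by (simp add: D')
    next
      case 3
      have e: "opp D d = w" "d' = a" "opp ?D d' = a'" using 3 o n by (simp_all add: d' D')
      have o': "opp A.I w = b" "opp A.I w' = a'" unfolding A.opp_I_if e using 3 n o nT by simp_all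
      show ?thesis unfolding L o' X A'.opp_I_if unfolding e using 3 n by (simp add: D')
    next
      case 4
      have e: "opp D d = w'" "d' = a'" "opp ?D d' = a" using 4 o n by (simp_all add: d' D')
      have o': "opp A.I w = a" "opp A.I w' = b" unfolding A.opp_I_if e using 4 n o nT by simp_all
      show ?thesis unfolding L o' X A'.opp_I_if unfolding e using 4 n by (simp add: D')
    next
      case 5
      have e: "d' = d" "opp ?D d' = opp D d" using 5 o n by (simp_all add: d' D')
      have n': "w \<noteq> d" "w' \<noteq> d" "a \<noteq> d" "a' \<noteq> d" "w \<noteq> opp D d" "w' \<noteq> opp D d" "a \<noteq> opp D d" "a' \<noteq> opp D d"
        using 5 by auto
      have o': "opp A.I w = a" "opp A.I w' = a'" unfolding A.opp_I_if using n n' o nT by simp_all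
      show ?thesis unfolding L o' X A'.opp_I_if unfolding e using n n' by (simp add: D')
    qed
  qed
  have darts: "darts (remove_marker w A.I) = darts A'.I"
    by (simp add: remove_marker_simps ri D' w'_def[symmetric] Un_Diff nT)
  have "rot (remove_marker w A.I) x = rot A'.I x" for x
    by (simp add: remove_marker_simps ins_def)
  moreover have "over (remove_marker w A.I) = over A'.I" by (simp add: remove_marker_simps)
  ultimately show "remove_marker w A.I \<approx> A'.I"
    unfolding deqv_def darts using opp regs by blast
qed

section \<open>Compatibility of insertion with relabelling\<close>

lemma diagram_iso_marker:
  assumes "diagram_iso f D E" "local_diagram D" "local_diagram E" "x \<in> darts D"
  shows "marker E (f x) \<longleftrightarrow> marker D x"
proof -
  have inj: "f y = f z \<longleftrightarrow> y = z" if "y \<in> darts D" "z \<in> darts D" for y z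
    using assms(1) that by (auto simp: diagram_iso_def bij_betw_def inj_on_def)
  have r: "rot E (f y) = f (rot D y)" "f y \<in> darts E" if "y \<in> darts D" for y
    using assms(1) that by (auto simp: diagram_iso_def bij_betw_def)
  note d = assms(4) rot_darts[OF assms(2,4)] rot_darts[OF assms(2) rot_darts[OF assms(2,4)]]
  show ?thesis using d by (simp add: marker_def r inj)
qed

lemma diagram_iso_reg:
  assumes "diagram_iso f D E" "local_diagram D" "local_diagram E" "x \<in> darts D"
  shows "reg E (f x) = f ` reg D x"
  using reg_regions[OF assms(2,4)] reg_self[OF assms(2,4)] assms(1)
  by (intro reg_eq[OF assms(3)]) (auto simp: diagram_iso_def)

lemma ins_iso:
  assumes f: "diagram_iso f D E" and g: "diagram_iso g T T'"
    and "insertion d T b D" "insertion (f d) T' (g b) E"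
  shows "diagram_iso (\<lambda>x. if x \<in> darts T then g x else f x) (ins d T b D) (ins (f d) T' (g b) E)"
proof -
  interpret A: insertion d T b D by fact
  interpret B: insertion "f d" T' "g b" E by fact
  define h where "h x = (if x \<in> darts T then g x else f x)" for x
  have hD: "h x = f x" if "x \<in> darts D" for x using that A.notin by (simp add: h_def)
  have hT: "h x = g x" if "x \<in> darts T" for x using that by (simp add: h_def)
  have F: "f ` darts D = darts E" "inj_on f (darts D)" "f ` over D = over E" "(`) f ` regions D = regions E"
    "x \<in> darts D \<Longrightarrow> f (rot D x) = rot E (f x)" "x \<in> darts D \<Longrightarrow> f (opp D x) = opp E (f x)" for x
    using f by (simp_all add: diagram_iso_def bij_betw_def)
  have G: "g ` darts T = darts T'" "inj_on g (darts T)" "g ` over T = over T'" "(`) g ` regions T = regions T'"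
    "x \<in> darts T \<Longrightarrow> g (rot T x) = rot T' (g x)" "x \<in> darts T \<Longrightarrow> g (opp T x) = opp T' (g x)" for x
    using g by (simp_all add: diagram_iso_def bij_betw_def)
  have FE: "f x \<in> darts E" if "x \<in> darts D" for x using F(1) that by blast
  have GE: "g x \<in> darts T'" if "x \<in> darts T" for x using G(1) that by blast
  have fi: "f x = f y \<longleftrightarrow> x = y" if "x \<in> darts D" "y \<in> darts D" for x y
    using F(2) that by (meson inj_onD)
  have gi: "g x = g y \<longleftrightarrow> x = y" if "x \<in> darts T" "y \<in> darts T" for x y
    using G(2) that by (meson inj_onD)
  have img: "h ` X = f ` X" if "X \<subseteq> darts D" for X using hD that by (intro image_cong) auto
  have img': "h ` X = g ` X" if "X \<subseteq> darts T" for X using hT that by (intro image_cong) auto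
  have "h ` darts A.I = darts B.I"
    by (simp add: image_Un img img' F(1) G(1))
  moreover have "inj_on h (darts A.I)"
  proof (rule inj_onI)
    fix x y assume "x \<in> darts A.I" "y \<in> darts A.I" "h x = h y"
    moreover have "f u \<noteq> g v" "g v \<noteq> f u" if "u \<in> darts D" "v \<in> darts T" for u v
      using FE GE that B.neq by metis+
    ultimately show "x = y" using fi gi hD hT by (auto simp: hD hT)
  qed
  moreover have "h (rot A.I x) = rot B.I (h x)" if "x \<in> darts A.I" for x
    using that rot_darts[OF A.D] rot_darts[OF A.T] FE GE by (auto simp: hD hT F G)
  moreover have "h (opp A.I x) = opp B.I (h x)" if "x \<in> darts A.I" for x
  proof -
    have o: "f (opp D d) = opp E (f d)" "g (opp T b) = opp T' (g b)" using A.d A.b F G by simp_all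
    have xc: "P" if "x \<in> darts A.I" "x = d \<Longrightarrow> P" "x = opp D d \<Longrightarrow> P" "x = b \<Longrightarrow> P" "x = opp T b \<Longrightarrow> P"
      "x \<in> darts D \<Longrightarrow> x \<noteq> d \<Longrightarrow> x \<noteq> opp D d \<Longrightarrow> P"
      "x \<in> darts T \<Longrightarrow> x \<noteq> b \<Longrightarrow> x \<noteq> opp T b \<Longrightarrow> P" for P
      using that by auto
    show ?thesis using that
    proof (rule xc)
      assume x: "x \<in> darts D" "x \<noteq> d" "x \<noteq> opp D d"
      then have "f x \<noteq> f d" "f x \<noteq> opp E (f d)" "opp D x \<in> darts D"
        using fi A.d A.e(1) o opp_darts[OF A.D] by metis+
      then show ?thesis using x FE by (simp add: hD F)
    next
      assume x: "x \<in> darts T" "x \<noteq> b" "x \<noteq> opp T b"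
      then have "g x \<noteq> g b" "g x \<noteq> opp T' (g b)" "opp T x \<in> darts T"
        using gi A.b A.bcf(1) o opp_darts[OF A.T] by metis+
      then show ?thesis using x GE by (simp add: hT G)
    qed (use A.d A.e A.b A.bcf o in \<open>simp_all add: hD hT\<close>)
  qed
  moreover have "h ` over A.I = over B.I"
    using over_subset[OF A.D] over_subset[OF A.T] by (simp add: image_Un img img' F(3) G(3))
  moreover have "(`) h ` regions A.I = regions B.I"
  proof -
    have rg: "reg T' (g b) = g ` reg T b" "reg T' (rot T' (g b)) = g ` reg T (rot T b)"
      using diagram_iso_reg[OF g A.T B.T A.b] diagram_iso_reg[OF g A.T B.T A.bcf(4)] G(5)[OF A.b] by simp_all
    have "h ` attach d T b D r = attach (f d) T' (g b) E (f ` r)" if r: "r \<in> regions D" for r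
    proof -
      have s: "r \<subseteq> darts D" by (rule region_subset[OF A.D r])
      have "f d \<in> f ` r \<longleftrightarrow> d \<in> r" "opp E (f d) \<in> f ` r \<longleftrightarrow> opp D d \<in> r"
        using s A.d A.e(1) fi F(6)[OF A.d] by (auto simp: image_iff) (metis subsetD)+
      then show ?thesis
        using A.reg_sub by (simp add: attach_def image_Un img[OF s] img' rg)
    qed
    then have "(`) h ` attach d T b D ` regions D = attach (f d) T' (g b) E ` regions E"
      by (simp add: image_image F(4)[symmetric])
    moreover have "(`) h ` (regions T - {reg T b, reg T A.c}) =
        regions T' - {reg T' (g b), reg T' (rot T' (g b))}"
    proof -
      have "inj_on ((`) g) (regions T)"
        using region_subset[OF A.T] G(2) by (intro inj_onI) (meson inj_on_image_eq_iff)
      then have "(`) g ` (regions T - {reg T b, reg T A.c}) =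
          regions T' - {reg T' (g b), reg T' (rot T' (g b))}"
        using A.reg_b(1) A.reg_c(1) by (simp add: inj_on_image_set_diff[where C = "regions T"] G(4) rg)
      moreover have "(`) h ` (regions T - {reg T b, reg T A.c}) = (`) g ` (regions T - {reg T b, reg T A.c})"
        by (intro image_cong[OF refl] img' region_subset[OF A.T]) simp
      ultimately show ?thesis by simp
    qed
    ultimately show ?thesis by (simp add: image_Un)
  qed
  ultimately have "diagram_iso h A.I B.I"
    unfolding diagram_iso_def bij_betw_def by blast
  then show ?thesis by (simp add: h_def[abs_def])
qed

section \<open>Kinks as insertions\<close>

text \<open>The darts of the model tangles are labelled by numerals added to a base; simplification
  should leave these labels in that form.\<close>

declare One_nat_def [simp del] add_2_eq_Suc' [simp del]

text \<open>Three tangles with the distinguished marker \<open>{n, n + 1}\<close>: the trivial one, the trivial one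
  with one further marker \<open>{n + 2, n + 3}\<close>, and the latter with that marker replaced by a kink.
  Its loop is \<open>{n + 4, n + 5}\<close>, and \<open>p\<close> says whether the dart \<open>n + 4\<close> lies on the overcrossing strand.\<close>

definition straight :: "nat \<Rightarrow> diagram" where
  "straight n = \<lparr> darts = {n, n + 1}, rot = transpose n (n + 1), opp = transpose n (n + 1),
     over = {}, regions = {{n}, {n + 1}} \<rparr>"

definition marked :: "nat \<Rightarrow> diagram" where
  "marked n = \<lparr> darts = {n, n + 1, n + 2, n + 3},
     rot = transpose n (n + 1) \<circ> transpose (n + 2) (n + 3),
     opp = transpose n (n + 2) \<circ> transpose (n + 1) (n + 3),
     over = {}, regions = {{n, n + 3}, {n + 1, n + 2}} \<rparr>"

definition kinked :: "bool \<Rightarrow> nat \<Rightarrow> diagram" where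
  "kinked p n = \<lparr> darts = {n, n + 1, n + 2, n + 3, n + 4, n + 5},
     rot = id(n := n + 1, n + 1 := n, n + 5 := n + 4, n + 4 := n + 2, n + 2 := n + 3, n + 3 := n + 5),
     opp = transpose n (n + 2) \<circ> transpose (n + 1) (n + 3) \<circ> transpose (n + 4) (n + 5),
     over = (if p then {n + 4, n + 3} else {n + 5, n + 2}),
     regions = {{n, n + 3}, {n + 1, n + 2, n + 5}, {n + 4}} \<rparr>"

section \<open>Computations in the three model tangles\<close>

lemma straight_simps [simp]:
  "darts (straight n) = {n, n + 1}" "over (straight n) = {}" "regions (straight n) = {{n}, {n + 1}}"
  "rot (straight n) n = n + 1" "rot (straight n) (n + 1) = n"
  "opp (straight n) n = n + 1" "opp (straight n) (n + 1) = n"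
  by (simp_all add: straight_def)

lemma marked_simps [simp]:
  "darts (marked n) = {n, n + 1, n + 2, n + 3}" "over (marked n) = {}"
  "regions (marked n) = {{n, n + 3}, {n + 1, n + 2}}"
  "rot (marked n) n = n + 1" "rot (marked n) (n + 1) = n"
  "rot (marked n) (n + 2) = n + 3" "rot (marked n) (n + 3) = n + 2"
  "opp (marked n) n = n + 2" "opp (marked n) (n + 2) = n"
  "opp (marked n) (n + 1) = n + 3" "opp (marked n) (n + 3) = n + 1"
  by (simp_all add: marked_def transpose_def)

lemma kinked_simps [simp]:
  "darts (kinked p n) = {n, n + 1, n + 2, n + 3, n + 4, n + 5}"
  "over (kinked p n) = (if p then {n + 4, n + 3} else {n + 5, n + 2})"
  "regions (kinked p n) = {{n, n + 3}, {n + 1, n + 2, n + 5}, {n + 4}}"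
  "rot (kinked p n) n = n + 1" "rot (kinked p n) (n + 1) = n"
  "rot (kinked p n) (n + 2) = n + 3" "rot (kinked p n) (n + 3) = n + 5"
  "rot (kinked p n) (n + 4) = n + 2" "rot (kinked p n) (n + 5) = n + 4"
  "opp (kinked p n) n = n + 2" "opp (kinked p n) (n + 2) = n"
  "opp (kinked p n) (n + 1) = n + 3" "opp (kinked p n) (n + 3) = n + 1"
  "opp (kinked p n) (n + 4) = n + 5" "opp (kinked p n) (n + 5) = n + 4"
  by (simp_all add: kinked_def transpose_def)

lemma local_straight: "local_diagram (straight n)"
proof (rule local_diagramI)
  show "partition_on (darts (straight n)) (regions (straight n))"
    by (rule partition_onI) (auto simp: disjnt_def)
qed (auto simp: marker_def crossing_def face_def straight_simps)

lemma local_marked: "local_diagram (marked n)"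
proof (rule local_diagramI)
  show "partition_on (darts (marked n)) (regions (marked n))"
    by (rule partition_onI) (auto simp: disjnt_def)
qed (auto simp: marker_def crossing_def face_def marked_simps)

lemma local_kinked: "local_diagram (kinked p n)"
proof (rule local_diagramI)
  show "partition_on (darts (kinked p n)) (regions (kinked p n))"
    by (rule partition_onI) (auto simp: disjnt_def)
qed (auto simp: marker_def crossing_def face_def kinked_simps split: if_splits)

lemma reg_straight [simp]: "reg (straight n) n = {n}" "reg (straight n) (n + 1) = {n + 1}"
  by (rule reg_eq[OF local_straight]; simp)+

lemma reg_marked [simp]:
  "reg (marked n) n = {n, n + 3}" "reg (marked n) (n + 1) = {n + 1, n + 2}"
  by (rule reg_eq[OF local_marked]; simp)+

lemma reg_kinked [simp]:
  "reg (kinked p n) n = {n, n + 3}" "reg (kinked p n) (n + 1) = {n + 1, n + 2, n + 5}"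
  by (rule reg_eq[OF local_kinked]; simp)+

lemma tangle_straight: "tangle (straight n) n"
  using local_straight by (simp add: tangle_def marker_def)

lemma tangle_marked: "tangle (marked n) n"
  using local_marked by (simp add: tangle_def marker_def)

lemma tangle_kinked: "tangle (kinked p n) n"
  using local_kinked by (simp add: tangle_def marker_def)

text \<open>A block of six labels, as many as \<open>kinked\<close> occupies; the same block
  accommodates the two smaller tangles.\<close>

definition fresh :: "nat \<Rightarrow> diagram \<Rightarrow> bool" where
  "fresh n D \<longleftrightarrow> (\<forall>x\<in>darts D. x < n \<or> n + 5 < x)"

text \<open>All later bases are fresh too, so that several tangles can be placed at once, in blocks
  starting at \<open>n\<close>, \<open>n + 6\<close> and \<open>n + 12\<close>.\<close>

lemma ex_fresh:
  assumes "local_diagram D"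
  shows "\<exists>n. \<forall>k. fresh (n + k) D"
proof -
  have "\<forall>x\<in>darts D. x < Suc (Max (darts D))"
    using finite_darts[OF assms] by (simp add: less_Suc_eq_le)
  then have "\<forall>k. fresh (Suc (Max (darts D)) + k) D" by (auto simp: fresh_def)
  then show ?thesis by blast
qed

lemma
  assumes "local_diagram D" "d \<in> darts D" "fresh n D"
  shows insertion_straight: "insertion d (straight n) n D"
    and insertion_marked: "insertion d (marked n) n D"
    and insertion_kinked: "insertion d (kinked p n) n D"
proof -
  have "n \<notin> darts D" "n + 1 \<notin> darts D" "n + 2 \<notin> darts D" "n + 3 \<notin> darts D" "n + 4 \<notin> darts D" "n + 5 \<notin> darts D"
    using assms(3) by (auto simp: fresh_def)
  then show "insertion d (straight n) n D" "insertion d (marked n) n D" "insertion d (kinked p n) n D"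
    using assms(1,2) tangle_straight tangle_marked tangle_kinked by (auto simp: insertion_def)
qed

text \<open>The trivial tangle contributes nothing but its distinguished marker. This is the bottom
  of a chain: a second marker turns \<open>straight\<close> into \<open>marked\<close>, and a kink
  in its place turns that into \<open>kinked\<close>.\<close>

lemma remove_straight:
  assumes "local_diagram D" "d \<in> darts D" "fresh n D"
  shows "remove_marker n (ins d (straight n) n D) \<approx> D"
    and "removable_marker (ins d (straight n) n D) n"
proof -
  interpret insertion d "straight n" n D using insertion_straight[OF assms] .
  have n: "n \<notin> darts D" "n + 1 \<notin> darts D" using assms(3) by (auto simp: fresh_def)
  have ne: "d \<noteq> n" "d \<noteq> n + 1" "e \<noteq> n" "e \<noteq> n + 1" using n d e by metis+
  have rn: "rot I n = n + 1" using rot_I(2)[OF b] by (simp)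
  have on: "opp I n = e" "opp I (n + 1) = d" using opp_I(3,4) by (simp_all)
  show "removable_marker I n"
    using marker_I(2)[OF b] marker_b ne by (simp add: removable_marker_def rn on)
  have "(attach d (straight n) n D r - {n, n + 1}) = r" if "r \<in> regions D" for r
  proof -
    have "n \<notin> r" "n + 1 \<notin> r" using region_subset[OF D that] n by auto
    then show ?thesis by (auto simp: attach_def)
  qed
  then have "regions (remove_marker n I) = regions D"
    by (simp add: remove_marker_simps rn image_Un image_image)
  moreover have "opp (remove_marker n I) x = opp D x" if x: "x \<in> darts D" for x
  proof (cases "x = d \<or> x = e")
    case True
    then show ?thesis using e by (auto simp: remove_marker_simps rn on)
  next
    case False
    then show ?thesis using opp_I(5)[OF x] by (simp add: remove_marker_simps rn on)
  qed
  moreover have "darts (remove_marker n I) = darts D"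
    using n by (simp add: remove_marker_simps rn)
  ultimately show "remove_marker n I \<approx> D"
    by (simp add: deqv_def remove_marker_simps)
qed

lemma remove_marked:
  assumes "local_diagram D" "d \<in> darts D" "fresh n D"
  shows "remove_marker (n + 2) (ins d (marked n) n D) \<approx> ins d (straight n) n D"
    and "removable_marker (ins d (marked n) n D) (n + 2)"
proof -
  interpret A: insertion d "marked n" n D using insertion_marked[OF assms] .
  interpret B: insertion d "straight n" n D using insertion_straight[OF assms] .
  have n: "n \<notin> darts D" "n + 1 \<notin> darts D" "n + 2 \<notin> darts D" "n + 3 \<notin> darts D"
    using assms(3) by (auto simp: fresh_def)
  have m: "n + 1 \<in> darts (marked n)" "n + 2 \<in> darts (marked n)" "n + 3 \<in> darts (marked n)" by simp_all
  have rn: "rot A.I (n + 2) = n + 3" "rot A.I (n + 3) = n + 2"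
    using A.rot_I(2)[OF m(2)] A.rot_I(2)[OF m(3)] by (simp_all)
  have on: "opp A.I (n + 2) = d" "opp A.I (n + 3) = n + 1"
    using A.opp_I(3) A.opp_I(6)[OF m(3)] by (simp_all)
  have ne: "d \<noteq> n" "d \<noteq> n + 1" "d \<noteq> n + 2" "d \<noteq> n + 3" "A.e \<noteq> n" "A.e \<noteq> n + 1" "A.e \<noteq> n + 2" "A.e \<noteq> n + 3"
    using n A.d A.e by metis+
  show "removable_marker A.I (n + 2)"
    using A.marker_I(2)[OF m(2)] ne
    by (simp add: removable_marker_def rn on marker_def)
  have att: "attach d (marked n) n D r - {n + 2, n + 3} = attach d (straight n) n D r" if "r \<in> regions D" for r
  proof -
    have "n + 2 \<notin> r" "n + 3 \<notin> r" using region_subset[OF A.D that] n by auto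
    then show ?thesis by (auto simp: attach_def)
  qed
  then have "regions (remove_marker (n + 2) A.I) = regions B.I"
    by (simp add: remove_marker_simps rn image_image)
  moreover have "darts (remove_marker (n + 2) A.I) = darts B.I"
    using n by (simp add: remove_marker_simps rn) auto
  moreover have "opp (remove_marker (n + 2) A.I) x = opp B.I x"
    "rot (remove_marker (n + 2) A.I) x = rot B.I x" if x: "x \<in> darts B.I" for x
  proof -
    consider "x = d" | "x = A.e" | "x = n" | "x = n + 1" | "x \<in> darts D" "x \<noteq> d" "x \<noteq> A.e" "x \<noteq> n + 1"
      using x n(2) by auto
    then show "opp (remove_marker (n + 2) A.I) x = opp B.I x"
      by cases (use A.opp_I B.opp_I ne A.e n(2) in \<open>simp_all add: remove_marker_simps rn on\<close>)
    show "rot (remove_marker (n + 2) A.I) x = rot B.I x"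
      using x A.rot_I B.rot_I m by (auto simp: remove_marker_simps)
  qed
  ultimately show "remove_marker (n + 2) A.I \<approx> B.I"
    unfolding deqv_def by (simp add: remove_marker_simps del: ins_simps(1))
qed

text \<open>The removal of a kink always leaves a marker on the arc; this is the reason for the
  extra marker in \<open>marked\<close>.\<close>

lemma remove_kinked:
  assumes "local_diagram D" "d \<in> darts D" "fresh n D"
  shows "remove_kink (n + 4) (ins d (kinked p n) n D) \<approx> ins d (marked n) n D"
    and "kink (ins d (kinked p n) n D) (n + 4)"
proof -
  interpret A: insertion d "kinked p n" n D using insertion_kinked[OF assms] .
  interpret B: insertion d "marked n" n D using insertion_marked[OF assms] .
  have n: "n + 4 \<notin> darts D" "n + 5 \<notin> darts D" "n + 2 \<notin> darts D" "n + 3 \<notin> darts D"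
    using assms(3) by (auto simp: fresh_def)
  have m: "n + 1 \<in> darts (kinked p n)" "n + 2 \<in> darts (kinked p n)" "n + 3 \<in> darts (kinked p n)"
    "n + 4 \<in> darts (kinked p n)" "n + 5 \<in> darts (kinked p n)" by simp_all
  have rn: "rot A.I n = n + 1" "rot A.I (n + 1) = n" "rot A.I (n + 2) = n + 3" "rot A.I (n + 3) = n + 5"
    "rot A.I (n + 4) = n + 2" "rot A.I (n + 5) = n + 4"
    using A.rot_I(2)[OF A.b] m[THEN A.rot_I(2)] by (simp_all)
  have on: "opp A.I (n + 4) = n + 5" "opp A.I (n + 1) = n + 3" "opp A.I (n + 3) = n + 1"
    using A.opp_I(6)[OF m(4)] A.opp_I(6)[OF m(1)] A.opp_I(6)[OF m(3)] by (simp_all)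
  have "crossing A.I (n + 4)" using m by (simp add: crossing_def rn)
  moreover have "{n + 4} \<in> regions A.I" by (auto)
  ultimately show "kink A.I (n + 4)" by (simp add: kink_def)
  have "attach d (kinked p n) n D r - {n + 4, n + 5} = attach d (marked n) n D r" if "r \<in> regions D" for r
  proof -
    have "n + 4 \<notin> r" "n + 5 \<notin> r" using region_subset[OF A.D that] n by auto
    then show ?thesis by (auto simp: attach_def)
  qed
  moreover have "regions A.I - {{n + 4}} = attach d (kinked p n) n D ` regions D"
  proof -
    have "attach d (kinked p n) n D r \<noteq> {n + 4}" if r: "r \<in> regions D" for r
      using region_nonempty[OF A.D r] region_subset[OF A.D r] n by (auto simp: attach_def)
    moreover have "regions (kinked p n) - {reg (kinked p n) n, reg (kinked p n) (rot (kinked p n) n)} = {{n + 4}}"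
      by auto
    ultimately show ?thesis unfolding ins_simps(3) by blast
  qed
  moreover have "regions (marked n) - {reg (marked n) n, reg (marked n) (rot (marked n) n)} = {}"
    by auto
  ultimately have "regions (remove_kink (n + 4) A.I) = regions B.I"
    unfolding remove_kink_simps on ins_simps(3) by (simp add: image_image)
  moreover have "darts (remove_kink (n + 4) A.I) = darts B.I"
    using n by (simp add: remove_kink_simps on) auto
  moreover have "over (remove_kink (n + 4) A.I) = over B.I"
    using n over_subset[OF A.D] by (auto simp: remove_kink_simps on rn)
  moreover have "opp (remove_kink (n + 4) A.I) x = opp B.I x"
    "rot (remove_kink (n + 4) A.I) x = rot B.I x" if x: "x \<in> darts B.I" for x
  proof -
    consider "x = d" | "x = A.e" | "x = n" | "x = n + 1" | "x = n + 2" | "x = n + 3"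
      | "x \<in> darts D" "x \<noteq> d" "x \<noteq> A.e" using x by auto
    then show "opp (remove_kink (n + 4) A.I) x = opp B.I x"
      by cases (use A.opp_I(1-5) B.opp_I B.opp_I(6)[of "n + 1"] B.opp_I(6)[of "n + 3"] in
        \<open>simp_all add: remove_kink_simps on\<close>)
    consider "x \<in> darts D" | "x = n" | "x = n + 1" | "x = n + 2" | "x = n + 3" using x by auto
    then show "rot (remove_kink (n + 4) A.I) x = rot B.I x"
    proof cases
      case 1
      then have "x \<noteq> n + 2" "x \<noteq> n + 3" using n by auto
      then show ?thesis using 1 by (simp add: remove_kink_simps rn)
    qed (use B.rot_I(2) in \<open>simp_all add: remove_kink_simps rn\<close>)
  qed
  ultimately show "remove_kink (n + 4) A.I \<approx> B.I"
    unfolding deqv_def by simp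
qed

text \<open>Sphericity climbs the chain: removing a marker, a marker and the kink, respectively,
  leads each of the three diagrams back to the one before it, starting from
  \<open>D\<close>.\<close>

lemma
  assumes "link_diagram D" "d \<in> darts D" "fresh n D"
  shows link_straight: "link_diagram (ins d (straight n) n D)"
    and link_marked: "link_diagram (ins d (marked n) n D)"
    and link_kinked: "link_diagram (ins d (kinked p n) n D)"
proof -
  have D: "local_diagram D" using assms(1) by (simp add: link_diagram_iff)
  note a = D assms(2,3)
  show s: "link_diagram (ins d (straight n) n D)"
    using link_of_remove_marker insertion.local_I[OF insertion_straight[OF a]] remove_straight[OF a]
      assms(1) by blast
  show m: "link_diagram (ins d (marked n) n D)"
    using link_of_remove_marker insertion.local_I[OF insertion_marked[OF a]] remove_marked[OF a] s by blast
  show "link_diagram (ins d (kinked p n) n D)"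
    using link_of_remove_kink insertion.local_I[OF insertion_kinked[OF a]] remove_kinked[OF a] m by blast
qed

lemma
  assumes "link_diagram D" "d \<in> darts D" "fresh n D"
  shows isotopic_straight: "isotopic (ins d (straight n) n D) D"
    and isotopic_marked: "isotopic (ins d (marked n) n D) D"
proof -
  have D: "local_diagram D" using assms(1) by (simp add: link_diagram_iff)
  note a = D assms(2,3)
  show s: "isotopic (ins d (straight n) n D) D"
    using isotopic_remove_marker link_straight[OF assms] remove_straight[OF a] assms(1) by blast
  have "isotopic (ins d (marked n) n D) (ins d (straight n) n D)"
    using isotopic_remove_marker link_marked[OF assms] remove_marked[OF a] link_straight[OF assms] by blast
  then show "isotopic (ins d (marked n) n D) D" using s by (rule isotopic_trans)
qed

text \<open>Two markers behind the kink make up for the marker left by its removal and for the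
  distinguished marker of the inserted tangle.\<close>

lemma kink_isotopic_ins:
  assumes D: "link_diagram D" and x: "kink D x" and D': "link_diagram (remove_kink x D)"
    and n: "fresh n D"
  defines "a \<equiv> opp D (rot D x)"
  shows "a \<in> darts (remove_kink x D)"
    and "isotopic D (ins a (kinked (x \<in> over D) n) n (remove_kink x D))"
proof -
  let ?D = "remove_kink x D"
  define y where "y = opp D x"
  define u where "u = rot D x"
  define v where "v = rot D u"
  define b' where "b' = opp D v"
  define p where "p \<longleftrightarrow> x \<in> over D"
  have LD: "local_diagram D" "local_diagram ?D" using D D' by (simp_all add: link_diagram_iff)
  note k = kink_darts[OF LD(1) x, folded y_def u_def v_def, folded v_def]
  have ua: "opp D u = a" by (simp add: a_def u_def)
  have xd: "crossing D x" using x by (simp add: kink_def)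
  have dist: "x \<noteq> y" "y \<noteq> x" "u \<noteq> v" "v \<noteq> u" "x \<noteq> u" "u \<noteq> x" "x \<noteq> v" "v \<noteq> x" "y \<noteq> u" "u \<noteq> y" "y \<noteq> v" "v \<noteq> y"
    using k(5) by auto
  have rots: "rot D x = u" "rot D u = v" "rot D v = y" "rot D y = x"
    using k by (simp_all add: u_def v_def)
  have opps: "opp D x = y" "opp D y = x" "opp D u = a" "opp D v = b'" "opp D a = u" "opp D b' = v"
    "a \<in> darts D" "b' \<in> darts D" "a \<noteq> u" "b' \<noteq> v"
    using k opp_opp[OF LD(1)] opp_darts[OF LD(1)] opp_neq[OF LD(1)]
    by (simp_all add: y_def ua[symmetric] b'_def)
  have ab: "a \<noteq> x" "a \<noteq> y" "b' \<noteq> x" "b' \<noteq> y" "a \<noteq> b'" "a = v \<longleftrightarrow> b' = u"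
    using opps k dist by metis+
  have S: "darts ?D = darts D - {x, y}" "rot ?D = (rot D)(u := v, v := u)" "opp ?D = opp D"
    "over ?D = over D - {x, y, u, v}" "regions ?D = (\<lambda>r. r - {x, y}) ` (regions D - {{x}})"
    by (simp_all add: remove_kink_simps y_def u_def v_def)
  show aD: "a \<in> darts ?D" using opps ab by (simp add: S)
  have n': "fresh n ?D" using n by (auto simp: fresh_def S)
  interpret A: insertion v "marked n" n D by (rule insertion_marked[OF LD(1) k(4) n])
  interpret B: insertion a "kinked p n" n ?D by (rule insertion_kinked[OF LD(2) aD n'])
  have nn: "n \<notin> darts D" "n + 1 \<notin> darts D" "n + 2 \<notin> darts D" "n + 3 \<notin> darts D" "n + 4 \<notin> darts D" "n + 5 \<notin> darts D"
    using n by (auto simp: fresh_def)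
  have ne: "z \<noteq> n" "z \<noteq> n + 1" "z \<noteq> n + 2" "z \<noteq> n + 3" "z \<noteq> n + 4" "z \<noteq> n + 5"
    "n \<noteq> z" "n + 1 \<noteq> z" "n + 2 \<noteq> z" "n + 3 \<noteq> z" "n + 4 \<noteq> z" "n + 5 \<noteq> z" if "z \<in> darts D" for z
    using nn that by metis+
  note ne4 = ne[OF k(1)] ne[OF k(2)] ne[OF k(3)] ne[OF k(4)]
  \<comment> \<open>The crossing \<open>u\<close>, \<open>v\<close>, \<open>x\<close>,
    \<open>y\<close> becomes the crossing of the tangle. Of the two markers added behind it,
    \<open>{n + 2, n + 3}\<close> becomes the distinguished marker, and \<open>{n, n + 1}\<close>
    becomes the marker \<open>{u, v}\<close> that \<open>remove_kink\<close> leaves. The map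
    \<open>g\<close> is the inverse.\<close>
  define f where "f = id(u := n + 2, v := n + 3, x := n + 4, y := n + 5,
    n + 2 := n + 1, n + 3 := n, n + 1 := u, n := v)"
  define g where "g = id(n + 2 := u, n + 3 := v, n + 4 := x, n + 5 := y,
    n + 1 := n + 2, n := n + 3, u := n + 1, v := n)"
  have f: "f u = n + 2" "f v = n + 3" "f x = n + 4" "f y = n + 5" "f (n + 2) = n + 1" "f (n + 3) = n"
    "f (n + 1) = u" "f n = v"
    using ne4 dist by (simp_all add: f_def)
  have f': "f z = z" if "z \<in> darts D" "z \<noteq> u" "z \<noteq> v" "z \<noteq> x" "z \<noteq> y" for z
    using ne[OF that(1)] that(2-) by (simp add: f_def)
  have f_image: "f ` X = X" if "X \<subseteq> darts D - {x, y, u, v}" for X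
  proof -
    have "f ` X = id ` X" by (rule image_cong) (use that f' in auto)
    then show ?thesis by simp
  qed
  have g: "g (n + 2) = u" "g (n + 3) = v" "g (n + 4) = x" "g (n + 5) = y" "g (n + 1) = n + 2" "g n = n + 3"
    "g u = n + 1" "g v = n"
    using ne4 dist by (simp_all add: g_def)
  have g': "g z = z" if "z \<in> darts D" "z \<noteq> u" "z \<noteq> v" for z
    using ne[OF that(1)] that(2-) by (simp add: g_def)
  have cA: "P" if "z \<in> darts A.I" "z = u \<Longrightarrow> P" "z = v \<Longrightarrow> P" "z = x \<Longrightarrow> P" "z = y \<Longrightarrow> P"
    "z = n \<Longrightarrow> P" "z = n + 1 \<Longrightarrow> P" "z = n + 2 \<Longrightarrow> P" "z = n + 3 \<Longrightarrow> P"
    "z \<in> darts D \<Longrightarrow> z \<noteq> u \<Longrightarrow> z \<noteq> v \<Longrightarrow> z \<noteq> x \<Longrightarrow> z \<noteq> y \<Longrightarrow> P" for z P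
    using that by auto
  have cB: "P" if "z \<in> darts B.I" "z = u \<Longrightarrow> P" "z = v \<Longrightarrow> P" "z = n + 4 \<Longrightarrow> P" "z = n + 5 \<Longrightarrow> P"
    "z = n \<Longrightarrow> P" "z = n + 1 \<Longrightarrow> P" "z = n + 2 \<Longrightarrow> P" "z = n + 3 \<Longrightarrow> P"
    "z \<in> darts D \<Longrightarrow> z \<noteq> u \<Longrightarrow> z \<noteq> v \<Longrightarrow> z \<noteq> x \<Longrightarrow> z \<noteq> y \<Longrightarrow> P" for z P
    using that by (auto simp: S)
  have uv: "u \<in> darts ?D" "v \<in> darts ?D" using k dist by (simp_all add: S)

  have "bij_betw f (darts A.I) (darts B.I)"
  proof (rule bij_betw_byWitness[where f' = g])
    show "\<forall>z\<in>darts A.I. g (f z) = z"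
    proof
      fix z assume "z \<in> darts A.I"
      then show "g (f z) = z" by (rule cA) (simp_all add: f f' g g')
    qed
    show "\<forall>z\<in>darts B.I. f (g z) = z"
    proof
      fix z assume "z \<in> darts B.I"
      then show "f (g z) = z" by (rule cB) (simp_all add: f f' g g')
    qed
    show "f ` darts A.I \<subseteq> darts B.I"
    proof
      fix w assume "w \<in> f ` darts A.I"
      then obtain z where z: "z \<in> darts A.I" "w = f z" by blast
      from z(1) show "w \<in> darts B.I" by (rule cA) (use uv in \<open>simp_all add: z(2) f f' S\<close>)
    qed
    show "g ` darts B.I \<subseteq> darts A.I"
    proof
      fix w assume "w \<in> g ` darts B.I"
      then obtain z where z: "z \<in> darts B.I" "w = g z" by blast
      from z(1) show "w \<in> darts A.I" by (rule cB) (use k in \<open>simp_all add: z(2) g g'\<close>)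
    qed
  qed
  moreover have "f (rot A.I z) = rot B.I (f z)" if "z \<in> darts A.I" for z
    using that
  proof (rule cA)
    assume z: "z \<in> darts D" "z \<noteq> u" "z \<noteq> v" "z \<noteq> x" "z \<noteq> y"
    then have "rot D z \<noteq> u" "rot D z \<noteq> v" "rot D z \<noteq> x" "rot D z \<noteq> y"
      using rot_inj[OF LD(1) z(1)] k rots by metis+
    then show ?thesis using z rot_darts[OF LD(1) z(1)] by (simp add: f' S)
  qed (use k uv rots dist ne4 in \<open>simp_all add: f A.rot_I(2) B.rot_I(2) S\<close>)
  moreover have "f (opp A.I z) = opp B.I (f z)" if "z \<in> darts A.I" for z
  proof -
    have oA: "opp A.I v = n + 2" "opp A.I (n + 2) = v" "opp A.I b' = n" "opp A.I n = b'"
      "opp A.I (n + 1) = n + 3" "opp A.I (n + 3) = n + 1"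
      "w \<in> darts D \<Longrightarrow> w \<noteq> v \<Longrightarrow> w \<noteq> b' \<Longrightarrow> opp A.I w = opp D w" for w
      using A.opp_I(1-5) A.opp_I(6)[of "n + 1"] A.opp_I(6)[of "n + 3"] by (simp_all add: opps)
    have oB: "opp B.I a = n + 2" "opp B.I (n + 2) = a" "opp B.I u = n" "opp B.I n = u"
      "opp B.I (n + 1) = n + 3" "opp B.I (n + 3) = n + 1" "opp B.I (n + 4) = n + 5" "opp B.I (n + 5) = n + 4"
      "w \<in> darts D \<Longrightarrow> w \<noteq> x \<Longrightarrow> w \<noteq> y \<Longrightarrow> w \<noteq> a \<Longrightarrow> w \<noteq> u \<Longrightarrow> opp B.I w = opp D w" for w
      using B.opp_I(1-5) B.opp_I(6)[of "n + 1"] B.opp_I(6)[of "n + 3"] B.opp_I(6)[of "n + 4"] B.opp_I(6)[of "n + 5"]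
      by (simp_all add: opps S)
    show ?thesis
    \<comment> \<open>Here the two free ends of the kink are joined to each other: the crossing and
      its two edges form a whole component, and the edge at \<open>v\<close> that receives the
      markers is also the edge at \<open>u\<close>.\<close>
    proof (cases "a = v")
      case True
      then have b: "b' = u" using ab by simp
      have t: "opp B.I v = n + 2" "opp B.I (n + 2) = v" "opp A.I u = n" "opp A.I n = u"
        using oB(1,2) oA(3,4) True b by metis+
      from that show ?thesis
      proof (rule cA)
        assume z: "z \<in> darts D" "z \<noteq> u" "z \<noteq> v" "z \<noteq> x" "z \<noteq> y"
        have "opp D z \<noteq> u" "opp D z \<noteq> v" "opp D z \<noteq> x" "opp D z \<noteq> y"
          using z opp_opp[OF LD(1) z(1)] opps True b by metis+
        moreover have "z \<noteq> a" "z \<noteq> b'" using z True b by simp_all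
        ultimately show ?thesis using z opp_darts[OF LD(1) z(1)] by (simp add: f' oA oB)
      qed (simp_all add: f t oA(1,2,5-7) oB(3-9) k(1-4) dist ab(1-4) ab(3,4)[symmetric] opps(1-6) S(3) b)
    next
      case False
      then have b: "b' \<noteq> u" using ab by simp
      from that show ?thesis
      proof (rule cA)
        assume z: "z \<in> darts D" "z \<noteq> u" "z \<noteq> v" "z \<noteq> x" "z \<noteq> y"
        show ?thesis
        proof (cases "z = a \<or> z = b'")
          case True
          then show ?thesis using z False b ab opps k by (elim disjE) (simp_all add: f f' oA oB)
        next
          case False
          then have "opp D z \<noteq> u" "opp D z \<noteq> v" "opp D z \<noteq> x" "opp D z \<noteq> y"
            using z opp_opp[OF LD(1) z(1)] opps by metis+
          then show ?thesis using z False opp_darts[OF LD(1) z(1)] by (simp add: f' oA oB)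
        qed
      qed (simp_all add: f f' oA oB False b ab(1-5) ab(1-5)[symmetric] k(1-4) dist opps False[symmetric] b[symmetric] S(3))
    qed
  qed
  moreover have "f ` over A.I = over B.I"
  proof -
    have ov: "x \<in> over D \<longleftrightarrow> u \<notin> over D" "u \<in> over D \<longleftrightarrow> v \<notin> over D" "v \<in> over D \<longleftrightarrow> y \<notin> over D"
    proof -
      have c: "crossing D u" "crossing D v" using rots dist k by (simp_all add: crossing_def)
      then show "x \<in> over D \<longleftrightarrow> u \<notin> over D" "u \<in> over D \<longleftrightarrow> v \<notin> over D" "v \<in> over D \<longleftrightarrow> y \<notin> over D"
        using over_crossing[OF LD(1) xd] over_crossing[OF LD(1) c(1)] over_crossing[OF LD(1) c(2)]
        by (simp_all only: rots)
    qed
    have "f ` (over D - {x, y, u, v}) = over D - {x, y, u, v}"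
      using over_subset[OF LD(1)] by (intro f_image) blast
    moreover have "over D = (over D - {x, y, u, v}) \<union> (if p then {x, v} else {y, u})"
    proof (cases p)
      case True
      then have "x \<in> over D" "v \<in> over D" "u \<notin> over D" "y \<notin> over D" using ov by (simp_all add: p_def)
      then show ?thesis using True by auto
    next
      case False
      then have "x \<notin> over D" "v \<notin> over D" "u \<in> over D" "y \<in> over D" using ov by (simp_all add: p_def)
      then show ?thesis using False by auto
    qed
    ultimately have "f ` over D = (over D - {x, y, u, v}) \<union> f ` (if p then {x, v} else {y, u})"
      by (metis image_Un)
    then show ?thesis by (simp add: S f)
  qed
  moreover have "(`) f ` regions A.I = regions B.I"
  proof -
    have reg: "y \<in> r \<longleftrightarrow> u \<in> r" "v \<in> r \<longleftrightarrow> a \<in> r" "b' \<in> r \<longleftrightarrow> u \<in> r" if r: "r \<in> regions D" for r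
      using rot_opp_region[OF LD(1) r k(1)] rot_opp_region[OF LD(1) r k(3)] rot_opp_region[OF LD(1) r k(4)]
      by (simp_all add: rots opps)
    have fx: "f ` attach v (marked n) n D {x} = {n + 4}"
      using ab opps dist by (simp add: attach_def f)
    have fr: "f ` attach v (marked n) n D r = attach a (kinked p n) n ?D (r - {x, y})"
      if r: "r \<in> regions D - {{x}}" for r
    proof -
      have rD: "r \<in> regions D" and xr: "x \<notin> r"
        using r kink_regions[OF LD(1) x] by auto
      have sub: "r \<subseteq> darts D" by (rule region_subset[OF LD(1) rD])
      let ?C = "r - {x, y, u, v}"
      have C: "f ` ?C = ?C"
        using sub by (intro f_image) blast
      have r_eq: "r = ?C \<union> (if u \<in> r then {u, y} else {}) \<union> (if v \<in> r then {v} else {})"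
        using xr reg(1)[OF rD] by auto
      have "f ` r = f ` ?C \<union> f ` (if u \<in> r then {u, y} else {}) \<union> f ` (if v \<in> r then {v} else {})"
        by (subst r_eq) (simp only: image_Un)
      also have "\<dots> = ?C \<union> (if u \<in> r then {n + 2, n + 5} else {}) \<union> (if v \<in> r then {n + 3} else {})"
        unfolding C by (simp add: f)
      finally have fr: "f ` r = \<dots>" .
      have "f ` attach v (marked n) n D r = f ` r \<union> (if v \<in> r then {v, n} else {}) \<union>
          (if u \<in> r then {u, n + 1} else {})"
        using reg[OF rD] by (simp add: attach_def opps image_Un f)
      also have "\<dots> = attach a (kinked p n) n ?D (r - {x, y})"
        unfolding fr attach_def using reg[OF rD] ab dist xr opps by (auto simp: S)
      finally show ?thesis .
    qed
    have xreg: "{x} \<in> regions D" using x by (simp add: kink_def)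
    have mr: "regions (marked n) - {reg (marked n) n, reg (marked n) (rot (marked n) n)} = {}"
      "regions (kinked p n) - {reg (kinked p n) n, reg (kinked p n) (rot (kinked p n) n)} = {{n + 4}}"
      by auto
    have "(`) f ` regions A.I = (\<lambda>r. f ` attach v (marked n) n D r) ` insert {x} (regions D - {{x}})"
      unfolding ins_simps(3) mr using xreg by (simp add: image_image insert_absorb)
    also have "\<dots> = insert {n + 4} ((\<lambda>r. attach a (kinked p n) n ?D (r - {x, y})) ` (regions D - {{x}}))"
      unfolding image_insert fx by (intro arg_cong[of _ _ "insert {n + 4}"] image_cong[OF refl] fr)
    also have "\<dots> = regions B.I"
      unfolding ins_simps(3) mr S(5) by (simp add: image_image)
    finally show ?thesis .
  qed
  ultimately have "diagram_iso f A.I B.I" by (simp only: diagram_iso_def) blast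
  then have "isotopic A.I B.I"
    using isotopic_iso link_marked[OF D k(4) n] link_kinked[OF D' aD n'] by blast
  then show "isotopic D (ins a (kinked (x \<in> over D) n) n ?D)"
    using isotopic_trans[OF isotopic_sym[OF isotopic_marked[OF D k(4) n]]] by (simp add: p_def)
qed

section \<open>Transport of kinks along isotopies\<close>

lemma kinked_iso:
  assumes f: "diagram_iso f D E" and D: "link_diagram D" and E: "link_diagram E"
    and d: "d \<in> darts D" and n: "fresh n D" "fresh n' E"
  shows "isotopic (ins d (kinked p n) n D) (ins (f d) (kinked p n') n' E)"
proof -
  define g where "g x = n' + (x - n)" for x
  have g: "g n = n'" "g (n + 1) = n' + 1" "g (n + 2) = n' + 2" "g (n + 3) = n' + 3" "g (n + 4) = n' + 4"
    "g (n + 5) = n' + 5" by (simp_all add: g_def)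
  have "diagram_iso g (kinked p n) (kinked p n')"
    unfolding diagram_iso_def
  proof (intro conjI)
    have "inj_on g (darts (kinked p n))" by (rule inj_onI) (auto simp: g_def)
    then show "bij_betw g (darts (kinked p n)) (darts (kinked p n'))"
      by (simp add: bij_betw_def g)
  qed (auto simp: g)
  moreover have fd: "f d \<in> darts E"
    using f d by (auto simp: diagram_iso_def bij_betw_def)
  moreover have "local_diagram D" "local_diagram E" using D E by (simp_all add: link_diagram_iff)
  ultimately have "diagram_iso (\<lambda>x. if x \<in> darts (kinked p n) then g x else f x)
      (ins d (kinked p n) n D) (ins (f d) (kinked p n') n' E)"
    using ins_iso[OF f, of g "kinked p n" "kinked p n'" d n] insertion_kinked d n
    by (simp add: g(1) del: kinked_simps)
  then show ?thesis using isotopic_iso link_kinked[OF D d n(1)] link_kinked[OF E fd n(2)] by blast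
qed

lemma kinked_relabel:
  assumes "link_diagram D" "d \<in> darts D" "fresh n D" "fresh n' D"
  shows "isotopic (ins d (kinked p n) n D) (ins d (kinked p n') n' D)"
  using kinked_iso[OF deqv_iso[OF deqv_refl] assms(1,1) assms(2-4)] by simp

lemma kinked_deqv:
  assumes "link_diagram D" "D \<approx> E" "d \<in> darts D" "fresh n D"
  shows "isotopic (ins d (kinked p n) n D) (ins d (kinked p n) n E)"
  using isotopic_deqv[OF link_kinked[OF assms(1,3,4)]
      ins_cong(1)[OF assms(2) insertion_kinked[OF _ assms(3,4)]]] assms(1)
  by (simp add: link_diagram_iff)

lemma kinked_remove_marker:
  assumes D: "link_diagram D" and v: "removable_marker D v" and d: "d \<in> darts D"
    and n: "fresh n D" "fresh n' (remove_marker v D)"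
  defines "d' \<equiv> if d = v then opp D (rot D v) else if d = rot D v then opp D v else d"
  shows "d' \<in> darts (remove_marker v D)"
    and "isotopic (ins d (kinked p n) n D) (ins d' (kinked p n') n' (remove_marker v D))"
proof -
  have LD: "local_diagram D" using D by (simp add: link_diagram_iff)
  have D': "link_diagram (remove_marker v D)" using link_remove_marker[OF LD v] D by simp
  have i: "insertion d (kinked p n) n D" for p by (rule insertion_kinked[OF LD d n(1)])
  note r = remove_marker_ins[OF i v, folded d'_def]
  show d': "d' \<in> darts (remove_marker v D)" using insertion.d[OF r(3)] .
  have n': "fresh n (remove_marker v D)" using n(1) by (auto simp: fresh_def remove_marker_simps)
  have "isotopic (ins d (kinked p n) n D) (ins d' (kinked p n) n (remove_marker v D))"
    using isotopic_remove_marker[OF link_kinked[OF D d n(1)] r(2) link_kinked[OF D' d' n'] r(1)] .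
  then show "isotopic (ins d (kinked p n) n D) (ins d' (kinked p n') n' (remove_marker v D))"
    using isotopic_trans kinked_relabel[OF D' d' n' n(2)] by blast
qed

text \<open>Forgetting the marker merges its two edges, and both insertions become the insertion at
  \<open>opp D v\<close>.\<close>

lemma kinked_slide:
  assumes "link_diagram D" "removable_marker D v" "fresh n D"
  shows "isotopic (ins (opp D v) (kinked p n) n D) (ins (rot D v) (kinked p n) n D)"
proof -
  have LD: "local_diagram D" using assms(1) by (simp add: link_diagram_iff)
  note m = removable_marker_darts[OF LD assms(2)]
  have n': "fresh n (remove_marker v D)" using assms(3) by (auto simp: fresh_def remove_marker_simps)
  have "isotopic (ins (opp D v) (kinked p n) n D) (ins (opp D v) (kinked p n) n (remove_marker v D))"
    using kinked_remove_marker(2)[OF assms(1,2) m(5) assms(3) n'] m by simp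
  moreover have "isotopic (ins (rot D v) (kinked p n) n D) (ins (opp D v) (kinked p n) n (remove_marker v D))"
    using kinked_remove_marker(2)[OF assms(1,2) m(2) assms(3) n'] m by simp
  ultimately show ?thesis using isotopic_trans isotopic_sym by blast
qed

text \<open>Induction on the isotopy: a relabelling maps the dart, forgetting a marker moves it to a
  surviving dart of the merged edge if necessary, and adding a marker keeps it. The dart
  \<open>d'\<close> is chosen before the labels, so that the induction can pass through an
  intermediate diagram with labels fresh for that diagram.\<close>

lemma kinked_transport:
  assumes "isotopic D E" "link_diagram D" "d \<in> darts D"
  shows "\<exists>d'\<in>darts E. \<forall>n n' p. fresh n D \<longrightarrow> fresh n' E \<longrightarrow>
    isotopic (ins d (kinked p n) n D) (ins d' (kinked p n') n' E)"
  using assms(1) unfolding isotopic_def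
proof (induction rule: equivclp_induct)
  case base
  show ?case using kinked_relabel[OF assms(2,3)] assms(3) by (auto simp: isotopic_def)
next
  case (step E F)
  then obtain d' where d': "d' \<in> darts E" and iso: "\<And>n n' p. fresh n D \<Longrightarrow> fresh n' E \<Longrightarrow>
    isotopic (ins d (kinked p n) n D) (ins d' (kinked p n') n' E)"
    unfolding isotopic_def by blast
  have L: "link_diagram E" "link_diagram F" using step(2) by (auto simp: isotopy_step_def)
  then have LE: "local_diagram E" "local_diagram F" by (simp_all add: link_diagram_iff)
  have "\<exists>d''\<in>darts F. \<forall>n n' p. fresh n E \<longrightarrow> fresh n' F \<longrightarrow>
    isotopic (ins d' (kinked p n) n E) (ins d'' (kinked p n') n' F)"
  proof -
    have inv: "diagram_iso (inv_into (darts X) f) Y X"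
      if f: "diagram_iso f X Y" and X: "local_diagram X" for f X Y
    proof -
      let ?g = "inv_into (darts X) f"
      have b: "bij_betw f (darts X) (darts Y)" using f by (simp add: diagram_iso_def)
      have gf: "?g (f x) = x" if "x \<in> darts X" for x
        using that b by (simp add: bij_betw_inv_into_left)
      have fg: "\<exists>x\<in>darts X. y = f x" if "y \<in> darts Y" for y
        using that b by (auto simp: bij_betw_def)
      have img: "?g ` f ` S = S" if "S \<subseteq> darts X" for S
        using that gf by (force simp: image_image)
      have "(`) ?g ` (`) f ` regions X = regions X"
        using img region_subset[OF X] by (simp add: image_image)
      then show ?thesis
        using f bij_betw_inv_into[OF b] fg gf img[OF over_subset[OF X]] rot_darts[OF X] opp_darts[OF X]
        by (auto simp: diagram_iso_def) metis+
    qed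
    have fr: "\<exists>n. fresh n E" "\<exists>n. fresh n F" using ex_fresh LE by blast+
    consider f where "diagram_iso f E F" | v where "removable_marker E v" "F = remove_marker v E"
      | v where "removable_marker F v" "E = remove_marker v F"
      using step(2) inv[OF _ LE(1)] inv[OF _ LE(2)] unfolding isotopy_step_def by blast
    then show ?thesis
    proof cases
      case (1 f)
      then have "f d' \<in> darts F" using d' by (auto simp: diagram_iso_def bij_betw_def)
      then show ?thesis using kinked_iso[OF 1 L d'] by blast
    next
      case (2 v)
      then show ?thesis using kinked_remove_marker[OF L(1) 2(1) d'] 2(2) fr by blast
    next
      case (3 v)
      then have dF: "d' \<in> darts F" "d' \<noteq> v" "d' \<noteq> rot F v" using d' by (simp_all add: remove_marker_simps)
      then show ?thesis
        using kinked_remove_marker(2)[OF L(2) 3(1) dF(1)] isotopic_sym unfolding 3(2) by fastforce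
    qed
  qed
  then obtain d'' where d'': "d'' \<in> darts F" "\<And>n n' p. fresh n E \<Longrightarrow> fresh n' F \<Longrightarrow>
    isotopic (ins d' (kinked p n) n E) (ins d'' (kinked p n') n' F)" by blast
  obtain k where "\<forall>j. fresh (k + j) E" using ex_fresh[OF LE(1)] by blast
  then have k: "fresh k E" by (metis add_0_right)
  have "isotopic (ins d (kinked p n) n D) (ins d'' (kinked p n') n' F)" if "fresh n D" "fresh n' F" for n n' p
    using isotopic_trans[OF iso[OF that(1) k] d''(2)[OF k that(2)]] .
  then show ?case using d''(1) unfolding isotopic_def by blast
qed

text \<open>The common form, up to isotopy, of a creating move from \<open>D\<close> to
  \<open>E\<close> and a removing move from \<open>E\<close> to \<open>D\<close>. One model tangle
  for each crossing type covers all kinks, because insertion at the opposite end of the edge puts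
  the loop on the other side.\<close>

definition kink_added :: "diagram \<Rightarrow> diagram \<Rightarrow> bool" where
  "kink_added D E \<longleftrightarrow> link_diagram D \<and>
     (\<exists>d\<in>darts D. \<exists>n p. fresh n D \<and> isotopic E (ins d (kinked p n) n D))"

lemma kink_added_isotopic:
  assumes "kink_added D E" "isotopic D D'" "isotopic E E'"
  shows "kink_added D' E'"
proof -
  obtain d n p where d: "link_diagram D" "d \<in> darts D" "fresh n D" "isotopic E (ins d (kinked p n) n D)"
    using assms(1) by (auto simp: kink_added_def)
  obtain d' where d': "d' \<in> darts D'" and iso: "\<And>n n' p. fresh n D \<Longrightarrow> fresh n' D' \<Longrightarrow>
    isotopic (ins d (kinked p n) n D) (ins d' (kinked p n') n' D')"
    using kinked_transport[OF assms(2) d(1,2)] by blast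
  have D': "link_diagram D'" using isotopic_link_diagram assms(2) d(1) by blast
  then obtain n' where "\<forall>k. fresh (n' + k) D'" using ex_fresh link_diagram_iff by blast
  then have n': "fresh n' D'" by (metis add_0_right)
  have "isotopic E' (ins d' (kinked p n') n' D')"
    using isotopic_trans[OF isotopic_sym[OF assms(3)] isotopic_trans[OF d(4) iso[OF d(3) n']]] .
  then show ?thesis using D' d' n' by (auto simp: kink_added_def)
qed

lemma omega1_down_kink_added:
  assumes "omega1_down E D"
  shows "kink_added D E"
proof -
  obtain x where x: "link_diagram E" "link_diagram D" "kink E x" "D = remove_kink x E"
    using assms by (auto simp: omega1_down_def)
  obtain n where "\<forall>k. fresh (n + k) E" using ex_fresh x(1) link_diagram_iff by blast
  then have n: "fresh n E" by (metis add_0_right)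
  then have "fresh n D" by (auto simp: fresh_def x(4) remove_kink_simps)
  then show ?thesis
    using kink_isotopic_ins[OF x(1,3) x(2)[unfolded x(4)] n] x(2,4) by (auto simp: kink_added_def)
qed

lemma kink_added_omega1_down:
  assumes "kink_added D E"
  shows "\<exists>E' D'. isotopic E E' \<and> omega1_down E' D' \<and> isotopic D' D"
proof -
  obtain d n p where d: "link_diagram D" "d \<in> darts D" "fresh n D" "isotopic E (ins d (kinked p n) n D)"
    using assms by (auto simp: kink_added_def)
  have LD: "local_diagram D" using d(1) by (simp add: link_diagram_iff)
  let ?E = "ins d (kinked p n) n D"
  let ?D = "remove_kink (n + 4) ?E"
  note r = remove_kinked[OF LD d(2,3), of p]
  have L: "link_diagram ?D" using deqv_link[OF deqv_sym[OF r(1)] link_marked[OF d(1-3)]] .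
  then have "omega1_down ?E ?D" using r(2) link_kinked[OF d(1-3)] by (auto simp: omega1_down_def)
  moreover have "isotopic ?D D"
    using isotopic_trans[OF isotopic_deqv[OF L r(1)] isotopic_marked[OF d(1-3)]] .
  ultimately show ?thesis using d(4) by blast
qed

text \<open>If both kinks sit on the same edge, a further marker separates them.\<close>

lemma kink_added_swap:
  assumes "kink_added D E" "kink_added D F"
  shows "\<exists>G. kink_added E G \<and> kink_added F G"
proof -
  \<comment> \<open>Stated for an arbitrary base diagram, and with \<open>E\<close> and
    \<open>F\<close> known only up to isotopy, so that it also applies after a marker has been added
    to the base diagram.\<close>
  have distinct: "\<exists>G. kink_added E G \<and> kink_added F G"
    if D: "link_diagram D" and d: "d \<in> darts D" "d' \<in> darts D" "d \<noteq> d'"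
      and E: "\<And>n. fresh n D \<Longrightarrow> isotopic E (ins d (kinked p n) n D)"
      and F: "\<And>n. fresh n D \<Longrightarrow> isotopic F (ins d' (kinked p' n) n D)" for D d d' p p'
  proof -
    have LD: "local_diagram D" using D by (simp add: link_diagram_iff)
    obtain n where nk: "\<And>k. fresh (n + k) D" using ex_fresh[OF LD] by blast
    have n: "fresh n D" "fresh (n + 6) D" using nk[of 0] nk[of 6] by simp_all
    let ?E = "ins d (kinked p n) n D" and ?F = "ins d' (kinked p' (n + 6)) (n + 6) D"
    let ?G = "ins d' (kinked p' (n + 6)) (n + 6) ?E"
    have LE: "link_diagram ?E" "link_diagram ?F" using link_kinked D d n by blast+
    have disj: "darts (kinked p' (n + 6)) \<inter> darts (kinked p n) = {}" by auto
    have eq: "?G \<approx> ins d (kinked p n) n ?F"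
      using ins_commute[OF insertion_kinked[OF LD d(2) n(2)] insertion_kinked[OF LD d(1) n(1)] d(3)[symmetric] disj] .
    have fr: "fresh (n + 6) ?E" "fresh n ?F" and dE: "d' \<in> darts ?E" "d \<in> darts ?F"
      using n d by (auto simp: fresh_def)
    have "link_diagram ?G" using link_kinked[OF LE(1) dE(1) fr(1)] .
    then have "isotopic ?G (ins d (kinked p n) n ?F)" using eq by (rule isotopic_deqv)
    then have "kink_added ?E ?G" "kink_added ?F ?G"
      using LE fr dE isotopic_refl[of ?G] unfolding kink_added_def by blast+
    then have "kink_added E ?G" "kink_added F ?G"
      using kink_added_isotopic[OF _ isotopic_sym[OF E[OF n(1)]] isotopic_refl]
        kink_added_isotopic[OF _ isotopic_sym[OF F[OF n(2)]] isotopic_refl] by blast+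
    then show ?thesis by blast
  qed
  have link_D: "link_diagram D" and LD: "local_diagram D"
    using assms(1) by (simp_all add: kink_added_def link_diagram_iff)
  obtain d k p where d: "d \<in> darts D" "fresh k D" "isotopic E (ins d (kinked p k) k D)"
    using assms(1) by (auto simp: kink_added_def)
  obtain d' k' p' where d': "d' \<in> darts D" "fresh k' D" "isotopic F (ins d' (kinked p' k') k' D)"
    using assms(2) by (auto simp: kink_added_def)
  show ?thesis
  proof (cases "d = d'")
    case False
    show ?thesis
      using distinct[OF link_D d(1) d'(1) False] isotopic_trans[OF d(3) kinked_relabel[OF link_D d(1,2)]]
        isotopic_trans[OF d'(3) kinked_relabel[OF link_D d'(1,2)]] by blast
  next
    case True
    obtain m where mk: "\<And>k. fresh (m + k) D" using ex_fresh[OF LD] by blast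
    have m: "fresh m D" using mk[of 0] by simp
    \<comment> \<open>The new marker divides the edge at \<open>d\<close> into one edge starting at
      \<open>d\<close> and one starting at \<open>m\<close>. A kink on either half is isotopic to
      the kink on the undivided edge, so one is placed on each half.\<close>
    let ?S = "ins d (straight m) m D"
    note r = remove_straight[OF LD d(1) m]
    have S: "link_diagram ?S" using link_straight[OF link_D d(1) m] .
    interpret I: insertion d "straight m" m D by (rule insertion_straight[OF LD d(1) m])
    have rot: "rot ?S m = m + 1" "opp ?S (m + 1) = d" using I.rot_I(2)[OF I.b] I.opp_I(3) by simp_all
    have edge: "isotopic (ins x (kinked q n) n ?S) (ins d (kinked q k) k D)"
      if "x = d \<or> x = m" and n: "fresh n ?S" "fresh k D" for x q n k
    proof -
      have x: "x \<in> darts ?S" using that(1) d(1) by auto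
      have d_ne: "d \<noteq> m" "d \<noteq> m + 1" using m d(1) by (auto simp: fresh_def)
      have dk: "(if x = m then opp ?S (rot ?S m) else if x = rot ?S m then opp ?S m else x) = d"
        using that(1) d_ne by (auto simp: rot)
      have n': "fresh n (remove_marker m ?S)" "fresh n D"
        using n(1) by (auto simp: fresh_def remove_marker_simps)
      have "isotopic (ins x (kinked q n) n ?S) (ins d (kinked q n) n (remove_marker m ?S))"
        using kinked_remove_marker(2)[OF S r(2) x n(1) n'(1)] unfolding dk .
      moreover have "isotopic (ins d (kinked q n) n (remove_marker m ?S)) (ins d (kinked q n) n D)"
        using isotopic_sym[OF kinked_deqv[OF link_D deqv_sym[OF r(1)] d(1) n'(2)]] .
      moreover have "isotopic (ins d (kinked q n) n D) (ins d (kinked q k) k D)"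
        using kinked_relabel[OF link_D d(1) n'(2) n(2)] .
      ultimately show ?thesis using isotopic_trans by blast
    qed
    have "d \<in> darts ?S" "m \<in> darts ?S" "d \<noteq> m" using d(1) m by (auto simp: fresh_def)
    moreover have "isotopic E (ins d (kinked p n) n ?S)" if "fresh n ?S" for n
      using isotopic_trans[OF d(3) isotopic_sym[OF edge[OF _ that d(2)]]] by blast
    moreover have "isotopic F (ins m (kinked p' n) n ?S)" if "fresh n ?S" for n
      using isotopic_trans[OF d'(3)[folded True] isotopic_sym[OF edge[OF _ that d'(2)]]] by blast
    ultimately show ?thesis using distinct[OF S] by blast
  qed
qed

section \<open>Rectangles\<close>

text \<open>If one region were on both sides of the edge, \<open>insert_tangle\<close> would extend
  it twice, giving two overlapping sets, while \<open>ins\<close> would form one union. With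
  different regions on the two sides, each absorbs exactly one side of the tangle in both
  constructions.\<close>

lemma insert_tangle_eq:
  assumes "insertion d T b D" and sep: "\<And>r. r \<in> regions D \<Longrightarrow> d \<in> r \<Longrightarrow> opp D d \<notin> r"
  shows "insert_tangle d T b D = ins d T b D"
proof -
  interpret insertion d T b D by fact
  have b_iff: "b \<in> s \<longleftrightarrow> s = reg T b" "c \<in> s \<longleftrightarrow> s = reg T c" if "s \<in> regions T" for s
    using region_unique[OF T that] reg_b reg_c by blast+
  have "{r \<in> regions D. d \<notin> r \<and> e \<notin> r} \<union> {s \<in> regions T. b \<notin> s \<and> c \<notin> s} \<union>
      {r \<union> s | r s. r \<in> regions D \<and> s \<in> regions T \<and> (d \<in> r \<and> b \<in> s \<or> e \<in> r \<and> c \<in> s)} =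
    attach d T b D ` regions D \<union> (regions T - {reg T b, reg T c})" (is "?A \<union> ?B \<union> ?C = ?L \<union> ?M")
  proof -
    have "?B = ?M" using b_iff by auto
    moreover have "?A \<union> ?C = ?L"
    proof (intro equalityI subsetI)
      fix q assume "q \<in> ?A \<union> ?C"
      then consider "q \<in> regions D" "d \<notin> q" "e \<notin> q"
        | r s where "r \<in> regions D" "s \<in> regions T" "d \<in> r" "b \<in> s" "q = r \<union> s"
        | r s where "r \<in> regions D" "s \<in> regions T" "e \<in> r" "c \<in> s" "q = r \<union> s" by blast
      then show "q \<in> ?L"
      proof cases
        case 1
        then have "q = attach d T b D q" by (simp add: attach_def)
        then show ?thesis using 1 by blast
      next
        case 2
        then have "q = attach d T b D r" using sep[OF 2(1,3)] b_iff[OF 2(2)] by (simp add: attach_def)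
        then show ?thesis using 2 by blast
      next
        case 3
        then have "d \<notin> r" using sep by blast
        then have "q = attach d T b D r" using 3 b_iff[OF 3(2)] by (simp add: attach_def)
        then show ?thesis using 3 by blast
      qed
    next
      fix q assume "q \<in> ?L"
      then obtain r where r: "r \<in> regions D" "q = attach d T b D r" by blast
      consider "d \<in> r" | "e \<in> r" | "d \<notin> r" "e \<notin> r" by blast
      then show "q \<in> ?A \<union> ?C"
      proof cases
        case 1
        then have "q = r \<union> reg T b" using sep[OF r(1)] r(2) by (simp add: attach_def)
        then show ?thesis using r(1) 1 reg_b by blast
      next
        case 2
        then have "q = r \<union> reg T c" using sep[OF r(1)] r(2) by (auto simp: attach_def)
        then show ?thesis using r(1) 2 reg_c by blast
      next
        case 3
        then have "q = r" using r(2) by (simp add: attach_def)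
        then show ?thesis using r(1) 3 by blast
      qed
    qed
    moreover have "?A \<union> ?B \<union> ?C = (?A \<union> ?C) \<union> ?B" by (simp only: Un_ac)
    ultimately show ?thesis by (simp only:)
  qed
  then show ?thesis unfolding insert_tangle_def ins_def Let_def by (simp only:)
qed

lemma rectangle_link: "rectangle T b \<Longrightarrow> link_diagram T"
  by (induction rule: rectangle.induct) auto

lemma rectangle_deqv:
  assumes "rectangle T b" "T \<approx> T'"
  shows "rectangle T' b"
  using rectangle.relabel[OF assms(1) deqv_link[OF assms(2)] deqv_iso[OF assms(2)]]
    rectangle_link[OF assms(1)] by simp

text \<open>The circle with one marker: one component and two boundary walks, one for each
  direction. Sphericity then gives it two regions.\<close>

lemma card_orbits_rot_opp_marker:
  assumes "local_diagram T" "marker T b" "darts T = {b, rot T b}"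
  shows "opp T b = rot T b" "opp T (rot T b) = b"
    and "card (orbits (darts T) {rot T, opp T}) = 1" "card (orbits (darts T) {face T}) = 2"
proof -
  have b: "b \<in> darts T" "rot T b \<in> darts T" "rot T (rot T b) = b" "rot T b \<noteq> b"
    using assms rot_darts[OF assms(1)] by (auto simp: marker_def)
  show o: "opp T b = rot T b" using opp_darts[OF assms(1) b(1)] opp_neq[OF assms(1) b(1)] assms(3) by auto
  show o': "opp T (rot T b) = b" using opp_opp[OF assms(1) b(1)] o by simp
  show "card (orbits (darts T) {rot T, opp T}) = 1"
  proof (rule card_orbits_transitive[OF b(1)])
    show "f y \<in> darts T" if "y \<in> darts T" "f \<in> {rot T, opp T}" for y f
      using that rot_darts[OF assms(1)] opp_darts[OF assms(1)] by blast
    have "(y, rot T y) \<in> (steps (darts T) {rot T, opp T})\<^sup>*" if "y \<in> darts T" for y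
      using that by auto
    from this[OF b(1)] this[OF b(2)]
    show "(y, z) \<in> (steps (darts T) {rot T, opp T})\<^sup>*" if "y \<in> darts T" "z \<in> darts T" for y z
      using that b(3) unfolding assms(3) by fastforce
  qed
  have f: "face T b = b" "face T (rot T b) = rot T b" using b o o' by (simp_all add: face_def)
  have "card (orbits ({b} \<union> {rot T b}) {face T}) = card (orbits {b} {face T}) + card (orbits {rot T b} {face T})"
    by (rule card_orbits_split) (use b f in auto)
  moreover have "card (orbits {b} {face T}) = 1"
    by (rule card_orbits_transitive[of b]) (use f in auto)
  moreover have "card (orbits {rot T b} {face T}) = 1"
    by (rule card_orbits_transitive[of "rot T b"]) (use f in auto)
  ultimately show "card (orbits (darts T) {face T}) = 2"
    unfolding assms(3) by (simp add: insert_commute)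
qed

text \<open>For the trivial tangle, sphericity forces two regions, so its only two darts are
  separated. The other rules relabel, or delete or restore darts outside the distinguished marker,
  and so keep its two sides apart.\<close>

lemma rectangle_tangle: "rectangle T b \<Longrightarrow> tangle T b"
proof (induction rule: rectangle.induct)
  case (trivial T b)
  then have L: "local_diagram T" and S: "spherical T" by (simp_all add: link_diagram_iff)
  have b: "b \<in> darts T" "rot T b \<in> darts T" using trivial(3) by auto
  have "card (regions T) = 2"
  proof -
    have "card (orbits (darts T) {rot T, opp T}) + region_count T = card (orbits (darts T) {face T}) + 1"
      using S unfolding spherical_def by (elim conjE)
    then show ?thesis
      using card_orbits_rot_opp_marker(3,4)[OF L trivial(2,3)] b by (simp add: region_count_def split: if_splits)
  qed
  moreover have "regions T = {darts T}" if c: "rot T b \<in> reg T b"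
  proof -
    have r: "reg T b \<in> regions T" "b \<in> reg T b" using reg_regions[OF L b(1)] reg_self[OF L b(1)] by simp_all
    then have eq: "reg T b = darts T" using region_subset[OF L r(1)] c trivial(3) by auto
    have "s = darts T" if s: "s \<in> regions T" for s
    proof -
      obtain x where "x \<in> s" using region_nonempty[OF L s] by blast
      then show ?thesis
        using region_unique[OF L s r(1)] region_subset[OF L s] eq by blast
    qed
    moreover have "darts T \<in> regions T" using r(1) eq by simp
    ultimately show ?thesis by blast
  qed
  ultimately have "rot T b \<notin> reg T b" by fastforce
  then show ?case using L trivial(2) by (simp add: tangle_def)
next
  case (relabel T b T' f)
  have L: "local_diagram T" "local_diagram T'" and b: "b \<in> darts T" "rot T b \<in> darts T" "marker T b" "rot T b \<notin> reg T b"
    using relabel rot_darts by (auto simp: tangle_def link_diagram_iff marker_def)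
  have "rot T' (f b) = f (rot T b)" "inj_on f (darts T)"
    using relabel(3) b(1) by (auto simp: diagram_iso_def bij_betw_def)
  moreover have "reg T b \<subseteq> darts T" using region_subset[OF L(1) reg_regions[OF L(1) b(1)]] .
  ultimately have "rot T' (f b) \<notin> reg T' (f b)"
    using diagram_iso_reg[OF relabel(3) L b(1)] b(2,4) by (auto simp: inj_on_def)
  then show ?case using L diagram_iso_marker[OF relabel(3) L b(1)] b(3) by (simp add: tangle_def)
next
  case (unmark T b v)
  have L: "local_diagram T" "local_diagram (remove_marker v T)" and b: "marker T b" "b \<in> darts T" "rot T b \<notin> reg T b"
    using unmark by (auto simp: tangle_def link_diagram_iff marker_def)
  note m = removable_marker_darts[OF L(1) unmark(2)]
  have bv: "b \<noteq> v" "b \<noteq> rot T v" "rot T b \<noteq> v" using unmark(3) m(4) by auto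
  have "reg (remove_marker v T) b = reg T b - {v, rot T v}"
    using reg_regions[OF L(1) b(2)] reg_self[OF L(1) b(2)] bv
    by (intro reg_eq[OF L(2)]) (auto simp: remove_marker_simps)
  then show ?case using L b bv by (simp add: tangle_def marker_def remove_marker_simps)
next
  case (mark v T b)
  have L: "local_diagram T" "local_diagram (remove_marker v T)" using mark by (auto simp: tangle_def link_diagram_iff)
  have b: "b \<in> darts (remove_marker v T)" "rot T b \<in> darts (remove_marker v T)"
    "rot T b \<notin> reg (remove_marker v T) b" "marker T b"
    using mark rot_darts[OF L(2), of b] by (auto simp: tangle_def marker_def remove_marker_simps)
  have bT: "b \<in> darts T" using b(1) by (simp add: remove_marker_simps)
  have "reg (remove_marker v T) b = reg T b - {v, rot T v}"
    using reg_regions[OF L(1) bT] reg_self[OF L(1) bT] b(1)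
    by (intro reg_eq[OF L(2)]) (auto simp: remove_marker_simps)
  then have "rot T b \<notin> reg T b" using b(2,3) by (auto simp: remove_marker_simps)
  then show ?case using L b by (simp add: tangle_def)
next
  case (add_kink x T b)
  have L: "local_diagram T" "local_diagram (remove_kink x T)" using add_kink by (auto simp: tangle_def link_diagram_iff)
  note k = kink_darts[OF L(1) add_kink(2)]
  let ?u = "rot T x" let ?v = "rot T (rot T x)" let ?Y = "remove_kink x T"
  have Y: "rot ?Y = (rot T)(?u := ?v, ?v := ?u)" "darts ?Y = darts T - {x, opp T x}"
    by (simp_all add: remove_kink_simps)
  have b: "marker ?Y b" "b \<in> darts ?Y" "rot ?Y b \<notin> reg ?Y b" using add_kink(5) by (auto simp: tangle_def marker_def)
  have bT: "b \<in> darts T" "b \<noteq> x" "b \<noteq> opp T x" "b \<noteq> ?u" "b \<noteq> ?v" using b(2) add_kink(3) by (auto simp: Y)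
  have r: "rot ?Y b = rot T b" using bT by (simp add: Y)
  have rr: "rot ?Y (rot T b) = b" "rot T b \<noteq> b" using b(1) unfolding marker_def r by simp_all
  have uv: "rot ?Y ?u = ?v" "rot ?Y ?v = ?u" using k(5) by (simp_all add: Y)
  \<comment> \<open>\<open>rot ?Y\<close> exchanges \<open>?u\<close> and \<open>?v\<close> and
    sends \<open>rot T b\<close> to \<open>b\<close>; if \<open>rot T b\<close> were one of these
    two darts, \<open>b\<close> would be the other.\<close>
  have "rot T b \<noteq> ?u" using rr(1) uv(1) bT(5) by metis
  moreover have "rot T b \<noteq> ?v" using rr(1) uv(2) bT(4) by metis
  ultimately have "rot T (rot T b) = b" using rr(1) unfolding Y(1) by simp
  then have mb: "marker T b" using bT rr by (simp add: marker_def)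
  have cY: "rot T b \<in> darts ?Y" using rot_darts[OF L(2) b(2)] r by simp
  have rb: "reg T b \<in> regions T" "b \<in> reg T b" using reg_regions[OF L(1) bT(1)] reg_self[OF L(1) bT(1)] by simp_all
  have "reg ?Y b = reg T b - {x, opp T x}"
    using rb bT by (intro reg_eq[OF L(2)]) (auto simp: remove_kink_simps)
  then have "rot T b \<notin> reg T b" using b(3) cY r by (auto simp: Y)
  then show ?case using L mb by (simp add: tangle_def)
qed

lemma rectangle_straight: "rectangle (straight n) n"
proof -
  have L: "local_diagram (straight n)" by (rule local_straight)
  have m: "marker (straight n) n" by (simp add: marker_def)
  have d: "darts (straight n) = {n, rot (straight n) n}" by simp
  note c = card_orbits_rot_opp_marker(3,4)[OF L m d]
  have "card (orbits (darts (straight n)) {rot (straight n)}) = 1"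
    by (rule card_orbits_transitive[of n]) (auto intro!: steps_refl_or_step)
  moreover have "card (orbits (darts (straight n)) {opp (straight n)}) = 1"
    using card_edges[OF L] by simp
  moreover have "region_count (straight n) = 2" by (simp add: region_count_def)
  moreover have "(x, y) \<in> (adjacency (straight n))\<^sup>*" if "x \<in> darts (straight n)" "y \<in> darts (straight n)" for x y
  proof -
    have "(n, n + 1) \<in> adjacency (straight n)" "(n + 1, n) \<in> adjacency (straight n)"
      by (simp_all add: adjacency_def)
    then show ?thesis using that by auto
  qed
  ultimately have "spherical (straight n)"
    unfolding spherical_def connected_iff[OF L] using c by simp
  then show ?thesis using L m d by (intro rectangle.trivial) (simp_all add: link_diagram_iff)
qed

text \<open>The three stages of the insertion are instances of the rules \<open>mark\<close>,
  \<open>mark\<close> and \<open>add_kink\<close>. Freshness of the labels keeps the distinguished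
  marker of \<open>T\<close> away from the marker that is turned into the kink.\<close>

lemma rectangle_kinked:
  assumes T: "rectangle T b" and d: "d \<in> darts T" and n: "fresh n T"
  shows "rectangle (ins d (kinked p n) n T) b"
proof -
  have L: "link_diagram T" using rectangle_link[OF T] .
  then have LT: "local_diagram T" by (simp add: link_diagram_iff)
  have b: "b \<in> darts T" "rot T b \<in> darts T" "rot T (rot T b) = b"
    using rectangle_tangle[OF T] rot_darts[OF LT] by (auto simp: tangle_def marker_def)
  have nb: "n \<noteq> b" "n + 1 \<noteq> b" "n + 2 \<noteq> b" "n + 3 \<noteq> b" "n \<noteq> rot T b" "n + 2 \<noteq> rot T b"
    using n b by (auto simp: fresh_def)
  note s = remove_straight[OF LT d n] and m = remove_marked[OF LT d n] and k = remove_kinked[OF LT d n, of p]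
  interpret S: insertion d "straight n" n T by (rule insertion_straight[OF LT d n])
  interpret M: insertion d "marked n" n T by (rule insertion_marked[OF LT d n])
  interpret K: insertion d "kinked p n" n T by (rule insertion_kinked[OF LT d n])
  have "rectangle (remove_marker n S.I) b" by (rule rectangle_deqv[OF T deqv_sym[OF s(1)]])
  then have "rectangle S.I b" using s(2) link_straight[OF L d n] by (rule rectangle.mark)
  then have "rectangle (remove_marker (n + 2) M.I) b" using deqv_sym[OF m(1)] by (rule rectangle_deqv)
  then have "rectangle M.I b" using m(2) link_marked[OF L d n] by (rule rectangle.mark)
  then have "rectangle (remove_kink (n + 4) K.I) b" using deqv_sym[OF k(1)] by (rule rectangle_deqv)
  moreover have "rot K.I (n + 4) = n + 2" "rot K.I (n + 2) = n + 3"
    using K.rot_I(2)[of "n + 4"] K.rot_I(2)[of "n + 2"] by simp_all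
  then have "b \<notin> {rot K.I (n + 4), rot K.I (rot K.I (n + 4))}" using nb by auto
  ultimately show ?thesis using k(2) link_kinked[OF L d n] using rectangle.add_kink by blast
qed

section \<open>The third move\<close>

lemma omega3_triangle_darts:
  assumes D: "local_diagram D" and tri: "omega3_triangle D t1 t2 t3"
  defines "s1 \<equiv> opp D t1" and "s2 \<equiv> opp D t2" and "s3 \<equiv> opp D t3"
  shows "t1 \<in> darts D" "t2 \<in> darts D" "t3 \<in> darts D" "s1 \<in> darts D" "s2 \<in> darts D" "s3 \<in> darts D"
    and "distinct [t1, t2, t3, s1, s2, s3]"
    and "opp D s1 = t1" "opp D s2 = t2" "opp D s3 = t3"
proof -
  have c: "crossing D t1" "crossing D t2" "crossing D t3"
    and f: "rot D s1 = t2" "rot D s2 = t3" "rot D s3 = t1"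
    and n: "\<And>n. (rot D ^^ n) t1 \<noteq> t2" "\<And>n. (rot D ^^ n) t2 \<noteq> t3" "\<And>n. (rot D ^^ n) t3 \<noteq> t1"
    using tri by (simp_all add: omega3_triangle_def face_def s1_def s2_def s3_def)
  show t: "t1 \<in> darts D" "t2 \<in> darts D" "t3 \<in> darts D" using c by (simp_all add: crossing_def)
  then show "s1 \<in> darts D" "s2 \<in> darts D" "s3 \<in> darts D"
    and os: "opp D s1 = t1" "opp D s2 = t2" "opp D s3 = t3"
    using opp_darts[OF D] opp_opp[OF D] by (simp_all add: s1_def s2_def s3_def)
  have tt: "t1 \<noteq> t2" "t2 \<noteq> t3" "t3 \<noteq> t1" using n(1)[of 0] n(2)[of 0] n(3)[of 0] by simp_all
  have ne: "rot D x \<noteq> x" if "x \<in> {t1, t2, t3}" for x using rot_neq[OF D] t that by blast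
  \<comment> \<open>Four applications of \<open>rot\<close> are the identity, so from
    \<open>rot D x\<close> three more lead back to \<open>x\<close>, against the assumption that the
    vertices are distinct.\<close>
  have r3: "y \<noteq> rot D x"
    if "x \<in> darts D" "\<And>n. (rot D ^^ n) y \<noteq> x" for x y
  proof
    assume "y = rot D x"
    then have "(rot D ^^ 3) y = x" using rot4[OF D that(1)] by (simp add: numeral_3_eq_3)
    then show False using that(2) by blast
  qed
  have "s1 \<noteq> t2" "s2 \<noteq> t3" "s3 \<noteq> t1" using f ne[of t1] ne[of t2] ne[of t3] by auto
  moreover have "s1 \<noteq> t3" "s2 \<noteq> t1" "s3 \<noteq> t2"
    using r3[OF t(3) n(2)] r3[OF t(1) n(3)] r3[OF t(2) n(1)] f by metis+
  moreover have "s1 \<noteq> t1" "s2 \<noteq> t2" "s3 \<noteq> t3" using opp_neq[OF D] t by (simp_all add: s1_def s2_def s3_def)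
  moreover have "s1 \<noteq> s2" "s2 \<noteq> s3" "s3 \<noteq> s1" using os tt by metis+
  ultimately show "distinct [t1, t2, t3, s1, s2, s3]" using tt by auto
qed

lemma transpose_closed:
  assumes "a \<in> A" "b \<in> A"
  shows "transpose a b x \<in> A \<longleftrightarrow> x \<in> A" "x \<notin> A \<Longrightarrow> transpose a b x = x"
  using assms by (cases "x = a"; cases "x = b"; force simp: transpose_def)+

lemma omega3_swap_darts:
  assumes "local_diagram D" "t \<in> darts D"
  shows "omega3_swap D t x \<in> darts D \<longleftrightarrow> x \<in> darts D" "x \<notin> darts D \<Longrightarrow> omega3_swap D t x = x"
proof -
  have "rot D (rot D t) \<in> darts D" "opp D t \<in> darts D" "rot D (rot D (opp D t)) \<in> darts D"
    using assms rot_darts[OF assms(1)] opp_darts[OF assms(1)] by simp_all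
  then show "omega3_swap D t x \<in> darts D \<longleftrightarrow> x \<in> darts D"
    "x \<notin> darts D \<Longrightarrow> omega3_swap D t x = x"
    using assms(2) by (simp_all add: omega3_swap_def Let_def transpose_closed)
qed

lemma omega3_result_simps:
  "darts (omega3_result t1 t2 t3 D) = darts D"
  "opp (omega3_result t1 t2 t3 D) = opp D"
  by (simp_all add: omega3_result_def Let_def)

text \<open>Before the move the region of \<open>t\<close> is the triangle, which contains none of
  the opposite darts. After it every old region has lost the opposite darts, and the new triangle,
  which has them, contains none of \<open>t1\<close>, \<open>t2\<close>, \<open>t3\<close>. This
  supplies the separation that \<open>insert_tangle_eq\<close> asks for.\<close>

lemma omega3_separated:
  assumes D: "local_diagram D" and tri: "omega3_triangle D t1 t2 t3" and t: "t \<in> {t1, t2, t3}"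
  shows "r \<in> regions D \<Longrightarrow> t \<in> r \<Longrightarrow> opp D t \<notin> r"
    and "r \<in> regions (omega3_result t1 t2 t3 D) \<Longrightarrow> t \<in> r \<Longrightarrow> opp D t \<notin> r"
proof -
  note d = omega3_triangle_darts[OF D tri]
  have T: "{t1, t2, t3} \<in> regions D" using tri by (simp add: omega3_triangle_def)
  show "opp D t \<notin> r" if "r \<in> regions D" "t \<in> r"
  proof -
    have "r = {t1, t2, t3}" using region_unique[OF D that(1) T that(2) t] .
    then show ?thesis using t d(7) by auto
  qed
  show "opp D t \<notin> r" if "r \<in> regions (omega3_result t1 t2 t3 D)" "t \<in> r"
    using that t d(7) by (auto simp: omega3_result_def Let_def)
qed

text \<open>The move permutes positions of darts through \<open>rot\<close> and keeps
  \<open>opp\<close>, while an insertion changes \<open>opp\<close> only at one edge. As that edge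
  is not an edge of the triangle, the swaps and the triangle are the same in both diagrams; the edge
  may well end at one of the three crossings.\<close>

lemma omega3_ins:
  assumes i: "insertion d K k D" and tri: "omega3_triangle D t1 t2 t3"
    and d: "d \<notin> {t1, t2, t3, opp D t1, opp D t2, opp D t3}"
  shows "omega3_triangle (ins d K k D) t1 t2 t3"
    and "omega3_result t1 t2 t3 (ins d K k D) \<approx> ins d K k (omega3_result t1 t2 t3 D)"
proof -
  interpret I: insertion d K k D by (rule i)
  note D = I.D
  define s1 where "s1 = opp D t1"
  define s2 where "s2 = opp D t2"
  define s3 where "s3 = opp D t3"
  note t = omega3_triangle_darts[OF D tri, folded s1_def s2_def s3_def]
  have T: "{t1, t2, t3} \<in> regions D" using tri by (simp add: omega3_triangle_def)
  have dn: "d \<notin> {t1, t2, t3, s1, s2, s3}" using d by (simp add: s1_def s2_def s3_def)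
  have en: "opp D d \<notin> {t1, t2, t3, s1, s2, s3}"
  proof
    assume "opp D d \<in> {t1, t2, t3, s1, s2, s3}"
    then have "opp D (opp D d) \<in> opp D ` {t1, t2, t3, s1, s2, s3}" by (rule imageI)
    then show False using dn t(8-10) I.e(3) by (auto simp: s1_def s2_def s3_def)
  qed
  have o: "opp I.I t1 = s1" "opp I.I t2 = s2" "opp I.I t3 = s3"
  proof -
    have "t1 \<noteq> d" "t1 \<noteq> opp D d" "t2 \<noteq> d" "t2 \<noteq> opp D d" "t3 \<noteq> d" "t3 \<noteq> opp D d"
      using dn en by blast+
    then show "opp I.I t1 = s1" "opp I.I t2 = s2" "opp I.I t3 = s3"
      using t(1-3) by (simp_all add: s1_def s2_def s3_def)
  qed
  have attT: "attach d K k D r = {t1, t2, t3} \<longleftrightarrow> r = {t1, t2, t3}" if r: "r \<in> regions D" for r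
  proof
    assume a: "attach d K k D r = {t1, t2, t3}"
    then have "t1 \<in> r" using I.attach_mem(1)[OF r t(1)] by blast
    then show "r = {t1, t2, t3}" using region_unique[OF D r T] by blast
  qed (use dn en in \<open>auto simp: attach_def\<close>)
  have "{t1, t2, t3} \<in> attach d K k D ` regions D" using attT[OF T] T by (metis imageI)
  then have TI: "{t1, t2, t3} \<in> regions I.I" by simp
  have pow: "(rot I.I ^^ n) x = (rot D ^^ n) x \<and> (rot D ^^ n) x \<in> darts D" if "x \<in> darts D" for n x
    by (induction n) (use that rot_darts[OF D] in auto)
  have nK: "x \<notin> over K" if "x \<in> darts D" for x using that I.notin over_subset[OF I.T] by blast
  show "omega3_triangle I.I t1 t2 t3"
    using tri TI t(1-6) pow unfolding omega3_triangle_def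
    by (simp add: face_def o s1_def[symmetric] s2_def[symmetric] s3_def[symmetric] nK del: ins_simps(3))
  let ?R = "omega3_result t1 t2 t3 D"
  have sw: "omega3_swap I.I t1 = omega3_swap D t1" "omega3_swap I.I t2 = omega3_swap D t2"
    "omega3_swap I.I t3 = omega3_swap D t3"
    using t(1-6) rot_darts[OF D] by (simp_all add: omega3_swap_def Let_def o s1_def[symmetric] s2_def[symmetric] s3_def[symmetric])
  define m where "m = omega3_swap D t1 \<circ> omega3_swap D t2 \<circ> omega3_swap D t3"
  have mD: "m x \<in> darts D \<longleftrightarrow> x \<in> darts D" "x \<notin> darts D \<Longrightarrow> m x = x" for x
    using omega3_swap_darts[OF D] t(1-3) by (simp_all add: m_def)
  have qI: "rot I.I (rot I.I t1) = rot D (rot D t1)" "rot I.I (rot I.I t2) = rot D (rot D t2)"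
    "rot I.I (rot I.I t3) = rot D (rot D t3)"
    using t(1-3) rot_darts[OF D] by simp_all
  define g where "g r = (r - {t1, t2, t3, s1, s2, s3}) \<union>
      {t. t = t1 \<and> rot D (rot D t3) \<in> r \<or> t = t2 \<and> rot D (rot D t1) \<in> r \<or> t = t3 \<and> rot D (rot D t2) \<in> r}" for r
  have RI: "darts (omega3_result t1 t2 t3 I.I) = darts I.I" "rot (omega3_result t1 t2 t3 I.I) = m \<circ> rot I.I \<circ> m"
    "opp (omega3_result t1 t2 t3 I.I) = opp I.I" "over (omega3_result t1 t2 t3 I.I) = m ` over I.I"
    "regions (omega3_result t1 t2 t3 I.I) = insert {s1, s2, s3} (g ` (regions I.I - {{t1, t2, t3}}))"
    by (simp_all add: omega3_result_def Let_def sw qI o m_def[symmetric] g_def[abs_def] del: ins_simps)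
  have R: "darts ?R = darts D" "rot ?R = m \<circ> rot D \<circ> m" "opp ?R = opp D" "over ?R = m ` over D"
    "regions ?R = insert {s1, s2, s3} (g ` (regions D - {{t1, t2, t3}}))"
    by (simp_all add: omega3_result_def Let_def m_def[symmetric] g_def[abs_def]
        s1_def[symmetric] s2_def[symmetric] s3_def[symmetric])
  have rotR: "rot (ins d K k ?R) x = (if x \<in> darts K then rot K x else rot ?R x)" for x
    by (simp add: ins_def)
  have "rot (omega3_result t1 t2 t3 I.I) x = rot (ins d K k ?R) x" if x: "x \<in> darts I.I" for x
  proof (cases "x \<in> darts K")
    case True
    then have "m x = x" "rot K x \<in> darts K" "m (rot K x) = rot K x"
      using mD I.notin rot_darts[OF I.T] by simp_all
    then show ?thesis using True by (simp add: RI(2) rotR)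
  next
    case False
    then have "m x \<in> darts D" using x mD by simp
    then show ?thesis using False by (simp add: RI(2) R(2) rotR)
  qed
  moreover have "opp I.I = opp (ins d K k ?R)" unfolding ins_def R(3) by simp
  moreover have "m ` over I.I = over (ins d K k ?R)"
  proof -
    have "m ` over K = id ` over K"
    proof (rule image_cong[OF refl])
      fix x assume "x \<in> over K"
      then have "x \<notin> darts D" using over_subset[OF I.T] I.notin(2) by blast
      then show "m x = id x" using mD(2) by simp
    qed
    then show ?thesis by (simp add: R image_Un)
  qed
  moreover have "regions (omega3_result t1 t2 t3 I.I) = regions (ins d K k ?R)"
  proof -
    let ?RK = "regions K - {reg K k, reg K (rot K k)}"
    have qD: "rot D (rot D t1) \<in> darts D" "rot D (rot D t2) \<in> darts D" "rot D (rot D t3) \<in> darts D"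
      using t(1-3) rot_darts[OF D] by simp_all
    have 1: "g (attach d K k D r) = attach d K k ?R (g r)" if r: "r \<in> regions D" for r
    proof -
      have a: "d \<in> g r \<longleftrightarrow> d \<in> r" "opp D d \<in> g r \<longleftrightarrow> opp D d \<in> r" using dn en by (auto simp: g_def)
      have q: "x \<in> attach d K k D r \<longleftrightarrow> x \<in> r" if "x \<in> darts D" for x
        using I.attach_mem(1)[OF r that] .
      have K: "X - {t1, t2, t3, s1, s2, s3} = X" if "X \<subseteq> darts K" for X
        using that t(1-6) I.notin by blast
      have "g (attach d K k D r) = g r \<union> (if d \<in> r then reg K k else {}) \<union>
          (if opp D d \<in> r then reg K (rot K k) else {})"
        unfolding g_def q[OF qD(1)] q[OF qD(2)] q[OF qD(3)]
        by (simp add: attach_def Un_Diff K I.reg_sub Un_ac)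
      then show ?thesis by (simp add: attach_def[of d K k ?R] a R(3))
    qed
    have 2: "g s = s" if "s \<in> ?RK" for s
    proof -
      have "s \<subseteq> darts K" by (rule I.other_region(4)[OF that])
      then have "x \<notin> s" if "x \<in> darts D" for x using that I.notin by blast
      then show ?thesis using t(1-6) qD by (auto simp: g_def)
    qed
    have "regions I.I - {{t1, t2, t3}} = attach d K k D ` (regions D - {{t1, t2, t3}}) \<union> ?RK"
    proof -
      have "{t1, t2, t3} \<notin> ?RK" using I.other_region(4) t(1) I.notin by blast
      moreover have "attach d K k D ` regions D - {{t1, t2, t3}} = attach d K k D ` (regions D - {{t1, t2, t3}})"
        using attT by blast
      ultimately show ?thesis unfolding ins_simps(3) Un_Diff by simp
    qed
    then have "g ` (regions I.I - {{t1, t2, t3}}) =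
        g ` attach d K k D ` (regions D - {{t1, t2, t3}}) \<union> g ` ?RK"
      by (simp only: image_Un)
    also have "g ` ?RK = ?RK" using 2 by simp
    also have "g ` attach d K k D ` (regions D - {{t1, t2, t3}}) =
        attach d K k ?R ` g ` (regions D - {{t1, t2, t3}})"
      unfolding image_image by (rule image_cong[OF refl]) (simp add: 1)
    finally have g: "g ` (regions I.I - {{t1, t2, t3}}) =
        attach d K k ?R ` g ` (regions D - {{t1, t2, t3}}) \<union> ?RK" .
    have "attach d K k ?R {s1, s2, s3} = {s1, s2, s3}" using dn en by (simp add: attach_def R(3))
    then show ?thesis unfolding RI(5) g unfolding ins_simps(3) R(5) image_insert by simp
  qed
  ultimately show "omega3_result t1 t2 t3 I.I \<approx> ins d K k ?R"
    unfolding deqv_def RI(1,3,4) by (simp add: R(1) del: ins_simps(2,3))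
qed

section \<open>Insertions at the three edges of a triangle\<close>

lemma insertion_ins:
  assumes "insertion d' T' b' D" "d \<in> darts D" "tangle T b" "darts D \<inter> darts T = {}"
    "darts T' \<inter> darts T = {}"
  shows "insertion d T b (ins d' T' b' D)"
  using insertion.local_I[OF assms(1)] assms(2-5) by (auto simp: insertion_def)

text \<open>Moves the insertion of \<open>K\<close> inwards past one of the nested tangles, given
  what it does below that level; \<open>outer\<close>, \<open>inner1\<close> and
  \<open>inner2\<close> iterate this.\<close>

lemma ins_commute_cong:
  assumes "insertion d K k D" "insertion t T b D" "d \<noteq> t" "darts K \<inter> darts T = {}"
    and "ins d K k D \<approx> E"
  shows "ins d K k (ins t T b D) \<approx> ins t T b E"
proof -
  have "ins d K k (ins t T b D) \<approx> ins t T b (ins d K k D)"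
    by (rule ins_commute[OF assms(1-4)])
  also have "\<dots> \<approx> ins t T b E"
  proof (rule ins_cong(1)[OF assms(5)])
    show "insertion t T b (ins d K k D)"
      using assms(2,4) by (intro insertion_ins[OF assms(1)]) (auto simp: insertion_def)
  qed
  finally show ?thesis .
qed

text \<open>A diagram and its \<Omega>3 result have the same darts and the same \<open>opp\<close>,
  so the locale holds for both with the same tangles, and each fact is applied once before and once
  after the move.\<close>

locale three_insertions =
  fixes D :: diagram and t1 t2 t3 :: nat and T1 T2 T3 :: diagram and b1 b2 b3 :: nat
  assumes D: "local_diagram D" and t: "t1 \<in> darts D" "t2 \<in> darts D" "t3 \<in> darts D"
    and dist: "distinct [t1, t2, t3, opp D t1, opp D t2, opp D t3]"
    and T: "tangle T1 b1" "tangle T2 b2" "tangle T3 b3"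
    and disj: "darts T1 \<inter> darts D = {}" "darts T2 \<inter> darts D = {}" "darts T3 \<inter> darts D = {}"
      "darts T1 \<inter> darts T2 = {}" "darts T2 \<inter> darts T3 = {}" "darts T3 \<inter> darts T1 = {}"
begin

abbreviation "X1 \<equiv> ins t1 T1 b1 D"
abbreviation "X2 \<equiv> ins t2 T2 b2 X1"
abbreviation "X3 \<equiv> ins t3 T3 b3 X2"

lemma i1: "insertion t1 T1 b1 D" and i2: "insertion t2 T2 b2 X1" and i3: "insertion t3 T3 b3 X2"
proof -
  have d: "darts D \<inter> darts T1 = {}" "darts D \<inter> darts T2 = {}" "darts D \<inter> darts T3 = {}"
    "darts T1 \<inter> darts T3 = {}" using disj by auto
  show i1: "insertion t1 T1 b1 D" using D t(1) T(1) d(1) by (simp add: insertion_def)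
  show i2: "insertion t2 T2 b2 X1"
    by (rule insertion_ins[OF i1 t(2) T(2) d(2) disj(4)])
  show "insertion t3 T3 b3 X2"
    by (rule insertion_ins[OF i2]) (use t(3) T(3) d disj in auto)
qed

sublocale I1: insertion t1 T1 b1 D by (rule i1)
sublocale I2: insertion t2 T2 b2 X1 by (rule i2)
sublocale I3: insertion t3 T3 b3 X2 by (rule i3)

lemma darts_X3: "darts X3 = darts D \<union> darts T1 \<union> darts T2 \<union> darts T3"
  by simp

lemma insert_tangle_X3:
  assumes "\<And>t r. t \<in> {t1, t2, t3} \<Longrightarrow> r \<in> regions D \<Longrightarrow> t \<in> r \<Longrightarrow> opp D t \<notin> r"
  shows "insert_tangle t3 T3 b3 (insert_tangle t2 T2 b2 (insert_tangle t1 T1 b1 D)) = X3"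
proof -
  have n: "t2 \<noteq> t1" "t2 \<noteq> opp D t1" "t3 \<noteq> t1" "t3 \<noteq> opp D t1" "t3 \<noteq> t2" "t3 \<noteq> opp D t2" using dist by auto
  have o: "opp D t2 \<in> darts D" "opp D t3 \<in> darts D" using D t opp_darts by blast+
  \<comment> \<open>\<open>attach\<close> adds no dart of \<open>E\<close> to a region of
    \<open>E\<close>. So separation at one edge survives an insertion at another, and the three
    tangles can be treated one after the other.\<close>
  have sep: "t \<in> q \<Longrightarrow> opp (ins d T b E) t \<notin> q"
    if i: "insertion d T b E" and sE: "\<And>r. r \<in> regions E \<Longrightarrow> t \<in> r \<Longrightarrow> opp E t \<notin> r"
      and tE: "t \<in> darts E" and q: "q \<in> regions (ins d T b E)" and ot: "opp (ins d T b E) t = opp E t"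
    for d T b E t q
  proof -
    interpret J: insertion d T b E by (rule i)
    assume tq: "t \<in> q"
    have o: "opp E t \<in> darts E" using opp_darts[OF J.D tE] .
    consider r where "r \<in> regions E" "q = attach d T b E r" | "q \<in> regions T - {reg T b, reg T (rot T b)}"
      using q by auto
    then show "opp (ins d T b E) t \<notin> q"
    proof cases
      case 1
      then show ?thesis using tq sE tE o J.attach_mem(1)[OF 1(1)] by (simp add: ot)
    next
      case 2
      then show ?thesis using J.other_region(4)[OF 2] tq tE J.notin by blast
    qed
  qed
  have o3: "opp X1 t3 = opp D t3" "opp X1 t2 = opp D t2" using n t by simp_all
  have s1: "opp D t1 \<notin> r" if "r \<in> regions D" "t1 \<in> r" for r using assms that by blast
  have s2: "opp X1 t2 \<notin> r" if "r \<in> regions X1" "t2 \<in> r" for r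
    using sep[OF i1 assms t(2) that(1) _ that(2)] o3 by simp
  have s3': "opp X1 t3 \<notin> r" if "r \<in> regions X1" "t3 \<in> r" for r
    using sep[OF i1 assms t(3) that(1) _ that(2)] o3 by simp
  have s3: "opp X2 t3 \<notin> r" if "r \<in> regions X2" "t3 \<in> r" for r
    using sep[OF i2 s3' _ that(1) _ that(2)] n t o3 by simp
  show ?thesis
    using insert_tangle_eq[OF i1 s1] insert_tangle_eq[OF i2 s2] insert_tangle_eq[OF i3 s3] by simp
qed

lemma opp_X3:
  "opp X3 (opp D t1) = b1" "opp X3 (opp D t2) = b2" "opp X3 (opp D t3) = b3"
  "opp X3 b1 = opp D t1" "opp X3 b2 = opp D t2" "opp X3 b3 = opp D t3"
  "opp X3 (opp T1 b1) = t1" "opp X3 (opp T2 b2) = t2" "opp X3 (opp T3 b3) = t3"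
  "x \<in> darts T1 \<Longrightarrow> x \<noteq> b1 \<Longrightarrow> x \<noteq> opp T1 b1 \<Longrightarrow> opp X3 x = opp T1 x"
  "x \<in> darts T2 \<Longrightarrow> x \<noteq> b2 \<Longrightarrow> x \<noteq> opp T2 b2 \<Longrightarrow> opp X3 x = opp T2 x"
  "x \<in> darts T3 \<Longrightarrow> x \<noteq> b3 \<Longrightarrow> x \<noteq> opp T3 b3 \<Longrightarrow> opp X3 x = opp T3 x"
proof -
  have n: "t2 \<noteq> t1" "t2 \<noteq> opp D t1" "t3 \<noteq> t1" "t3 \<noteq> opp D t1" "t3 \<noteq> t2" "t3 \<noteq> opp D t2"
    "opp D t1 \<noteq> t2" "opp D t1 \<noteq> t3" "opp D t2 \<noteq> t3" "opp D t2 \<noteq> t1" "opp D t3 \<noteq> t1" "opp D t3 \<noteq> t2"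
    "opp D t1 \<noteq> opp D t2" "opp D t1 \<noteq> opp D t3" "opp D t2 \<noteq> opp D t3" "opp D t2 \<noteq> opp D t1"
    "opp D t3 \<noteq> opp D t1" "opp D t3 \<noteq> opp D t2" using dist by auto
  have o: "opp D t1 \<in> darts D" "opp D t2 \<in> darts D" "opp D t3 \<in> darts D" using D t opp_darts by blast+
  have e: "opp X1 t2 = opp D t2" "opp X1 t3 = opp D t3" "opp X1 (opp D t2) = t2" "opp X1 (opp D t3) = t3"
    using n t o opp_opp[OF D] by simp_all
  have e2: "opp X2 t3 = opp D t3" using n t o e by simp
  have inD: "x \<noteq> t2 \<and> x \<noteq> t3 \<and> x \<noteq> opp D t2 \<and> x \<noteq> opp D t3" if "x \<notin> darts D" for x
    using that t o by blast
  have b: "b1 \<in> darts T1" "opp T1 b1 \<in> darts T1" "b2 \<in> darts T2" "opp T2 b2 \<in> darts T2"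
    using I1.b I1.bcf I2.b I2.bcf by simp_all
  have nD: "x \<notin> darts D" if "x \<in> darts T1 \<or> x \<in> darts T2 \<or> x \<in> darts T3" for x using that disj by blast
  have k1: "opp X3 x = opp X1 x" if "x \<in> darts X1" "x \<noteq> t2" "x \<noteq> t3" "x \<noteq> opp D t2" "x \<noteq> opp D t3" for x
    using that I3.opp_I(5)[of x] I2.opp_I(5)[of x] by (simp add: e e2)
  have k2: "opp X3 x = opp X2 x" if "x \<in> darts X2" "x \<noteq> t3" "x \<noteq> opp D t3" for x
    using that I3.opp_I(5)[of x] by (simp add: e e2)
  show "opp X3 (opp D t1) = b1" using k1 o n by simp
  show "opp X3 (opp D t2) = b2" using k2[of "opp D t2"] o n I2.opp_I(2) by (simp add: e)
  show "opp X3 (opp D t3) = b3" using I3.opp_I(2) by (simp add: e2)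
  show "opp X3 b1 = opp D t1" using k1[of b1] inD[OF nD, of b1] b by simp
  show "opp X3 b2 = opp D t2" using k2[of b2] inD[OF nD, of b2] b I2.opp_I(4) by (simp add: e)
  show "opp X3 b3 = opp D t3" using I3.opp_I(4) by (simp add: e2)
  show "opp X3 (opp T1 b1) = t1" using k1[of "opp T1 b1"] inD[OF nD, of "opp T1 b1"] b by simp
  show "opp X3 (opp T2 b2) = t2" using k2[of "opp T2 b2"] inD[OF nD, of "opp T2 b2"] b I2.opp_I(3) by simp
  show "opp X3 (opp T3 b3) = t3" by (rule I3.opp_I(3))
  show "opp X3 x = opp T1 x" if "x \<in> darts T1" "x \<noteq> b1" "x \<noteq> opp T1 b1"
    using that k1[of x] inD[OF nD, of x] by simp
  show "opp X3 x = opp T2 x" if "x \<in> darts T2" "x \<noteq> b2" "x \<noteq> opp T2 b2"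
    using that k2[of x] inD[OF nD, of x] I2.opp_I(6)[of x] by simp
  show "opp X3 x = opp T3 x" if "x \<in> darts T3" "x \<noteq> b3" "x \<noteq> opp T3 b3"
    using that I3.opp_I(6)[of x] by simp
qed

lemma marker_X3:
  "marker X3 b1" "marker X3 b2" "marker X3 b3" "rot X3 b1 = rot T1 b1" "rot X3 b2 = rot T2 b2" "rot X3 b3 = rot T3 b3"
  "rot X3 (rot T1 b1) = b1" "rot X3 (rot T2 b2) = b2" "rot X3 (rot T3 b3) = b3"
  using I1.marker_b I2.marker_b I3.marker_b I1.b I2.b I3.b I1.bcf I2.bcf I3.bcf by simp_all

context
  fixes K :: diagram and k :: nat
  assumes K: "tangle K k"
    and K_disj: "darts K \<inter> darts D = {}" "darts K \<inter> darts T1 = {}" "darts K \<inter> darts T2 = {}" "darts K \<inter> darts T3 = {}"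
begin

lemma ins_X1: "d \<in> darts X1 \<Longrightarrow> insertion d K k X1"
  using I1.local_I K K_disj by (auto simp: insertion_def)

lemma ins_X2: "d \<in> darts X2 \<Longrightarrow> insertion d K k X2"
  using I2.local_I K K_disj by (auto simp: insertion_def)

lemma ins_D: "d \<in> darts D \<Longrightarrow> insertion d K k D"
  using D K K_disj by (auto simp: insertion_def)

lemma outer:
  assumes d: "d \<in> darts D" "d \<notin> {t1, t2, t3}"
  shows "ins d K k X3 \<approx> ins t3 T3 b3 (ins t2 T2 b2 (ins t1 T1 b1 (ins d K k D)))"
proof -
  have n: "d \<noteq> t1" "d \<noteq> t2" "d \<noteq> t3" using d by auto
  have "ins d K k X1 \<approx> ins t1 T1 b1 (ins d K k D)"
    by (rule ins_commute[OF ins_D[OF d(1)] i1 n(1) K_disj(2)])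
  from ins_commute_cong[OF ins_X1 i2 n(2) K_disj(3) this]
  have "ins d K k X2 \<approx> ins t2 T2 b2 (ins t1 T1 b1 (ins d K k D))" using d by simp
  from ins_commute_cong[OF ins_X2 i3 n(3) K_disj(4) this]
  show ?thesis using d by simp
qed

text \<open>The kink is absorbed by the first tangle. As in \<open>ins_nest\<close>, the edge of
  \<open>T1\<close> at \<open>b1\<close> is found at \<open>t1\<close> in the composite, so
  \<open>b1\<close> itself, which now addresses an edge outside the tangle, is not covered.\<close>

lemma inner1:
  assumes "d' \<in> darts T1"
  shows "ins (if d' = b1 then t1 else d') K k X3 \<approx> ins t3 T3 b3 (ins t2 T2 b2 (ins t1 (ins d' K k T1) b1 D))"
proof -
  define d where "d = (if d' = b1 then t1 else d')"
  have d: "d \<in> darts X1" "d \<noteq> t2" "d \<noteq> t3" using assms t dist disj by (auto simp: d_def)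
  have "insertion d' K k T1" using I1.T assms K K_disj by (auto simp: insertion_def)
  then have "ins d K k X1 \<approx> ins t1 (ins d' K k T1) b1 D"
    unfolding d_def by (rule ins_nest(1)[OF i1 _ K_disj(1)])
  from ins_commute_cong[OF ins_X1 i2 d(2) K_disj(3) this]
  have "ins d K k X2 \<approx> ins t2 T2 b2 (ins t1 (ins d' K k T1) b1 D)" using d by simp
  from ins_commute_cong[OF ins_X2 i3 d(3) K_disj(4) this]
  show ?thesis unfolding d_def[symmetric] using d by auto
qed

lemma inner2:
  assumes "d' \<in> darts T2"
  shows "ins (if d' = b2 then t2 else d') K k X3 \<approx> ins t3 T3 b3 (ins t2 (ins d' K k T2) b2 X1)"
proof -
  let ?d = "if d' = b2 then t2 else d'"
  have d: "?d \<in> darts X2" "?d \<noteq> t3" using assms t dist disj by auto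
  have "insertion d' K k T2" using I2.T assms K K_disj by (auto simp: insertion_def)
  then have "ins ?d K k X2 \<approx> ins t2 (ins d' K k T2) b2 X1"
    by (rule ins_nest(1)[OF i2]) (use K_disj in auto)
  from ins_commute_cong[OF ins_X2 i3 d(2) K_disj(4) this]
  show ?thesis using d by simp
qed

lemma inner3:
  assumes "d' \<in> darts T3"
  shows "ins (if d' = b3 then t3 else d') K k X3 \<approx> ins t3 (ins d' K k T3) b3 X2"
proof -
  have "insertion d' K k T3" using I3.T assms K K_disj by (auto simp: insertion_def)
  then show ?thesis by (rule ins_nest(1)[OF i3]) (use K_disj in auto)
qed

end

end

lemma three_insertionsI:
  assumes "local_diagram D" "omega3_triangle D t1 t2 t3"
    and "rectangle T1 b1" "rectangle T2 b2" "rectangle T3 b3"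
    and "darts T1 \<inter> darts D = {}" "darts T2 \<inter> darts D = {}" "darts T3 \<inter> darts D = {}"
      "darts T1 \<inter> darts T2 = {}" "darts T2 \<inter> darts T3 = {}" "darts T3 \<inter> darts T1 = {}"
    and E: "local_diagram E" "darts E = darts D" "opp E = opp D"
  shows "three_insertions E t1 t2 t3 T1 T2 T3 b1 b2 b3"
  using assms omega3_triangle_darts[OF assms(1,2)] rectangle_tangle by (simp add: three_insertions_def)

section \<open>Star moves and the insertion of a kink on either side\<close>

definition star_data :: "diagram \<Rightarrow> nat \<Rightarrow> nat \<Rightarrow> nat \<Rightarrow> diagram \<Rightarrow> nat \<Rightarrow> diagram \<Rightarrow> nat \<Rightarrow> diagram \<Rightarrow> nat \<Rightarrow> bool" where
  "star_data D t1 t2 t3 T1 b1 T2 b2 T3 b3 \<longleftrightarrow>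
     link_diagram D \<and> link_diagram (omega3_result t1 t2 t3 D) \<and> omega3_triangle D t1 t2 t3 \<and>
     rectangle T1 b1 \<and> rectangle T2 b2 \<and> rectangle T3 b3 \<and>
     darts T1 \<inter> darts D = {} \<and> darts T2 \<inter> darts D = {} \<and> darts T3 \<inter> darts D = {} \<and>
     darts T1 \<inter> darts T2 = {} \<and> darts T2 \<inter> darts T3 = {} \<and> darts T3 \<inter> darts T1 = {}"

lemma star_data_insertions:
  assumes "star_data D t1 t2 t3 T1 b1 T2 b2 T3 b3"
  shows "three_insertions D t1 t2 t3 T1 T2 T3 b1 b2 b3"
    and "three_insertions (omega3_result t1 t2 t3 D) t1 t2 t3 T1 T2 T3 b1 b2 b3"
  using assms
  by (intro three_insertionsI[of D]; simp add: star_data_def link_diagram_iff omega3_result_simps)+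

lemma omega3_star_iff:
  "omega3_star E E' \<longleftrightarrow> link_diagram E \<and> link_diagram E' \<and>
    (\<exists>D t1 t2 t3 T1 b1 T2 b2 T3 b3. star_data D t1 t2 t3 T1 b1 T2 b2 T3 b3 \<and>
      E = ins t3 T3 b3 (ins t2 T2 b2 (ins t1 T1 b1 D)) \<and>
      E' = ins t3 T3 b3 (ins t2 T2 b2 (ins t1 T1 b1 (omega3_result t1 t2 t3 D))))"
proof -
  have "insert_tangle t3 T3 b3 (insert_tangle t2 T2 b2 (insert_tangle t1 T1 b1 D)) =
        ins t3 T3 b3 (ins t2 T2 b2 (ins t1 T1 b1 D))"
      "insert_tangle t3 T3 b3 (insert_tangle t2 T2 b2 (insert_tangle t1 T1 b1 (omega3_result t1 t2 t3 D))) =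
        ins t3 T3 b3 (ins t2 T2 b2 (ins t1 T1 b1 (omega3_result t1 t2 t3 D)))"
    if s: "star_data D t1 t2 t3 T1 b1 T2 b2 T3 b3" for D t1 t2 t3 T1 b1 T2 b2 T3 b3
  proof -
    have D: "local_diagram D" "omega3_triangle D t1 t2 t3" using s by (simp_all add: star_data_def link_diagram_iff)
    note sep = omega3_separated[OF D]
    show "insert_tangle t3 T3 b3 (insert_tangle t2 T2 b2 (insert_tangle t1 T1 b1 D)) =
        ins t3 T3 b3 (ins t2 T2 b2 (ins t1 T1 b1 D))"
      by (rule three_insertions.insert_tangle_X3[OF star_data_insertions(1)[OF s]]) (rule sep(1))
    show "insert_tangle t3 T3 b3 (insert_tangle t2 T2 b2 (insert_tangle t1 T1 b1 (omega3_result t1 t2 t3 D))) =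
        ins t3 T3 b3 (ins t2 T2 b2 (ins t1 T1 b1 (omega3_result t1 t2 t3 D)))"
      by (rule three_insertions.insert_tangle_X3[OF star_data_insertions(2)[OF s]])
        (use sep(2) in \<open>simp add: omega3_result_simps\<close>)
  qed
  then have eq: "(star_data D t1 t2 t3 T1 b1 T2 b2 T3 b3 \<and>
      E = ins t3 T3 b3 (ins t2 T2 b2 (ins t1 T1 b1 D)) \<and>
      E' = ins t3 T3 b3 (ins t2 T2 b2 (ins t1 T1 b1 (omega3_result t1 t2 t3 D)))) \<longleftrightarrow>
      star_data D t1 t2 t3 T1 b1 T2 b2 T3 b3 \<and>
      E = insert_tangle t3 T3 b3 (insert_tangle t2 T2 b2 (insert_tangle t1 T1 b1 D)) \<and>
      E' = insert_tangle t3 T3 b3 (insert_tangle t2 T2 b2 (insert_tangle t1 T1 b1 (omega3_result t1 t2 t3 D)))"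
    for D t1 t2 t3 T1 b1 T2 b2 T3 b3
    by (intro conj_cong refl) simp_all
  show ?thesis
    unfolding omega3_star_def eq by (simp only: star_data_def conj_assoc)
qed

lemma (in three_insertions) X3_cong:
  assumes "D \<approx> D'"
  shows "X3 \<approx> ins t3 T3 b3 (ins t2 T2 b2 (ins t1 T1 b1 D'))"
  using ins_cong(1)[OF ins_cong(1)[OF ins_cong(1)[OF assms i1] i2] i3] .

lemma omega3_star_darts: "omega3_star E E' \<Longrightarrow> darts E' = darts E"
  by (auto simp: omega3_star_iff omega3_result_simps)

text \<open>Insertion at the same \<open>d\<close> makes sense on both sides because a star move
  keeps the set of darts. According to the position of \<open>d\<close>, the kink becomes part of
  the underlying \<Omega>3 move or of one of its rectangles, possibly after an isotopy performed on
  both sides at once.\<close>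

lemma omega3_star_kinked:
  assumes star: "omega3_star E E'" and d: "d \<in> darts E" and n: "fresh n E"
  shows "\<exists>F F'. isotopic (ins d (kinked p n) n E) F \<and> isotopic (ins d (kinked p n) n E') F' \<and> omega3_star F F'"
proof -
  let ?K = "kinked p n"
  obtain D t1 t2 t3 T1 b1 T2 b2 T3 b3 where s: "star_data D t1 t2 t3 T1 b1 T2 b2 T3 b3"
    and E: "E = ins t3 T3 b3 (ins t2 T2 b2 (ins t1 T1 b1 D))"
    and E': "E' = ins t3 T3 b3 (ins t2 T2 b2 (ins t1 T1 b1 (omega3_result t1 t2 t3 D)))"
    and L: "link_diagram E" "link_diagram E'"
    using star unfolding omega3_star_iff by (elim conjE exE) (rule that)
  let ?R = "omega3_result t1 t2 t3 D"
  interpret P: three_insertions D t1 t2 t3 T1 T2 T3 b1 b2 b3 by (rule star_data_insertions(1)[OF s])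
  interpret Q: three_insertions ?R t1 t2 t3 T1 T2 T3 b1 b2 b3 by (rule star_data_insertions(2)[OF s])
  have dartsE: "darts E = darts D \<union> darts T1 \<union> darts T2 \<union> darts T3" "darts E' = darts E"
    using P.darts_X3 omega3_star_darts[OF star] by (simp_all add: E)
  have n': "fresh n E'" using n by (simp add: fresh_def dartsE(2))
  have fr: "fresh n D" "fresh n ?R" "fresh n T1" "fresh n T2" "fresh n T3"
    using n by (auto simp: fresh_def dartsE omega3_result_simps)
  have disj_K: "darts ?K \<inter> A = {}" if "A \<subseteq> darts E" for A
  proof -
    have "x \<notin> darts ?K" if "x \<in> darts E" for x using n that by (auto simp: fresh_def)
    then show ?thesis using that by blast
  qed
  note sd = s[unfolded star_data_def]
  \<comment> \<open>The property is formulated up to isotopy at both ends, so that it passes across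
    any marker common to \<open>E\<close> and \<open>E'\<close>.\<close>
  define good where "good d \<longleftrightarrow> (\<exists>F F'. isotopic (ins d ?K n E) F \<and> isotopic (ins d ?K n E') F' \<and> omega3_star F F')"
    for d
  have good: "good d"
    if d: "d \<in> darts E" and s': "star_data D' t1 t2 t3 T1' b1 T2' b2 T3' b3"
      and eq: "ins d ?K n E \<approx> ins t3 T3' b3 (ins t2 T2' b2 (ins t1 T1' b1 D'))"
        "ins d ?K n E' \<approx> ins t3 T3' b3 (ins t2 T2' b2 (ins t1 T1' b1 (omega3_result t1 t2 t3 D')))"
    for d D' T1' T2' T3'
  proof -
    have "d \<in> darts E'" using d dartsE by simp
    then have "link_diagram (ins d ?K n E)" "link_diagram (ins d ?K n E')"
      using link_kinked L d n n' by blast+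
    then show ?thesis
      using deqv_link[OF eq(1)] deqv_link[OF eq(2)] isotopic_deqv[OF _ eq(1)] isotopic_deqv[OF _ eq(2)] s'
      unfolding good_def omega3_star_iff by blast
  qed
  have sub: "darts D \<subseteq> darts E" "darts T1 \<subseteq> darts E" "darts T2 \<subseteq> darts E" "darts T3 \<subseteq> darts E" "darts ?R \<subseteq> darts E"
    by (auto simp: dartsE omega3_result_simps)
  note dK = disj_K[OF sub(1)] disj_K[OF sub(2)] disj_K[OF sub(3)] disj_K[OF sub(4)] disj_K[OF sub(5)]
  note dKs = dK(1)[unfolded Int_commute[of "darts ?K"]] dK(2)[unfolded Int_commute[of "darts ?K"]]
    dK(3)[unfolded Int_commute[of "darts ?K"]] dK(4)[unfolded Int_commute[of "darts ?K"]]
  have outside: "good x"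
    if x: "x \<in> darts D" "x \<notin> {t1, t2, t3, opp D t1, opp D t2, opp D t3}" for x
  proof -
    let ?D = "ins x ?K n D"
    have LD: "link_diagram D" "link_diagram ?R" "omega3_triangle D t1 t2 t3" using sd by blast+
    have i: "insertion x ?K n D" by (rule insertion_kinked[OF P.D x(1) fr(1)])
    note o = omega3_ins[OF i LD(3) x(2)]
    have xR: "x \<in> darts ?R" using x(1) by (simp add: omega3_result_simps)
    have "link_diagram (omega3_result t1 t2 t3 ?D)"
      using deqv_link[OF deqv_sym[OF o(2)]] link_kinked[OF LD(2) xR fr(2)] .
    then have s': "star_data ?D t1 t2 t3 T1 b1 T2 b2 T3 b3"
      using sd o(1) link_kinked[OF LD(1) x(1) fr(1)] dKs
      unfolding star_data_def by (simp add: Int_Un_distrib del: kinked_simps)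
    have xn: "x \<notin> {t1, t2, t3}" using x(2) by blast
    have "ins x ?K n E' \<approx> ins t3 T3 b3 (ins t2 T2 b2 (ins t1 T1 b1 (ins x ?K n ?R)))"
      unfolding E' by (rule Q.outer[OF tangle_kinked dK(5,2,3,4) xR xn])
    also have "\<dots> \<approx> ins t3 T3 b3 (ins t2 T2 b2 (ins t1 T1 b1 (omega3_result t1 t2 t3 ?D)))"
      using three_insertions.X3_cong[OF star_data_insertions(2)[OF s'] o(2)] by (rule deqv_sym)
    finally show ?thesis
      using good[OF _ s' P.outer[OF tangle_kinked dK(1-4) x(1) xn, folded E]] x(1) by (simp add: dartsE)
  qed
  \<comment> \<open>For \<open>x = b1\<close> this yields \<open>good t1\<close>; that
    \<open>b1\<close> itself is good follows only in \<open>strand\<close>.\<close>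
  have inside1: "good (if x = b1 then t1 else x)" if x: "x \<in> darts T1" for x
  proof -
    have "rectangle (ins x ?K n T1) b1" using sd rectangle_kinked[OF _ x fr(3)] by blast
    then have s': "star_data D t1 t2 t3 (ins x ?K n T1) b1 T2 b2 T3 b3"
      using sd dK unfolding star_data_def by (simp add: Int_Un_distrib Int_Un_distrib2 Int_commute del: kinked_simps)
    show ?thesis
      by (rule good[OF _ s' P.inner1[OF tangle_kinked dK(1-4) x, folded E] Q.inner1[OF tangle_kinked dK(5,2-4) x, folded E']])
        (use x P.t in \<open>simp add: dartsE\<close>)
  qed
  have inside2: "good (if x = b2 then t2 else x)" if x: "x \<in> darts T2" for x
  proof -
    have "rectangle (ins x ?K n T2) b2" using sd rectangle_kinked[OF _ x fr(4)] by blast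
    then have s': "star_data D t1 t2 t3 T1 b1 (ins x ?K n T2) b2 T3 b3"
      using sd dK unfolding star_data_def by (simp add: Int_Un_distrib Int_Un_distrib2 Int_commute del: kinked_simps)
    show ?thesis
      by (rule good[OF _ s' P.inner2[OF tangle_kinked dK(1-4) x, folded E] Q.inner2[OF tangle_kinked dK(5,2-4) x, folded E']])
        (use x P.t in \<open>simp add: dartsE\<close>)
  qed
  have inside3: "good (if x = b3 then t3 else x)" if x: "x \<in> darts T3" for x
  proof -
    have "rectangle (ins x ?K n T3) b3" using sd rectangle_kinked[OF _ x fr(5)] by blast
    then have s': "star_data D t1 t2 t3 T1 b1 T2 b2 (ins x ?K n T3) b3"
      using sd dK unfolding star_data_def by (simp add: Int_Un_distrib Int_Un_distrib2 Int_commute del: kinked_simps)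
    show ?thesis
      by (rule good[OF _ s' P.inner3[OF tangle_kinked dK(1-4) x, folded E] Q.inner3[OF tangle_kinked dK(5,2-4) x, folded E']])
        (use x P.t in \<open>simp add: dartsE\<close>)
  qed
  have slide: "good (opp E v) \<longleftrightarrow> good (rot E v)"
    if "removable_marker E v" "removable_marker E' v" "opp E' v = opp E v" "rot E' v = rot E v" for v
  proof -
    have "isotopic (ins (opp E v) ?K n E) (ins (rot E v) ?K n E)" by (rule kinked_slide[OF L(1) that(1) n])
    moreover have "isotopic (ins (opp E v) ?K n E') (ins (rot E v) ?K n E')"
      using kinked_slide[OF L(2) that(2) n'] that(3,4) by simp
    ultimately show ?thesis unfolding good_def using isotopic_trans isotopic_sym by blast
  qed
  text \<open>The two edges at the distinguished marker are not part of the tangle, so that a kink on them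
    has to be moved across this marker.\<close>
  have strand: "good u \<and> good u' \<and> (\<forall>x\<in>darts T. good x)"
    if T: "tangle T b" "darts T \<inter> darts D = {}" and u: "u \<in> darts D" "u' \<in> darts D"
      and inside: "\<And>x. x \<in> darts T \<Longrightarrow> good (if x = b then u else x)"
      and m: "marker E b" "marker E' b" "rot E b = rot T b" "rot E' b = rot T b" "rot E (rot T b) = b" "rot E' (rot T b) = b"
      and o: "opp E b = u'" "opp E' b = u'" "opp E (opp T b) = u" "opp E' (opp T b) = u"
        "\<And>x. x \<in> darts T \<Longrightarrow> x \<noteq> b \<Longrightarrow> x \<noteq> opp T b \<Longrightarrow> opp E x = opp T x \<and> opp E' x = opp T x"
    for T b u u'
  proof -
    let ?c = "rot T b"
    have LT: "local_diagram T" and b: "b \<in> darts T" "?c \<in> darts T" "?c \<noteq> b"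
      using T(1) rot_darts[of T b] by (auto simp: tangle_def marker_def)
    have nu: "u \<noteq> x" "u' \<noteq> x" if "x \<in> darts T" for x using that u T(2) by blast+
    have good_u: "good u" using inside[OF b(1)] by simp
    have good_x: "good x" if "x \<in> darts T" "x \<noteq> b" for x using inside[OF that(1)] that(2) by simp
    have "removable_marker E b" "removable_marker E' b"
      using m nu(2)[OF b(2)] by (simp_all add: removable_marker_def o)
    \<comment> \<open>\<open>?c\<close> is a dart of the tangle other than \<open>b\<close> and thus
      already good; sliding across the marker \<open>{b, ?c}\<close> carries this to
      \<open>u'\<close>, on the edge that leaves the tangle.\<close>
    then have "good u' \<longleftrightarrow> good ?c" using slide[of b] m o by simp
    then have good_u': "good u'" using good_x[OF b(2,3)] by simp
    \<comment> \<open>The dart facing \<open>?c\<close> is \<open>u\<close> if the strand of the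
      tangle is a single edge, and otherwise a dart of the tangle different from \<open>b\<close>.
      Either is already good, and a second slide across the same marker reaches
      \<open>b\<close>.\<close>
    have oc: "opp E ?c = opp E' ?c \<and> opp E ?c \<noteq> b \<and> good (opp E ?c)"
    proof (cases "?c = opp T b")
      case True
      then show ?thesis using o(3,4) good_u nu(1)[OF b(1)] by simp
    next
      case False
      then have e: "opp E ?c = opp T ?c" "opp E' ?c = opp T ?c" using o(5)[OF b(2,3)] by simp_all
      have "opp T ?c \<in> darts T" "opp T ?c \<noteq> b"
        using opp_darts[OF LT b(2)] opp_opp[OF LT b(2)] False by auto
      then show ?thesis using e good_x by simp
    qed
    have "marker E ?c" "marker E' ?c" using marker_rot[of E b] marker_rot[of E' b] m L by (simp_all add: link_diagram_iff)
    then have "removable_marker E ?c" "removable_marker E' ?c"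
      using m oc by (auto simp: removable_marker_def)
    then have "good (opp E ?c) \<longleftrightarrow> good b" using slide[of ?c] m oc by simp
    then have "good b" using oc by blast
    then show ?thesis using good_u good_u' good_x by blast
  qed
  have oR: "opp ?R = opp D" by (simp add: omega3_result_simps)
  have oD: "opp D t1 \<in> darts D" "opp D t2 \<in> darts D" "opp D t3 \<in> darts D" using P.t opp_darts[OF P.D] by simp_all
  note PQ = P.opp_X3[folded E] Q.opp_X3[folded E', unfolded oR] P.marker_X3[folded E] Q.marker_X3[folded E']
  have "good t1 \<and> good (opp D t1) \<and> (\<forall>x\<in>darts T1. good x)"
    by (rule strand[OF P.T(1) P.disj(1) P.t(1) oD(1) inside1]) (simp_all add: PQ)
  moreover have "good t2 \<and> good (opp D t2) \<and> (\<forall>x\<in>darts T2. good x)"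
    by (rule strand[OF P.T(2) P.disj(2) P.t(2) oD(2) inside2]) (simp_all add: PQ)
  moreover have "good t3 \<and> good (opp D t3) \<and> (\<forall>x\<in>darts T3. good x)"
    by (rule strand[OF P.T(3) P.disj(3) P.t(3) oD(3) inside3]) (simp_all add: PQ)
  ultimately have "good d" using d outside unfolding dartsE by blast
  then show ?thesis unfolding good_def .
qed

text \<open>Even trivial rectangles leave their distinguished markers on the three edges, so an
  \<Omega>3 move becomes a star move only after an isotopy on both sides that adds these
  markers.\<close>

lemma omega3_star_of_omega3:
  assumes "omega3 D D'"
  shows "\<exists>E E'. isotopic D E \<and> isotopic D' E' \<and> omega3_star E E'"
proof -
  obtain t1 t2 t3 where L: "link_diagram D" "link_diagram D'" and tri: "omega3_triangle D t1 t2 t3"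
    and D': "D' = omega3_result t1 t2 t3 D"
    using assms by (auto simp: omega3_def)
  have LD: "local_diagram D" using L(1) by (simp add: link_diagram_iff)
  obtain n where n: "\<And>k. fresh (n + k) D" using ex_fresh[OF LD] by blast
  have fr: "fresh n D" "fresh (n + 6) D" "fresh (n + 12) D" using n[of 0] n[of 6] n[of 12] by simp_all
  have s: "star_data D t1 t2 t3 (straight n) n (straight (n + 6)) (n + 6) (straight (n + 12)) (n + 12)"
    using L tri rectangle_straight fr unfolding star_data_def D'
    by (auto simp: fresh_def)
  have iso: "link_diagram (ins t3 (straight (n + 12)) (n + 12) (ins t2 (straight (n + 6)) (n + 6) (ins t1 (straight n) n X))) \<and>
      isotopic X (ins t3 (straight (n + 12)) (n + 12) (ins t2 (straight (n + 6)) (n + 6) (ins t1 (straight n) n X)))"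
    if X: "link_diagram X" "darts X = darts D" for X
  proof -
    let ?X1 = "ins t1 (straight n) n X"
    let ?X2 = "ins t2 (straight (n + 6)) (n + 6) ?X1"
    have t: "t1 \<in> darts X" "t2 \<in> darts ?X1" "t3 \<in> darts ?X2"
      using omega3_triangle_darts(1-3)[OF LD tri] X(2) by simp_all
    have f: "fresh n X" "fresh (n + 6) ?X1" "fresh (n + 12) ?X2"
      using fr X(2) by (auto simp: fresh_def)
    have L1: "link_diagram ?X1" using link_straight[OF X(1) t(1) f(1)] .
    have L2: "link_diagram ?X2" using link_straight[OF L1 t(2) f(2)] .
    show ?thesis
      using link_straight[OF L2 t(3) f(3)] isotopic_straight[OF X(1) t(1) f(1)]
        isotopic_straight[OF L1 t(2) f(2)] isotopic_straight[OF L2 t(3) f(3)]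
      by (meson isotopic_sym isotopic_trans)
  qed
  show ?thesis
    using iso[OF L(1) refl] iso[OF L(2)] s unfolding omega3_star_iff D' omega3_result_simps by blast
qed

section \<open>Sorting the moves\<close>

declare One_nat_def [simp] add_2_eq_Suc' [simp]

text \<open>\<open>transforms\<close> puts an isotopy before every move and one after the last.
  Allowing isotopies at both ends of each single move makes moves depend only on isotopy classes, so
  that neighbours can be exchanged.\<close>

definition move_step :: "move \<Rightarrow> diagram \<Rightarrow> diagram \<Rightarrow> bool" where
  "move_step m D E \<longleftrightarrow> (\<exists>A B. isotopic D A \<and> move_rel m A B \<and> isotopic B E)"

lemma move_step_up: "move_step Omega1_up D E \<longleftrightarrow> kink_added D E"
proof
  assume "move_step Omega1_up D E"
  then obtain A B where "isotopic D A" "omega1_down B A" "isotopic B E"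
    by (auto simp: move_step_def omega1_up_def)
  then show "kink_added D E"
    using kink_added_isotopic[OF omega1_down_kink_added] isotopic_sym by blast
next
  assume "kink_added D E"
  then obtain E' D' where "isotopic E E'" "omega1_down E' D'" "isotopic D' D"
    using kink_added_omega1_down by blast
  then show "move_step Omega1_up D E"
    unfolding move_step_def move_rel.simps omega1_up_def using isotopic_sym by blast
qed

lemma move_step_down: "move_step Omega1_down D E \<longleftrightarrow> kink_added E D"
proof
  assume "move_step Omega1_down D E"
  then obtain A B where "isotopic D A" "omega1_down A B" "isotopic B E"
    by (auto simp: move_step_def)
  then show "kink_added E D"
    using kink_added_isotopic[OF omega1_down_kink_added] isotopic_sym by blast
next
  assume "kink_added E D"
  then show "move_step Omega1_down D E"
    unfolding move_step_def move_rel.simps using kink_added_omega1_down by blast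
qed

lemma move_step_omega3: "move_step Omega3 D E \<Longrightarrow> move_step Omega3_star D E"
  unfolding move_step_def move_rel.simps
  using omega3_star_of_omega3 isotopic_trans isotopic_sym by meson

text \<open>Both parts come from one insertion at the same dart of \<open>A\<close> and
  \<open>B\<close>. Read forwards it delays the removal of a kink until after the star move; read
  backwards it brings the creation of a kink in front of it.\<close>

lemma kink_added_star:
  assumes "omega3_star A B"
  shows "kink_added A D \<Longrightarrow> \<exists>G. move_step Omega3_star D G \<and> kink_added B G"
    and "kink_added B D \<Longrightarrow> \<exists>G. move_step Omega3_star G D \<and> kink_added A G"
proof -
  have L: "link_diagram A" "link_diagram B" using assms by (simp_all add: omega3_star_def)
  note dAB = omega3_star_darts[OF assms]
  have fr: "fresh n B \<longleftrightarrow> fresh n A" for n by (simp add: fresh_def dAB)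
  show "\<exists>G. move_step Omega3_star D G \<and> kink_added B G" if D: "kink_added A D"
  proof -
    obtain d n p where d: "d \<in> darts A" "fresh n A" "isotopic D (ins d (kinked p n) n A)"
      using D by (auto simp: kink_added_def)
    obtain F F' where F: "isotopic (ins d (kinked p n) n A) F" "isotopic (ins d (kinked p n) n B) F'" "omega3_star F F'"
      using omega3_star_kinked[OF assms d(1,2)] by blast
    have "move_step Omega3_star D F'"
      unfolding move_step_def move_rel.simps using isotopic_trans[OF d(3) F(1)] F(3) isotopic_refl by blast
    moreover have "kink_added B F'"
      unfolding kink_added_def using L(2) d(1,2) isotopic_sym[OF F(2)] by (auto simp: dAB fr)
    ultimately show ?thesis by blast
  qed
  show "\<exists>G. move_step Omega3_star G D \<and> kink_added A G" if D: "kink_added B D"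
  proof -
    obtain d n p where d: "d \<in> darts A" "fresh n A" "isotopic D (ins d (kinked p n) n B)"
      using D by (auto simp: kink_added_def dAB fr)
    obtain F F' where F: "isotopic (ins d (kinked p n) n A) F" "isotopic (ins d (kinked p n) n B) F'" "omega3_star F F'"
      using omega3_star_kinked[OF assms d(1,2)] by blast
    have "move_step Omega3_star F D"
      unfolding move_step_def move_rel.simps
      using isotopic_refl F(3) isotopic_sym[OF isotopic_trans[OF d(3) F(2)]] by blast
    moreover have "kink_added A F"
      unfolding kink_added_def using L(1) d(1,2) isotopic_sym[OF F(1)] by blast
    ultimately show ?thesis by blast
  qed
qed

definition exchanges :: "move \<Rightarrow> move \<Rightarrow> bool" where
  "exchanges m k \<longleftrightarrow> (\<forall>D E F. move_step m D E \<longrightarrow> move_step k E F \<longrightarrow>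
     (\<exists>G. move_step k D G \<and> move_step m G F))"

text \<open>\<open>D\<close> and \<open>F\<close> are both \<open>E\<close> with one more kink, and
  the new intermediate diagram carries both kinks.\<close>

lemma exchanges_down_up: "exchanges Omega1_down Omega1_up"
  unfolding exchanges_def move_step_up move_step_down using kink_added_swap by blast

lemma exchanges_down_star: "exchanges Omega1_down Omega3_star"
  unfolding exchanges_def move_step_down
proof (intro allI impI)
  fix D E F assume "kink_added E D" "move_step Omega3_star E F"
  then obtain A B where A: "isotopic E A" "omega3_star A B" "isotopic B F"
    by (auto simp: move_step_def)
  have "kink_added A D" by (rule kink_added_isotopic[OF \<open>kink_added E D\<close> A(1) isotopic_refl])
  then show "\<exists>G. move_step Omega3_star D G \<and> kink_added F G"
    using kink_added_star(1)[OF A(2)] kink_added_isotopic[OF _ A(3) isotopic_refl] by blast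
qed

lemma exchanges_star_up: "exchanges Omega3_star Omega1_up"
  unfolding exchanges_def move_step_up
proof (intro allI impI)
  fix D E F assume "move_step Omega3_star D E" "kink_added E F"
  then obtain A B where A: "isotopic D A" "omega3_star A B" "isotopic B E"
    by (auto simp: move_step_def)
  have "kink_added B F" by (rule kink_added_isotopic[OF \<open>kink_added E F\<close> isotopic_sym[OF A(3)] isotopic_refl])
  then show "\<exists>G. kink_added D G \<and> move_step Omega3_star G F"
    using kink_added_star(2)[OF A(2)] kink_added_isotopic[OF _ isotopic_sym[OF A(1)] isotopic_refl] by blast
qed

section \<open>Rearranging lists of moves\<close>

lemma transforms_isotopic:
  assumes "transforms ms D F" "isotopic D' D"
  shows "transforms ms D' F"
  using assms by (cases rule: transforms.cases) (auto intro: transforms.intros isotopic_trans)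

lemma transforms_Cons_iff: "transforms (m # ms) D F \<longleftrightarrow> (\<exists>E. move_step m D E \<and> transforms ms E F)"
proof
  assume "transforms (m # ms) D F"
  then show "\<exists>E. move_step m D E \<and> transforms ms E F"
    unfolding move_step_def by (cases rule: transforms.cases) (use isotopic_refl in blast)
next
  assume "\<exists>E. move_step m D E \<and> transforms ms E F"
  then show "transforms (m # ms) D F"
    unfolding move_step_def using transforms_isotopic transforms.Cons by blast
qed

lemma transforms_push:
  assumes "exchanges m k" "move_step m D E" "transforms (replicate a k @ ns) E F"
  shows "transforms (replicate a k @ m # ns) D F"
  using assms(2,3)
proof (induction a arbitrary: D E)
  case 0
  then show ?case by (auto simp: transforms_Cons_iff)
next
  case (Suc a)
  then obtain E' where "move_step k E E'" "transforms (replicate a k @ ns) E' F"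
    by (auto simp: transforms_Cons_iff)
  then obtain G where "move_step k D G" "move_step m G E'" "transforms (replicate a k @ ns) E' F"
    using assms(1) Suc.prems(1) unfolding exchanges_def by blast
  then show ?case using Suc.IH by (auto simp: transforms_Cons_iff)
qed

lemma transforms_append_mono:
  assumes "transforms (xs @ ys) D F" "\<And>G. transforms ys G F \<Longrightarrow> transforms zs G F"
  shows "transforms (xs @ zs) D F"
  using assms(1) by (induction xs arbitrary: D) (use assms(2) in \<open>auto simp: transforms_Cons_iff\<close>)

text \<open>Insertion sort: the tail is already sorted, and the first move travels to the right
  through it. A creating move stays in place, a removing move passes the creating moves and the star
  moves, and an \<Omega>3 move is turned into a star move and passes the creating moves.\<close>

lemma transforms_sort:
  assumes "transforms ms D F" "set ms \<subseteq> {Omega1_up, Omega1_down, Omega3}"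
  shows "transforms (replicate (count_list ms Omega1_up) Omega1_up @
    replicate (count_list ms Omega3) Omega3_star @ replicate (count_list ms Omega1_down) Omega1_down) D F"
  using assms
proof (induction ms arbitrary: D)
  case Nil
  then show ?case by simp
next
  case (Cons m ms)
  let ?a = "count_list ms Omega1_up" and ?b = "count_list ms Omega3" and ?c = "count_list ms Omega1_down"
  obtain E where E: "move_step m D E" "transforms ms E F"
    using Cons.prems(1) by (auto simp: transforms_Cons_iff)
  then have IH: "transforms (replicate ?a Omega1_up @ replicate ?b Omega3_star @ replicate ?c Omega1_down) E F"
    using Cons.IH Cons.prems(2) by simp
  consider "m = Omega1_up" | "m = Omega1_down" | "m = Omega3" using Cons.prems(2) by auto
  then show ?case
  proof cases
    case 1
    then show ?thesis using E(1) IH by (auto simp: transforms_Cons_iff)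
  next
    case 2
    have "transforms (replicate ?a Omega1_up @ Omega1_down # replicate ?b Omega3_star @ replicate ?c Omega1_down) D F"
      using transforms_push[OF exchanges_down_up _ IH] E(1) 2 by simp
    moreover have "transforms (Omega1_down # replicate ?b Omega3_star @ replicate ?c Omega1_down) G F \<Longrightarrow>
        transforms (replicate ?b Omega3_star @ Omega1_down # replicate ?c Omega1_down) G F" for G
      using transforms_push[OF exchanges_down_star] by (auto simp: transforms_Cons_iff)
    ultimately have "transforms (replicate ?a Omega1_up @ replicate ?b Omega3_star @ Omega1_down # replicate ?c Omega1_down) D F"
      by (rule transforms_append_mono)
    then show ?thesis using 2 by simp
  next
    case 3
    then have "transforms (replicate ?a Omega1_up @ Omega3_star # replicate ?b Omega3_star @ replicate ?c Omega1_down) D F"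
      using transforms_push[OF exchanges_star_up move_step_omega3 IH] E(1) by simp
    then show ?thesis using 3 by simp
  qed
qed

theorem theorem4p9:
  fixes D\<^sub>1 D\<^sub>2 :: diagram
  assumes "link_diagram D\<^sub>1" and "link_diagram D\<^sub>2"
  shows "((\<exists>ms. set ms \<subseteq> {Omega1_up, Omega1_down, Omega3} \<and> transforms ms D\<^sub>1 D\<^sub>2) \<longrightarrow>
            (\<exists>ns. I_generalized_ordered ns \<and> transforms ns D\<^sub>1 D\<^sub>2)) \<and>
         (\<forall>ms a b c. set ms \<subseteq> {Omega1_up, Omega1_down, Omega3} \<and> transforms ms D\<^sub>1 D\<^sub>2 \<and>
            count_list ms Omega1_up = a \<and> count_list ms Omega3 = b \<and>
            count_list ms Omega1_down = c \<longrightarrow>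
            (\<exists>ns. I_generalized_ordered ns \<and> transforms ns D\<^sub>1 D\<^sub>2 \<and>
               count_list ns Omega1_up = a \<and> count_list ns Omega3_star = b \<and>
               count_list ns Omega1_down = c))"
proof -
  have replicate: "count_list (replicate n x) y = (if x = y then n else 0)" for n and x y :: move
    by (induction n) auto
  have main: "\<exists>ns. I_generalized_ordered ns \<and> transforms ns D\<^sub>1 D\<^sub>2 \<and>
      count_list ns Omega1_up = count_list ms Omega1_up \<and>
      count_list ns Omega3_star = count_list ms Omega3 \<and>
      count_list ns Omega1_down = count_list ms Omega1_down"
    if "set ms \<subseteq> {Omega1_up, Omega1_down, Omega3}" "transforms ms D\<^sub>1 D\<^sub>2" for ms
    using transforms_sort[OF that(2,1)]
    by (intro exI[of _ "replicate (count_list ms Omega1_up) Omega1_up @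
        replicate (count_list ms Omega3) Omega3_star @ replicate (count_list ms Omega1_down) Omega1_down"])
      (auto simp: I_generalized_ordered_def replicate)
  then show ?thesis by blast
qed

end
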